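(* Let $\mathbf{u}_h=\tfrac12\nabla^\perp h\in W^{3,2}_{\mathrm{div}}(\mathbb{T}^2;\mathbb{R}^2)$, $f\in W^{2,2}(\mathbb{T}^2)$ and $(b_0,\omega_0)\in\mathcal{M}=W^{3,2}(\mathbb{T}^2)\times W^{2,2}(\mathbb{T}^2)$. Let $(b^1,\omega^1,T^1)$ and $(b^2,\omega^2,T^2)$ be two local strong solutions of the thermal quasi-geostrophic (TQG) system with the same data $\mathbf{u}_h$, $f$ and the same initial condition $(b_0,\omega_0)$. Then $$\|(b^1-b^2)(t)\|_{2,2}^2+\|(\omega^1-\omega^2)(t)\|_{1,2}^2=0$$ for all $t\in[0,T]$, where $T=\min\{T^1,T^2\}$.
   Context: $\mathbb{T}^2$ is the two-dimensional flat torus, $\nabla^\perp=(-\partial_y,\partial_x)$, $W^{k,2}(\mathbb{T}^2)$ are the usual $L^2$-based Sobolev spaces with norm $\|\cdot\|_{k,2}$, and $W^{k,2}_{\mathrm{div}}(\mathbb{T}^2;\mathbb{R}^2)$ is the space of weakly divergence-free vector fields in $W^{k,2}$. Standing assumption: all functions under consideration have zero average over $\mathbb{T}^2$. The TQG system for $(b,\omega)$ is $$\partial_t b+\mathbf{u}\cdot\nabla b=0,\qquad \partial_t\omega+\mathbf{u}\cdot\nabla(\omega-b)=-\mathbf{u}_h\cdot\nabla b,$$ $$\mathbf{u}=\nabla^\perp\psi,\qquad \mathbf{u}_h=\tfrac12\nabla^\perp h,\qquad \omega=(\Delta-1)\psi+f,$$ where $h$ and $f$ are given time-independent functions. Local strong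 solution: given $T>0$, $(b,\omega,T)$ is a local strong solution with initial condition $(b_0,\omega_0)$ if $b\in C([0,T];W^{3,2}(\mathbb{T}^2))$, $\omega\in C([0,T];W^{2,2}(\mathbb{T}^2))$, and for all $t\in[0,T]$ $$b(t)=b_0-\int_0^t\mathrm{div}(b\mathbf{u})\,d\tau,\qquad \omega(t)=\omega_0-\int_0^t\big[\mathrm{div}((\omega-b)\mathbf{u})+\mathrm{div}(b\mathbf{u}_h)\big]\,d\tau,$$ with $\mathbf{u}=\nabla^\perp(\Delta-1)^{-1}(\omega-f)$. *)

theory Defs
  imports "HOL-Analysis.Analysis"
begin

text \<open>
  The flat torus is the plane modulo the integer lattice. Its measure is Lebesgue measure on
  the fundamental cell. An integrable function on the torus carries no more information than its
  restriction to the cell; the identification of opposite sides enters through the test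
  functions below, which are periodic on the whole plane.
\<close>

definition torus :: "(real \<times> real) measure" where
  "torus = restrict_space lborel ({0..<1} \<times> {0..<1})"

definition square_integrable :: "(real \<times> real \<Rightarrow> real) \<Rightarrow> bool" where
  "square_integrable f \<longleftrightarrow> f \<in> borel_measurable torus \<and> integrable torus (\<lambda>p. (f p)\<^sup>2)"

definition l2_eq :: "(real \<times> real \<Rightarrow> real) \<Rightarrow> (real \<times> real \<Rightarrow> real) \<Rightarrow> bool" where
  "l2_eq f g \<longleftrightarrow> square_integrable f \<and> square_integrable g \<and> (AE p in torus. f p = g p)"

lemma square_integrable_mult:
  assumes "square_integrable f" "square_integrable g"
  shows "integrable torus (\<lambda>p. f p * g p)"
proof (rule Bochner_Integration.integrable_bound)
  show "integrable torus (\<lambda>p. (f p)\<^sup>2 + (g p)\<^sup>2)"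
    using assms by (auto simp: square_integrable_def)
  show "(\<lambda>p. f p * g p) \<in> borel_measurable torus"
    using assms by (auto simp: square_integrable_def)
  have "\<bar>a * b\<bar> \<le> a\<^sup>2 + b\<^sup>2" for a b :: real
  proof -
    have "2 * (\<bar>a\<bar> * \<bar>b\<bar>) \<le> a\<^sup>2 + b\<^sup>2"
      using sum_squares_bound[of "\<bar>a\<bar>" "\<bar>b\<bar>"] by (simp add: mult.assoc)
    moreover have "0 \<le> \<bar>a\<bar> * \<bar>b\<bar>" by simp
    ultimately show ?thesis unfolding abs_mult by linarith
  qed
  then show "AE p in torus. norm (f p * g p) \<le> norm ((f p)\<^sup>2 + (g p)\<^sup>2)"
    by (auto simp del: abs_mult)
qed

lemma square_integrable_add:
  assumes "square_integrable f" "square_integrable g"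
  shows "square_integrable (\<lambda>p. f p + g p)"
proof -
  have "integrable torus (\<lambda>p. (f p)\<^sup>2 + (g p)\<^sup>2 + 2 * (f p * g p))"
    using assms square_integrable_mult[OF assms]
    by (intro Bochner_Integration.integrable_add integrable_mult_right)
      (auto simp: square_integrable_def)
  then show ?thesis
    using assms by (auto simp: square_integrable_def power2_sum mult.assoc)
qed

lemma square_integrable_cmult:
  "square_integrable f \<Longrightarrow> square_integrable (\<lambda>p. c * f p)"
  by (auto simp: square_integrable_def power_mult_distrib)

lemma square_integrable_zero: "square_integrable (\<lambda>p. 0)"
  by (simp add: square_integrable_def)

quotient_type torus_l2 = "real \<times> real \<Rightarrow> real" / partial: l2_eq
proof (rule part_equivpI)
  show "\<exists>f. l2_eq f f"
    using square_integrable_zero by (auto simp: l2_eq_def)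
  show "symp l2_eq" by (auto simp: symp_def l2_eq_def)
  show "transp l2_eq" by (auto simp: transp_def l2_eq_def)
qed

text \<open>A representative of the class, determined only almost everywhere.\<close>

definition fn :: "torus_l2 \<Rightarrow> real \<times> real \<Rightarrow> real" where
  "fn u = rep_torus_l2 u"

lemma fn_square_integrable: "square_integrable (fn u)"
  using Quotient3_rep_reflp[OF Quotient3_torus_l2, of u] by (simp add: fn_def l2_eq_def)

lemma abs_fn: "abs_torus_l2 (fn u) = u"
  unfolding fn_def by (rule Quotient3_abs_rep[OF Quotient3_torus_l2])

lemma fn_abs: "square_integrable f \<Longrightarrow> AE p in torus. fn (abs_torus_l2 f) p = f p"
  using Quotient3_rep_abs[OF Quotient3_torus_l2, of f] by (simp add: fn_def l2_eq_def)

instantiation torus_l2 :: real_inner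
begin

lift_definition zero_torus_l2 :: torus_l2 is "\<lambda>p. 0"
  using square_integrable_zero by (simp add: l2_eq_def)

lift_definition plus_torus_l2 :: "torus_l2 \<Rightarrow> torus_l2 \<Rightarrow> torus_l2" is "\<lambda>f g p. f p + g p"
  by (auto simp: l2_eq_def square_integrable_add)

lift_definition scaleR_torus_l2 :: "real \<Rightarrow> torus_l2 \<Rightarrow> torus_l2" is "\<lambda>c f p. c * f p"
  by (auto simp: l2_eq_def square_integrable_cmult)

lift_definition uminus_torus_l2 :: "torus_l2 \<Rightarrow> torus_l2" is "\<lambda>f p. - f p"
  using square_integrable_cmult[where c = "-1"] by (auto simp: l2_eq_def)

definition minus_torus_l2 :: "torus_l2 \<Rightarrow> torus_l2 \<Rightarrow> torus_l2" where
  "minus_torus_l2 u v = u + - v"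

lift_definition inner_torus_l2 :: "torus_l2 \<Rightarrow> torus_l2 \<Rightarrow> real"
  is "\<lambda>f g. LINT p|torus. f p * g p"
  by (rule integral_cong_AE) (auto simp: l2_eq_def square_integrable_def)

definition norm_torus_l2 :: "torus_l2 \<Rightarrow> real" where
  "norm_torus_l2 u = sqrt (inner u u)"

definition sgn_torus_l2 :: "torus_l2 \<Rightarrow> torus_l2" where
  "sgn_torus_l2 u = inverse (norm u) *\<^sub>R u"

definition dist_torus_l2 :: "torus_l2 \<Rightarrow> torus_l2 \<Rightarrow> real" where
  "dist_torus_l2 u v = norm (u - v)"

definition uniformity_torus_l2 :: "(torus_l2 \<times> torus_l2) filter" where
  "uniformity_torus_l2 = (INF e\<in>{0<..}. principal {(u, v). dist u v < e})"

definition open_torus_l2 :: "torus_l2 set \<Rightarrow> bool" where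
  "open_torus_l2 U \<longleftrightarrow> (\<forall>u\<in>U. eventually (\<lambda>(u', v). u' = u \<longrightarrow> v \<in> U) uniformity)"

instance
proof
  fix u v w :: torus_l2 and a c :: real
  show "u + v + w = u + (v + w)"
    by transfer (auto simp: l2_eq_def square_integrable_add add.assoc)
  show "u + v = v + u"
    by transfer (auto simp: l2_eq_def square_integrable_add add.commute)
  show "0 + u = u"
    by transfer (auto simp: l2_eq_def)
  show "- u + u = 0"
    by transfer (auto simp: l2_eq_def square_integrable_zero)
  show "u - v = u + - v"
    by (rule minus_torus_l2_def)
  show "a *\<^sub>R (u + v) = a *\<^sub>R u + a *\<^sub>R v"
    by transfer (auto simp: l2_eq_def square_integrable_add square_integrable_cmult distrib_left)
  show "(a + c) *\<^sub>R u = a *\<^sub>R u + c *\<^sub>R u"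
    by transfer (auto simp: l2_eq_def square_integrable_add square_integrable_cmult distrib_right)
  show "a *\<^sub>R c *\<^sub>R u = (a * c) *\<^sub>R u"
    by transfer (auto simp: l2_eq_def square_integrable_cmult mult.assoc)
  show "1 *\<^sub>R u = u"
    by transfer (auto simp: l2_eq_def)
  show "sgn u = inverse (norm u) *\<^sub>R u" by (rule sgn_torus_l2_def)
  show "dist u v = norm (u - v)" by (rule dist_torus_l2_def)
  show "uniformity = (INF e\<in>{0<..}. principal {(u, v :: torus_l2). dist u v < e})"
    by (rule uniformity_torus_l2_def)
  show "open U \<longleftrightarrow> (\<forall>u\<in>U. eventually (\<lambda>(u', v). u' = u \<longrightarrow> v \<in> U) uniformity)"
    for U :: "torus_l2 set"
    by (rule open_torus_l2_def)
  show "inner u v = inner v u"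
    by transfer (simp add: mult.commute)
  show "inner (u + v) w = inner u w + inner v w"
    by transfer (simp add: l2_eq_def distrib_right square_integrable_mult)
  show "inner (a *\<^sub>R u) v = a * inner u v"
    by transfer (simp add: mult.assoc)
  show "0 \<le> inner u u"
    by transfer simp
  show "inner u u = 0 \<longleftrightarrow> u = 0"
  proof transfer
    fix f assume f: "l2_eq f f"
    then have "(LINT p|torus. f p * f p) = 0 \<longleftrightarrow> (AE p in torus. f p * f p = 0)"
      by (intro integral_nonneg_eq_0_iff_AE)
        (auto simp: l2_eq_def square_integrable_mult)
    then show "(LINT p|torus. f p * f p) = 0 \<longleftrightarrow> l2_eq f (\<lambda>p. 0)"
      using f by (auto simp: l2_eq_def square_integrable_zero)
  qed
  show "norm u = sqrt (inner u u)" by (rule norm_torus_l2_def)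
qed

end

definition zero_average :: "torus_l2 \<Rightarrow> bool" where
  "zero_average u \<longleftrightarrow> (LINT p|torus. fn u p) = 0"

definition D1 :: "(real \<times> real \<Rightarrow> real) \<Rightarrow> real \<times> real \<Rightarrow> real" where
  "D1 \<phi> = (\<lambda>(x, y). deriv (\<lambda>s. \<phi> (s, y)) x)"

definition D2 :: "(real \<times> real \<Rightarrow> real) \<Rightarrow> real \<times> real \<Rightarrow> real" where
  "D2 \<phi> = (\<lambda>(x, y). deriv (\<lambda>s. \<phi> (x, s)) y)"

primrec C_k :: "nat \<Rightarrow> (real \<times> real \<Rightarrow> real) \<Rightarrow> bool" where
  "C_k 0 \<phi> \<longleftrightarrow> continuous_on UNIV \<phi>"
| "C_k (Suc k) \<phi> \<longleftrightarrow> continuous_on UNIV \<phi> \<and>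
     (\<forall>x y. (\<lambda>s. \<phi> (s, y)) field_differentiable at x \<and>
            (\<lambda>s. \<phi> (x, s)) field_differentiable at y) \<and>
     C_k k (D1 \<phi>) \<and> C_k k (D2 \<phi>)"

definition test_function :: "(real \<times> real \<Rightarrow> real) \<Rightarrow> bool" where
  "test_function \<phi> \<longleftrightarrow> (\<forall>k. C_k k \<phi>) \<and>
     (\<forall>x y. \<phi> (x + 1, y) = \<phi> (x, y) \<and> \<phi> (x, y + 1) = \<phi> (x, y))"

definition has_weak_partial :: "nat \<times> nat \<Rightarrow> torus_l2 \<Rightarrow> torus_l2 \<Rightarrow> bool" where
  "has_weak_partial \<alpha> u v \<longleftrightarrow> (\<forall>\<phi>. test_function \<phi> \<longrightarrow>
     (LINT p|torus. fn u p * (D1 ^^ fst \<alpha>) ((D2 ^^ snd \<alpha>) \<phi>) p)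
       = (- 1) ^ (fst \<alpha> + snd \<alpha>) * (LINT p|torus. fn v p * \<phi> p))"

definition weak_partial :: "nat \<times> nat \<Rightarrow> torus_l2 \<Rightarrow> torus_l2" where
  "weak_partial \<alpha> u = (THE v. has_weak_partial \<alpha> u v)"

definition multi_indices :: "nat \<Rightarrow> (nat \<times> nat) set" where
  "multi_indices k = {\<alpha>. fst \<alpha> + snd \<alpha> \<le> k}"

lemma finite_multi_indices: "finite (multi_indices k)"
  by (rule finite_subset[of _ "{..k} \<times> {..k}"]) (auto simp: multi_indices_def)

definition sobolev :: "nat \<Rightarrow> torus_l2 set" where
  "sobolev k = {u. \<forall>\<alpha>\<in>multi_indices k. \<exists>v. has_weak_partial \<alpha> u v}"

definition sobolev_norm :: "nat \<Rightarrow> torus_l2 \<Rightarrow> real" where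
  "sobolev_norm k u = sqrt (\<Sum>\<alpha>\<in>multi_indices k. (norm (weak_partial \<alpha> u))\<^sup>2)"

definition sobolev0 :: "nat \<Rightarrow> torus_l2 set" where
  "sobolev0 k = {u \<in> sobolev k. zero_average u}"

definition continuous_in_sobolev0 :: "nat \<Rightarrow> real \<Rightarrow> (real \<Rightarrow> torus_l2) \<Rightarrow> bool" where
  "continuous_in_sobolev0 k T u \<longleftrightarrow> (\<forall>t\<in>{0..T}. u t \<in> sobolev0 k \<and>
     ((\<lambda>s. sobolev_norm k (u s - u t)) \<longlongrightarrow> 0) (at t within {0..T}))"

text \<open>
  The weak divergence is stated for an integrable vector field given by its two component
  functions, because a product of two square integrable functions is a priori only integrable.
\<close>

definition has_weak_div ::
  "(real \<times> real \<Rightarrow> real) \<Rightarrow> (real \<times> real \<Rightarrow> real) \<Rightarrow> torus_l2 \<Rightarrow> bool" where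
  "has_weak_div F1 F2 g \<longleftrightarrow> integrable torus F1 \<and> integrable torus F2 \<and>
     (\<forall>\<phi>. test_function \<phi> \<longrightarrow>
       (LINT p|torus. F1 p * D1 \<phi> p + F2 p * D2 \<phi> p) = - (LINT p|torus. fn g p * \<phi> p))"

text \<open>\<open>has_div_flux a v g\<close> reads $\mathrm{div}(a\,v) = g$.\<close>

definition has_div_flux :: "torus_l2 \<Rightarrow> torus_l2 \<times> torus_l2 \<Rightarrow> torus_l2 \<Rightarrow> bool" where
  "has_div_flux a v g \<longleftrightarrow>
     has_weak_div (\<lambda>p. fn a p * fn (fst v) p) (\<lambda>p. fn a p * fn (snd v) p) g"

definition sobolev_div :: "nat \<Rightarrow> (torus_l2 \<times> torus_l2) set" where
  "sobolev_div k = {v. fst v \<in> sobolev0 k \<and> snd v \<in> sobolev0 k \<and>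
     has_weak_div (fn (fst v)) (fn (snd v)) 0}"

definition grad_perp :: "torus_l2 \<Rightarrow> torus_l2 \<times> torus_l2" where
  "grad_perp \<psi> = (- weak_partial (0, 1) \<psi>, weak_partial (1, 0) \<psi>)"

definition laplacian :: "torus_l2 \<Rightarrow> torus_l2" where
  "laplacian \<psi> = weak_partial (2, 0) \<psi> + weak_partial (0, 2) \<psi>"

text \<open>
  The graph of $(\Delta - 1)^{-1}$: \<open>is_stream_function g \<psi>\<close> reads
  $\psi = (\Delta - 1)^{-1} g$.
\<close>

definition is_stream_function :: "torus_l2 \<Rightarrow> torus_l2 \<Rightarrow> bool" where
  "is_stream_function g \<psi> \<longleftrightarrow> \<psi> \<in> sobolev0 2 \<and> laplacian \<psi> - \<psi> = g"

text \<open>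
  The three divergences \<open>Gb\<close>, \<open>Gw\<close>, \<open>Gh\<close> and the stream function \<open>\<psi>\<close> are determined uniquely
  by \<open>b\<close>, \<open>w\<close>, \<open>uh\<close>, \<open>f\<close>. The time integrals are integrals of functions with values in
  $L^2$ of the torus; the Henstock--Kurzweil integral agrees here with the Bochner integral,
  since the integrands are continuous in time.
\<close>

definition local_strong_solution ::
  "torus_l2 \<times> torus_l2 \<Rightarrow> torus_l2 \<Rightarrow> torus_l2 \<Rightarrow> torus_l2 \<Rightarrow>
   (real \<Rightarrow> torus_l2) \<Rightarrow> (real \<Rightarrow> torus_l2) \<Rightarrow> real \<Rightarrow> bool" where
  "local_strong_solution uh f b0 w0 b w T \<longleftrightarrow>
     0 < T \<and> continuous_in_sobolev0 3 T b \<and> continuous_in_sobolev0 2 T w \<and>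
     (\<exists>\<psi> Gb Gw Gh.
        (\<forall>\<tau>\<in>{0..T}.
           is_stream_function (w \<tau> - f) (\<psi> \<tau>) \<and>
           has_div_flux (b \<tau>) (grad_perp (\<psi> \<tau>)) (Gb \<tau>) \<and>
           has_div_flux (w \<tau> - b \<tau>) (grad_perp (\<psi> \<tau>)) (Gw \<tau>) \<and>
           has_div_flux (b \<tau>) uh (Gh \<tau>)) \<and>
        (\<forall>t\<in>{0..T}.
           Gb integrable_on {0..t} \<and> b t = b0 - integral {0..t} Gb \<and>
           (\<lambda>\<tau>. Gw \<tau> + Gh \<tau>) integrable_on {0..t} \<and>
           w t = w0 - integral {0..t} (\<lambda>\<tau>. Gw \<tau> + Gh \<tau>)))"

end

theory Submission
  imports Defs
begin

text \<open>
  Although the claim concerns the norms of $W^{2,2}\times W^{1,2}$, it suffices to run the energy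
  method one level lower. Put $\beta = b^1-b^2$, $\omega = \omega^1-\omega^2$ and let $\varphi$ solve
  $(\Delta-1)\varphi=\omega$. The energy
  $Z = \|\beta\|^2 + \|\varphi\|^2 + \|\nabla\varphi\|^2 = \langle\beta,\beta\rangle - \langle\omega,\varphi\rangle$
  satisfies $Z' \le C Z$: testing the vorticity equation with $\varphi$ removes the term
  $(\omega^2-b^2)\nabla^\perp\varphi\cdot\nabla\varphi$, and the remaining terms only need essential
  bounds on $b$, $\nabla b$, $\omega - b$, $\mathbf{u}_h$, $\mathbf{u}$ and $\nabla\mathbf{u}$.
  These bounds, and the regularity of $(\Delta-1)^{-1}$, are read off the Fourier coefficients, since
  $((1+k^2)(1+l^2))^{-1/2}$ is square summable over the frequencies. All integrations by parts
  are done for partial Fourier sums and passed to the limit in $L^2$. In time only the weak form of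
  the equations is used, in a discrete Gronwall argument, so that neither the completeness of $L^2$
  nor the continuity in time of the divergences is needed.
\<close>

section \<open>Trigonometric polynomials\<close>

text \<open>The divergences in the equations are known only as classes of L^2 tied to test
  functions, so an estimate in W^{2,2} x W^{1,2} would require differentiating the equations first.
  One level lower, a divergence is only ever paired with a function whose gradient lies in L^2.
  Testing the vorticity equation with \<phi> rather than \<omega> is essential: the difference of
  the two fluxes contains \<open>w2 - b2\<close> times the difference of the velocities, and moving
  the derivative onto this factor would require a bound on its gradient, which W^{2,2} does not give
  in two dimensions. In time, the energy is the quadratic form of a symmetric bilinear form B, and
  B(x,x) - B(y,y) = B(x - y, x + y). An increment of the energy is thus the time integral of the
  equations tested with the sum of the two endpoint values, which is fixed in time. Replacing this
  sum by twice the current value costs only differences of gradients, which are small by uniform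
  continuity.\<close>

definition mode :: "complex \<Rightarrow> int \<Rightarrow> int \<Rightarrow> real \<times> real \<Rightarrow> real" where
  "mode z k l = (\<lambda>(x, y). Re (z * cis (2 * pi * (k * x + l * y))))"

lemma mode_eq:
  "mode z k l (x, y) =
    Re z * cos (2 * pi * (k * x + l * y)) - Im z * sin (2 * pi * (k * x + l * y))"
  by (simp add: mode_def)

lemma mode_add: "mode (z + w) k l p = mode z k l p + mode w k l p"
  by (cases p) (simp add: mode_eq algebra_simps)

lemma mode_zero [simp]: "mode 0 k l p = 0"
  by (cases p) (simp add: mode_eq)

lemma abs_mode_le: "\<bar>mode z k l p\<bar> \<le> norm z"
proof (cases p)
  case (Pair x y)
  have "\<bar>Re (z * cis (2 * pi * (k * x + l * y)))\<bar> \<le> norm (z * cis (2 * pi * (k * x + l * y)))"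
    by (rule abs_Re_le_cmod)
  then show ?thesis
    by (simp add: Pair mode_def norm_mult)
qed

lemma mode_cnj: "mode (cnj z) (- k) (- l) p = mode z k l p"
proof (cases p)
  case (Pair x y)
  have "2 * pi * (of_int (- k) * x + of_int (- l) * y) = - (2 * pi * (k * x + l * y))"
    by (simp add: algebra_simps)
  then show ?thesis
    unfolding Pair mode_eq by (simp only: cos_minus sin_minus) simp
qed

text \<open>Product-to-sum in complex form: Re a Re b is half the sum of Re (a b) and Re (a cnj b).
  It makes the trigonometric polynomials an algebra and, through the mean values of the two modes,
  gives orthogonality.\<close>

lemma mode_mult:
  "mode w k l p * mode z m n p =
    mode (w * z / 2) (k + m) (l + n) p + mode (w * cnj z / 2) (k - m) (l - n) p"
proof (cases p)
  case (Pair x y)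
  define a where "a = w * cis (2 * pi * (k * x + l * y))"
  define b where "b = z * cis (2 * pi * (m * x + n * y))"
  have "Re a * Re b = Re (a * b / 2) + Re (a * cnj b / 2)"
    by (simp add: field_simps)
  moreover have "w * z / 2 * cis (2 * pi * (of_int (k + m) * x + of_int (l + n) * y)) = a * b / 2"
    by (simp add: a_def b_def cis_mult algebra_simps)
  moreover have "w * cnj z / 2 * cis (2 * pi * (of_int (k - m) * x + of_int (l - n) * y)) = a * cnj b / 2"
    by (simp add: a_def b_def cis_mult cis_cnj algebra_simps)
  ultimately show ?thesis
    unfolding Pair mode_def prod.case by (simp only: a_def[symmetric] b_def[symmetric])
qed

lemma mode_has_derivative_fst:
  "((\<lambda>s. mode z k l (s, y)) has_real_derivative mode (2 * pi * \<i> * k * z) k l (x, y)) (at x)"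
  unfolding mode_eq by (auto intro!: derivative_eq_intros simp: algebra_simps)

lemma mode_has_derivative_snd:
  "((\<lambda>s. mode z k l (x, s)) has_real_derivative mode (2 * pi * \<i> * l * z) k l (x, y)) (at y)"
  unfolding mode_eq by (auto intro!: derivative_eq_intros simp: algebra_simps)

lemma D1_mode: "D1 (mode z k l) = mode (2 * pi * \<i> * k * z) k l"
  unfolding D1_def using DERIV_imp_deriv[OF mode_has_derivative_fst] by auto

lemma D2_mode: "D2 (mode z k l) = mode (2 * pi * \<i> * l * z) k l"
  unfolding D2_def using DERIV_imp_deriv[OF mode_has_derivative_snd] by auto

lemma mode_continuous: "continuous_on UNIV (mode z k l)"
proof -
  have "mode z k l = (\<lambda>p::real \<times> real. Re (z * cis (2 * pi * (k * fst p + l * snd p))))"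
    by (auto simp: mode_def)
  then show ?thesis
    by (auto intro!: continuous_intros simp: cis_conv_exp)
qed

lemma mode_periodic:
  "mode z k l (x + 1, y) = mode z k l (x, y)" "mode z k l (x, y + 1) = mode z k l (x, y)"
proof -
  have "cis (2 * pi * (k * (x + 1) + l * y)) = cis (2 * pi * (k * x + l * y)) * cis (2 * pi * k)"
    by (simp add: cis_mult algebra_simps)
  moreover have "cis (2 * pi * (k * x + l * (y + 1))) = cis (2 * pi * (k * x + l * y)) * cis (2 * pi * l)"
    by (simp add: cis_mult algebra_simps)
  ultimately show "mode z k l (x + 1, y) = mode z k l (x, y)" "mode z k l (x, y + 1) = mode z k l (x, y)"
    unfolding mode_def by (simp_all only: prod.case cis_multiple_2pi[OF Ints_of_int] mult_1_right)
qed

text \<open>Linear combinations need no further rule: a scalar is absorbed in the coefficient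
  \<open>z\<close>, and one mode carries both cosine and sine. Every induction then has only two
  cases.\<close>

inductive trig :: "(real \<times> real \<Rightarrow> real) \<Rightarrow> bool" where
  trig_mode: "trig (mode z k l)"
| trig_add: "trig f \<Longrightarrow> trig g \<Longrightarrow> trig (\<lambda>p. f p + g p)"

lemma trig_const: "trig (\<lambda>p. c)"
  using trig_mode[of "of_real c" 0 0] by (simp add: mode_def split_def)

lemma trig_sum: "finite A \<Longrightarrow> (\<And>i. i \<in> A \<Longrightarrow> trig (f i)) \<Longrightarrow> trig (\<lambda>p. \<Sum>i\<in>A. f i p)"
  by (induction A rule: finite_induct) (auto intro: trig_const trig_add)

lemma trig_mult:
  assumes "trig f" "trig g" shows "trig (\<lambda>p. f p * g p)"
  using assms(1)
proof (induction rule: trig.induct)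
  case (trig_mode w k l)
  show ?case
    using assms(2)
  proof (induction rule: trig.induct)
    case (trig_mode z m n)
    have "(\<lambda>p. mode w k l p * mode z m n p) =
      (\<lambda>p. mode (w * z / 2) (k + m) (l + n) p + mode (w * cnj z / 2) (k - m) (l - n) p)"
      by (rule ext) (rule mode_mult)
    then show ?case by (simp add: trig.intros)
  qed (auto simp: distrib_left intro: trig_add)
qed (auto simp: distrib_right intro: trig_add)

lemma trig_cmult: "trig f \<Longrightarrow> trig (\<lambda>p. c * f p)"
  by (rule trig_mult[OF trig_const])

lemma trig_continuous: "trig f \<Longrightarrow> continuous_on UNIV f"
  by (induction rule: trig.induct) (auto intro!: continuous_intros mode_continuous)

lemma trig_periodic:
  "trig f \<Longrightarrow> f (x + 1, y) = f (x, y) \<and> f (x, y + 1) = f (x, y)"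
  by (induction rule: trig.induct) (auto simp: mode_periodic)

lemma trig_bounded: "trig f \<Longrightarrow> \<exists>K. \<forall>p. \<bar>f p\<bar> \<le> K"
proof (induction rule: trig.induct)
  case (trig_add f g)
  then obtain K L where "\<And>p. \<bar>f p\<bar> \<le> K" "\<And>p. \<bar>g p\<bar> \<le> L" by auto
  then have "\<bar>f p + g p\<bar> \<le> K + L" for p
    by (meson abs_triangle_ineq add_mono order_trans)
  then show ?case by blast
qed (auto intro: abs_mode_le)

lemma D1_eqI:
  assumes "\<And>x y. ((\<lambda>s. f (s, y)) has_real_derivative g (x, y)) (at x)"
  shows "D1 f = g"
  using DERIV_imp_deriv[OF assms] by (auto simp: D1_def)

lemma D2_eqI:
  assumes "\<And>x y. ((\<lambda>s. f (x, s)) has_real_derivative g (x, y)) (at y)"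
  shows "D2 f = g"
  using DERIV_imp_deriv[OF assms] by (auto simp: D2_def)

text \<open>\<open>D1\<close> and \<open>D2\<close> are defined through \<open>deriv\<close>, which
  splits over a sum only for differentiable summands. The induction therefore carries along the
  existence of the first derivatives and of the mixed second ones; otherwise the sum case would say
  nothing about \<open>D1 (D2 f)\<close>.\<close>

lemma trig_deriv:
  assumes "trig f"
  shows "trig (D1 f)" "trig (D2 f)" "D1 (D2 f) = D2 (D1 f)"
    "((\<lambda>s. f (s, y)) has_real_derivative D1 f (x, y)) (at x)"
    "((\<lambda>s. f (x, s)) has_real_derivative D2 f (x, y)) (at y)"
proof -
  have "trig (D1 f) \<and> trig (D2 f) \<and> D1 (D2 f) = D2 (D1 f) \<and>
    (\<forall>x y. ((\<lambda>s. f (s, y)) has_real_derivative D1 f (x, y)) (at x) \<and>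
      ((\<lambda>s. f (x, s)) has_real_derivative D2 f (x, y)) (at y)) \<and>
    (\<forall>x y. ((\<lambda>s. D2 f (s, y)) has_real_derivative D1 (D2 f) (x, y)) (at x) \<and>
      ((\<lambda>s. D1 f (x, s)) has_real_derivative D2 (D1 f) (x, y)) (at y))"
    using assms
  proof (induction rule: trig.induct)
    case (trig_mode z k l)
    have c: "2 * pi * \<i> * k * (2 * pi * \<i> * l * z) = 2 * pi * \<i> * l * (2 * pi * \<i> * k * z)"
      by (simp only: mult_ac)
    have "((\<lambda>s. mode (2 * pi * \<i> * l * z) k l (s, y)) has_real_derivative
        mode (2 * pi * \<i> * l * (2 * pi * \<i> * k * z)) k l (x, y)) (at x)" for x y
      using mode_has_derivative_fst[of "2 * pi * \<i> * l * z" k l y x] by (simp only: c)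
    moreover note mode_has_derivative_snd[of "2 * pi * \<i> * k * z" k l]
    ultimately show ?case
      unfolding D1_mode D2_mode c
      by (intro conjI allI trig.intros mode_has_derivative_fst mode_has_derivative_snd) simp_all
  next
    case (trig_add f g)
    then have d: "((\<lambda>s. f (s, y) + g (s, y)) has_real_derivative D1 f (x, y) + D1 g (x, y)) (at x)"
      "((\<lambda>s. f (x, s) + g (x, s)) has_real_derivative D2 f (x, y) + D2 g (x, y)) (at y)" for x y
      by (auto intro!: DERIV_add)
    have e: "D1 (\<lambda>p. f p + g p) = (\<lambda>p. D1 f p + D1 g p)"
      "D2 (\<lambda>p. f p + g p) = (\<lambda>p. D2 f p + D2 g p)"
      using d by (auto intro!: D1_eqI D2_eqI)
    from trig_add have d2:
      "((\<lambda>s. D2 f (s, y) + D2 g (s, y)) has_real_derivative D1 (D2 f) (x, y) + D1 (D2 g) (x, y)) (at x)"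
      "((\<lambda>s. D1 f (x, s) + D1 g (x, s)) has_real_derivative D2 (D1 f) (x, y) + D2 (D1 g) (x, y)) (at y)" for x y
      by (auto intro!: DERIV_add)
    then have e2: "D1 (\<lambda>p. D2 f p + D2 g p) = (\<lambda>p. D1 (D2 f) p + D1 (D2 g) p)"
      "D2 (\<lambda>p. D1 f p + D1 g p) = (\<lambda>p. D2 (D1 f) p + D2 (D1 g) p)"
      by (auto intro!: D1_eqI D2_eqI)
    show ?case
      using trig_add d d2 by (auto simp: e e2 intro: trig.intros)
  qed
  then show "trig (D1 f)" "trig (D2 f)" "D1 (D2 f) = D2 (D1 f)"
    "((\<lambda>s. f (s, y)) has_real_derivative D1 f (x, y)) (at x)"
    "((\<lambda>s. f (x, s)) has_real_derivative D2 f (x, y)) (at y)" by auto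
qed

lemma D_trig_add:
  assumes "trig f" "trig g"
  shows "D1 (\<lambda>p. f p + g p) = (\<lambda>p. D1 f p + D1 g p)"
    "D2 (\<lambda>p. f p + g p) = (\<lambda>p. D2 f p + D2 g p)"
  using trig_deriv(4,5)[OF assms(1)] trig_deriv(4,5)[OF assms(2)]
  by (auto intro!: D1_eqI D2_eqI DERIV_add)

lemma D_trig_mult:
  assumes "trig f" "trig g"
  shows "D1 (\<lambda>p. f p * g p) = (\<lambda>p. f p * D1 g p + g p * D1 f p)"
    "D2 (\<lambda>p. f p * g p) = (\<lambda>p. f p * D2 g p + g p * D2 f p)"
  using trig_deriv(4,5)[OF assms(1)] trig_deriv(4,5)[OF assms(2)]
  by (auto intro!: D1_eqI D2_eqI derivative_eq_intros)

lemma D_trig_sum: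
  assumes "finite A" "\<And>i. i \<in> A \<Longrightarrow> trig (f i)"
  shows "D1 (\<lambda>p. \<Sum>i\<in>A. f i p) = (\<lambda>p. \<Sum>i\<in>A. D1 (f i) p)"
    "D2 (\<lambda>p. \<Sum>i\<in>A. f i p) = (\<lambda>p. \<Sum>i\<in>A. D2 (f i) p)"
  using trig_deriv(4,5)[OF assms(2)] by (auto intro!: D1_eqI D2_eqI DERIV_sum)

lemma C_k_trig: "trig f \<Longrightarrow> C_k k f"
proof (induction k arbitrary: f)
  case 0
  then show ?case by (simp add: trig_continuous)
next
  case (Suc k)
  then show ?case
    using trig_deriv[OF Suc.prems] trig_continuous field_differentiable_def by fastforce
qed

lemma test_function_trig: "trig f \<Longrightarrow> test_function f"
  by (simp add: test_function_def C_k_trig trig_periodic)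

section \<open>Integration over the unit cell\<close>

lemma space_torus: "space torus = {0..<1} \<times> {0..<1}"
  by (simp add: torus_def space_restrict_space)

lemma cell_borel: "{0..<1::real} \<times> {0..<1::real} \<in> sets borel"
  by (simp add: borel_Times)

lemma finite_measure_torus: "finite_measure torus"
proof
  have "emeasure torus (space torus) = emeasure lborel ({0..<1::real} \<times> {0..<1::real})"
    unfolding space_torus unfolding torus_def
    by (subst emeasure_restrict_space) (auto simp: cell_borel)
  also have "\<dots> \<le> emeasure lborel (cbox (0::real, 0::real) (1, 1))"
    by (rule emeasure_mono) (auto simp: cbox_Pair_eq borel_Times)
  also have "\<dots> < \<infinity>"
    by (rule emeasure_lborel_cbox_finite)
  finally show "emeasure torus (space torus) \<noteq> \<infinity>" by simp
qed

interpretation torus: finite_measure torus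
  by (rule finite_measure_torus)

lemma measurable_torus: "f \<in> borel_measurable borel \<Longrightarrow> f \<in> borel_measurable torus"
  unfolding torus_def by (rule measurable_restrict_space1) simp

lemma square_integrable_bounded:
  assumes "f \<in> borel_measurable torus" "\<And>p. \<bar>f p\<bar> \<le> K"
  shows "square_integrable f"
  unfolding square_integrable_def
proof
  show "integrable torus (\<lambda>p. (f p)\<^sup>2)"
  proof (rule torus.integrable_const_bound[where B = "K\<^sup>2"])
    have "(f p)\<^sup>2 \<le> K\<^sup>2" for p
      using power_mono[OF assms(2)[of p], of 2] by simp
    then show "AE p in torus. norm ((f p)\<^sup>2) \<le> K\<^sup>2" by simp
  qed (use assms in auto)
qed fact

lemma square_integrable_imp_integrable:
  assumes "square_integrable f" shows "integrable torus f"
  using square_integrable_mult[OF assms square_integrable_bounded[of "\<lambda>p. 1" 1]] by simp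

lemma trig_square_integrable: "trig f \<Longrightarrow> square_integrable f"
  by (metis borel_measurable_continuous_onI measurable_torus square_integrable_bounded
      trig_bounded trig_continuous)

text \<open>The half-open cell and the closed square differ by a part of the frontier, a null set,
  so that Fubini for continuous functions on a closed box applies.\<close>

lemma integral_torus_continuous:
  fixes f :: "real \<times> real \<Rightarrow> real"
  assumes "continuous_on UNIV f" "integrable torus f"
  shows "(LINT p|torus. f p) = integral {0..1} (\<lambda>x. integral {0..1} (\<lambda>y. f (x, y)))"
proof -
  let ?C = "{0..<1::real} \<times> {0..<1::real}"
  have "(LINT p|torus. f p) = (LINT p:?C|lborel. f p)"
    unfolding torus_def set_lebesgue_integral_def
    by (subst integral_restrict_space) (auto simp: cell_borel)
  also have "\<dots> = integral ?C f"
  proof (rule set_borel_integral_eq_integral)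
    show "set_integrable lborel ?C f"
      using assms(2) unfolding torus_def set_integrable_def
      by (subst (asm) integrable_restrict_space) (auto simp: cell_borel)
  qed
  also have "\<dots> = integral (cbox (0, 0) (1, 1)) f"
  proof (rule integral_spike_set)
    have n: "negligible (cbox (0::real, 0::real) (1, 1) - box (0, 0) (1, 1))"
      by (rule negligible_frontier_interval)
    show "negligible {x \<in> ?C - cbox (0, 0) (1, 1). f x \<noteq> 0}"
      by (rule negligible_subset[OF negligible_empty]) (auto simp: cbox_Pair_eq)
    have "box (0::real, 0::real) (1, 1) \<subseteq> ?C"
      by (auto simp: box_def Basis_prod_def)
    then show "negligible {x \<in> cbox (0, 0) (1, 1) - ?C. f x \<noteq> 0}"
      by (intro negligible_subset[OF n]) auto
  qed
  also have "\<dots> = integral {0..1} (\<lambda>x. integral {0..1} (\<lambda>y. f (x, y)))"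
    by (subst integral_prod_continuous) (auto intro: continuous_on_subset[OF assms(1)])
  finally show ?thesis .
qed

lemma integral_mode_snd:
  "integral {0..1} (\<lambda>y. mode z k l (x, y)) = (if l = 0 then mode z k 0 (x, 0) else 0)"
proof (cases "l = 0")
  case True
  then have "(\<lambda>y. mode z k l (x, y)) = (\<lambda>y. mode z k 0 (x, 0))"
    by (auto simp: mode_eq)
  then show ?thesis using True by simp
next
  case False
  \<comment> \<open>\<open>mode w k l\<close> is an antiderivative in y, and by periodicity it takes
    the same value at both ends.\<close>
  define w where "w = z / (2 * pi * \<i> * l)"
  have w: "2 * pi * \<i> * l * w = z"
    using False by (simp add: w_def)
  have "((\<lambda>y. mode z k l (x, y)) has_integral mode w k l (x, 1) - mode w k l (x, 0)) {0..1}"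
    by (rule fundamental_theorem_of_calculus)
      (auto simp: has_real_derivative_iff_has_vector_derivative[symmetric] w
        intro!: DERIV_subset[OF mode_has_derivative_snd[of w k l x, unfolded w]])
  then show ?thesis
    using mode_periodic(2)[of w k l x 0] False by (simp add: integral_unique)
qed

lemma integral_mode_fst:
  "integral {0..1} (\<lambda>x. mode z k 0 (x, 0)) = (if k = 0 then Re z else 0)"
proof (cases "k = 0")
  case True
  then have "(\<lambda>x. mode z k 0 (x, 0)) = (\<lambda>y. Re z)"
    by (auto simp: mode_eq)
  then show ?thesis using True by simp
next
  case False
  define w where "w = z / (2 * pi * \<i> * k)"
  have w: "2 * pi * \<i> * k * w = z"
    using False by (simp add: w_def)
  have "((\<lambda>x. mode z k 0 (x, 0)) has_integral mode w k 0 (1, 0) - mode w k 0 (0, 0)) {0..1}"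
    by (rule fundamental_theorem_of_calculus)
      (auto simp: has_real_derivative_iff_has_vector_derivative[symmetric] w
        intro!: DERIV_subset[OF mode_has_derivative_fst[of w k 0 0, unfolded w]])
  then show ?thesis
    using mode_periodic(1)[of w k 0 0 0] False by (simp add: integral_unique)
qed

lemma integral_mode:
  "(LINT p|torus. mode z k l p) = (if k = 0 \<and> l = 0 then Re z else 0)"
proof -
  have "integrable torus (mode z k l)"
    by (intro square_integrable_imp_integrable trig_square_integrable trig_mode)
  then have "(LINT p|torus. mode z k l p) =
      integral {0..1} (\<lambda>x. integral {0..1} (\<lambda>y. mode z k l (x, y)))"
    by (rule integral_torus_continuous[OF mode_continuous])
  also have "\<dots> = (if l = 0 then integral {0..1} (\<lambda>x. mode z k 0 (x, 0)) else 0)"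
    by (simp add: integral_mode_snd)
  finally show ?thesis
    by (simp add: integral_mode_fst)
qed

section \<open>Density of trigonometric polynomials\<close>

abbreviation cls :: "(real \<times> real \<Rightarrow> real) \<Rightarrow> torus_l2" where
  "cls \<equiv> abs_torus_l2"

lemma square_integrable_measurable [measurable_dest]:
  "square_integrable f \<Longrightarrow> f \<in> borel_measurable torus"
  by (simp add: square_integrable_def)

lemma fn_measurable [measurable]: "fn u \<in> borel_measurable torus"
  using fn_square_integrable by (simp add: square_integrable_def)

lemma l2_eq_refl: "square_integrable f \<Longrightarrow> l2_eq f f"
  by (simp add: l2_eq_def)

lemma square_integrable_diff:
  assumes "square_integrable f" "square_integrable g"
  shows "square_integrable (\<lambda>p. f p - g p)"
  using square_integrable_add[OF assms(1) square_integrable_cmult[OF assms(2), of "-1"]] by simp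

lemma square_integrable_mono:
  assumes "square_integrable g" "f \<in> borel_measurable torus" "\<And>p. p \<in> space torus \<Longrightarrow> \<bar>f p\<bar> \<le> \<bar>g p\<bar>"
  shows "square_integrable f"
  unfolding square_integrable_def
proof
  show "integrable torus (\<lambda>p. (f p)\<^sup>2)"
  proof (rule Bochner_Integration.integrable_bound)
    show "integrable torus (\<lambda>p. (g p)\<^sup>2)"
      using assms(1) by (simp add: square_integrable_def)
    show "(\<lambda>p. (f p)\<^sup>2) \<in> borel_measurable torus"
      using assms(2) by (rule borel_measurable_power)
    have "(f p)\<^sup>2 \<le> (g p)\<^sup>2" if "p \<in> space torus" for p
      using assms(3)[OF that] by (simp only: abs_le_square_iff)
    then show "AE p in torus. norm ((f p)\<^sup>2) \<le> norm ((g p)\<^sup>2)"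
      by (intro AE_I2) simp
  qed
qed fact

lemma cls_add:
  "square_integrable f \<Longrightarrow> square_integrable g \<Longrightarrow> cls (\<lambda>p. f p + g p) = cls f + cls g"
  by (simp add: plus_torus_l2.abs_eq l2_eq_refl)

lemma cls_cmult: "square_integrable f \<Longrightarrow> cls (\<lambda>p. c * f p) = c *\<^sub>R cls f"
  by (simp add: scaleR_torus_l2.abs_eq l2_eq_refl)

lemma cls_diff:
  assumes "square_integrable f" "square_integrable g"
  shows "cls (\<lambda>p. f p - g p) = cls f - cls g"
  using cls_add[OF assms(1) square_integrable_cmult[OF assms(2), of "-1"]] cls_cmult[OF assms(2), of "-1"]
  by simp

lemma cls_sum:
  assumes "finite A" "\<And>i. i \<in> A \<Longrightarrow> square_integrable (f i)"
  shows "square_integrable (\<lambda>p. \<Sum>i\<in>A. f i p) \<and> cls (\<lambda>p. \<Sum>i\<in>A. f i p) = (\<Sum>i\<in>A. cls (f i))"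
  using assms
proof (induction A rule: finite_induct)
  case empty
  then show ?case by (simp add: square_integrable_zero zero_torus_l2_def)
next
  case (insert i A)
  then show ?case by (simp add: square_integrable_add cls_add)
qed

lemma inner_cls_cls:
  "square_integrable f \<Longrightarrow> square_integrable g \<Longrightarrow> inner (cls f) (cls g) = (LINT p|torus. f p * g p)"
  by (simp add: inner_torus_l2.abs_eq l2_eq_refl)

lemma inner_cls: "square_integrable f \<Longrightarrow> inner u (cls f) = (LINT p|torus. fn u p * f p)"
  using inner_cls_cls[OF fn_square_integrable] by (simp add: abs_fn)

lemma norm_cls: "square_integrable f \<Longrightarrow> (norm (cls f))\<^sup>2 = (LINT p|torus. (f p)\<^sup>2)"
  by (simp add: power2_norm_eq_inner inner_cls_cls) (simp add: power2_eq_square)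

lemma fn_diff: "AE p in torus. fn (u - v) p = fn u p - fn v p"
  using fn_abs[OF square_integrable_diff[OF fn_square_integrable fn_square_integrable]]
  by (simp add: cls_diff fn_square_integrable abs_fn)

text \<open>A property of functions rather than of classes, so that the inductions over Borel sets
  and measurable functions can be run on it.\<close>

definition approximable :: "(real \<times> real \<Rightarrow> real) \<Rightarrow> bool" where
  "approximable f \<longleftrightarrow> square_integrable f \<and> cls f \<in> closure (cls ` Collect trig)"

lemma approximable_trig: "trig f \<Longrightarrow> approximable f"
  unfolding approximable_def
  by (intro conjI trig_square_integrable subsetD[OF closure_subset] imageI CollectI)

lemma approximable_sequence:
  assumes "approximable f"
  obtains F where "\<And>n. trig (F n)" "(\<lambda>n. cls (F n)) \<longlonglongrightarrow> cls f"
proof -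
  have "cls f \<in> closure (cls ` Collect trig)"
    using assms by (simp only: approximable_def)
  then obtain X where X: "\<forall>n. X n \<in> cls ` Collect trig" "X \<longlonglongrightarrow> cls f"
    unfolding closure_sequential by (elim exE conjE)
  then have "\<forall>n. \<exists>g. trig g \<and> X n = cls g" by blast
  then obtain F where "\<And>n. trig (F n)" "\<And>n. X n = cls (F n)" by metis
  then show ?thesis using that X(2) by presburger
qed

lemma approximableI:
  assumes "square_integrable f" "\<And>n. trig (F n)" "(\<lambda>n. cls (F n)) \<longlonglongrightarrow> cls f"
  shows "approximable f"
  unfolding approximable_def closure_sequential
  using assms by (intro conjI exI[of _ "\<lambda>n. cls (F n)"] allI imageI CollectI)

lemma approximable_add:
  assumes "approximable f" "approximable g"
  shows "approximable (\<lambda>p. f p + g p)"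
proof -
  obtain F G where F: "\<And>n. trig (F n)" "(\<lambda>n. cls (F n)) \<longlonglongrightarrow> cls f"
    and G: "\<And>n. trig (G n)" "(\<lambda>n. cls (G n)) \<longlonglongrightarrow> cls g"
    using approximable_sequence assms by metis
  have sq: "square_integrable f" "square_integrable g"
    using assms by (simp_all only: approximable_def)
  show ?thesis
  proof (rule approximableI)
    show "trig (\<lambda>p. F n p + G n p)" for n
      by (rule trig_add[OF F(1) G(1)])
    show "(\<lambda>n. cls (\<lambda>p. F n p + G n p)) \<longlonglongrightarrow> cls (\<lambda>p. f p + g p)"
      using tendsto_add[OF F(2) G(2)]
      by (simp only: cls_add sq trig_square_integrable F(1) G(1))
  qed (rule square_integrable_add[OF sq])
qed

lemma approximable_cmult:
  assumes "approximable f"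
  shows "approximable (\<lambda>p. c * f p)"
proof -
  obtain F where F: "\<And>n. trig (F n)" "(\<lambda>n. cls (F n)) \<longlonglongrightarrow> cls f"
    using approximable_sequence[OF assms] by metis
  have sq: "square_integrable f"
    using assms by (simp only: approximable_def)
  show ?thesis
  proof (rule approximableI)
    show "trig (\<lambda>p. c * F n p)" for n
      by (rule trig_cmult[OF F(1)])
    show "(\<lambda>n. cls (\<lambda>p. c * F n p)) \<longlonglongrightarrow> cls (\<lambda>p. c * f p)"
      using tendsto_scaleR[OF tendsto_const[of c] F(2)]
      by (simp only: cls_cmult sq trig_square_integrable F(1))
  qed (rule square_integrable_cmult[OF sq])
qed

lemma approximable_sum:
  "finite A \<Longrightarrow> (\<And>i. i \<in> A \<Longrightarrow> approximable (f i)) \<Longrightarrow> approximable (\<lambda>p. \<Sum>i\<in>A. f i p)"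
proof (induction A rule: finite_induct)
  case empty
  show ?case
    unfolding sum.empty by (rule approximable_trig[OF trig_const])
next
  case (insert i A)
  then have "approximable (\<lambda>p. f i p + (\<Sum>i\<in>A. f i p))"
    by (intro approximable_add) blast+
  then show ?case
    unfolding sum.insert[OF insert.hyps] .
qed

text \<open>Dominated convergence gives convergence of the classes in L^2, and a closure is closed.
  The later approximations, uniform or monotone, all pass through this lemma; the factor 4 comes
  from |F n - f| \<le> 2 h.\<close>

lemma approximable_limit:
  assumes F: "\<And>n. approximable (F n)" and f: "f \<in> borel_measurable torus"
    and h: "square_integrable h" "\<And>n p. p \<in> space torus \<Longrightarrow> \<bar>F n p\<bar> \<le> h p"
    and lim: "\<And>p. p \<in> space torus \<Longrightarrow> (\<lambda>n. F n p) \<longlonglongrightarrow> f p"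
  shows "approximable f"
proof -
  have fh: "\<bar>f p\<bar> \<le> h p" if "p \<in> space torus" for p
    using h(2)[OF that] by (intro LIMSEQ_le_const2[OF tendsto_rabs[OF lim[OF that]]]) auto
  have int: "integrable torus (\<lambda>p. (h p)\<^sup>2)"
    using h(1) by (simp add: square_integrable_def)
  have sqf: "square_integrable f"
    using fh by (intro square_integrable_mono[OF h(1) f]) force
  have sqF: "square_integrable (F n)" for n
    using F by (simp add: approximable_def)
  note [measurable] = f sqF[THEN square_integrable_measurable]
  have "(\<lambda>n. LINT p|torus. (F n p - f p)\<^sup>2) \<longlonglongrightarrow> (LINT p|torus. 0)"
  proof (rule integral_dominated_convergence[where w = "\<lambda>p. 4 * (h p)\<^sup>2"])
    show "AE p in torus. (\<lambda>n. (F n p - f p)\<^sup>2) \<longlonglongrightarrow> 0"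
    proof (rule AE_I2)
      fix p assume "p \<in> space torus"
      then have "(\<lambda>n. (F n p - f p)\<^sup>2) \<longlonglongrightarrow> (f p - f p)\<^sup>2"
        by (intro tendsto_power tendsto_diff tendsto_const lim)
      then show "(\<lambda>n. (F n p - f p)\<^sup>2) \<longlonglongrightarrow> 0" by simp
    qed
    show "AE p in torus. norm ((F n p - f p)\<^sup>2) \<le> 4 * (h p)\<^sup>2" for n
    proof (rule AE_I2)
      fix p assume p: "p \<in> space torus"
      have "\<bar>F n p - f p\<bar> \<le> 2 * h p"
        using h(2)[OF p, of n] fh[OF p] by linarith
      then have "(F n p - f p)\<^sup>2 \<le> (2 * h p)\<^sup>2"
        using power_mono[of "\<bar>F n p - f p\<bar>" "2 * h p" 2] by simp
      then show "norm ((F n p - f p)\<^sup>2) \<le> 4 * (h p)\<^sup>2"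
        by (simp add: power_mult_distrib)
    qed
  qed (use int in \<open>auto intro!: borel_measurable_diff borel_measurable_power\<close>)
  then have "(\<lambda>n. (norm (cls (F n) - cls f))\<^sup>2) \<longlonglongrightarrow> 0"
    by (simp add: norm_cls sqf sqF square_integrable_diff flip: cls_diff)
  then have "(\<lambda>n. sqrt ((norm (cls (F n) - cls f))\<^sup>2)) \<longlonglongrightarrow> sqrt 0"
    by (rule tendsto_real_sqrt)
  then have L: "(\<lambda>n. cls (F n)) \<longlonglongrightarrow> cls f"
    by (simp add: tendsto_norm_zero_iff LIM_zero_iff)
  have F': "\<forall>n. cls (F n) \<in> closure (cls ` Collect trig)"
    by (intro allI F[unfolded approximable_def, THEN conjunct2])
  have "cls f \<in> closure (cls ` Collect trig)"
    by (rule closed_sequential_limits[THEN iffD1, OF closed_closure, THEN spec[of _ "\<lambda>n. cls (F n)"],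
          THEN spec, THEN mp, OF conjI[OF F' L]])
  then show ?thesis
    unfolding approximable_def by (intro conjI sqf)
qed

section \<open>Stone-Weierstrass on a product of two circles\<close>

definition circle_pair :: "real \<times> real \<Rightarrow> complex \<times> complex" where
  "circle_pair p = (cis (2 * pi * fst p), cis (2 * pi * snd p))"

lemma circle_pair_continuous: "continuous_on UNIV circle_pair"
  unfolding circle_pair_def cis_conv_exp by (intro continuous_intros)

lemma circle_pair_measurable [measurable]: "circle_pair \<in> torus \<rightarrow>\<^sub>M borel"
  unfolding torus_def
  by (rule measurable_restrict_space1)
    (simp add: borel_measurable_continuous_onI circle_pair_continuous)

text \<open>A real linear functional on pairs of complex numbers becomes a combination of two
  cosines and two sines on the torus, the coefficient \<open>- \<i>\<close> producing the sine; sums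
  and products are covered by the algebra of trigonometric polynomials.\<close>

lemma trig_real_polynomial:
  fixes q :: "complex \<times> complex \<Rightarrow> real"
  shows "real_polynomial_function q \<Longrightarrow> trig (\<lambda>p. q (circle_pair p))"
proof (induction rule: real_polynomial_function.induct)
  case (linear f)
  then interpret bounded_linear f .
  have "f (circle_pair p) = f (1, 0) * mode 1 1 0 p + f (\<i>, 0) * mode (- \<i>) 1 0 p +
      (f (0, 1) * mode 1 0 1 p + f (0, \<i>) * mode (- \<i>) 0 1 p)" for p
  proof -
    have "f (z, w) = Re z * f (1, 0) + Im z * f (\<i>, 0) + (Re w * f (0, 1) + Im w * f (0, \<i>))" for z w
    proof -
      have "(z, w) = Re z *\<^sub>R (1, 0) + Im z *\<^sub>R (\<i>, 0) + (Re w *\<^sub>R (0, 1) + Im w *\<^sub>R (0, \<i>))"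
        by (simp add: complex_eq_iff)
      then have "f (z, w) = f (Re z *\<^sub>R (1, 0) + Im z *\<^sub>R (\<i>, 0) + (Re w *\<^sub>R (0, 1) + Im w *\<^sub>R (0, \<i>)))"
        by (rule arg_cong)
      then show ?thesis
        unfolding add scaleR real_scaleR_def .
    qed
    then have "f (circle_pair p) = Re (cis (2 * pi * fst p)) * f (1, 0) + Im (cis (2 * pi * fst p)) * f (\<i>, 0) +
        (Re (cis (2 * pi * snd p)) * f (0, 1) + Im (cis (2 * pi * snd p)) * f (0, \<i>))"
      unfolding circle_pair_def .
    then show ?thesis
      by (cases p) (simp add: mode_eq)
  qed
  then show ?case
    by (simp add: trig_add trig_cmult trig_mode)
qed (auto intro: trig_const trig_add trig_mult)

text \<open>The product of the circles is compact, while the half-open cell is not; this is why the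
  approximation takes place there. The tolerance 1/(n+1) is at most 1, hence the common bound K +
  1.\<close>

lemma approximable_continuous:
  assumes "continuous_on UNIV G"
  shows "approximable (\<lambda>p. G (circle_pair p))"
proof -
  let ?S = "sphere (0::complex) 1 \<times> sphere (0::complex) 1"
  have S: "compact ?S" by (intro compact_Times compact_sphere)
  have G: "continuous_on ?S G" using assms continuous_on_subset by blast
  have "\<exists>q. real_polynomial_function q \<and> (\<forall>z\<in>?S. \<bar>G z - q z\<bar> < 1 / real (Suc n))" for n
    using Stone_Weierstrass_real_polynomial_function[OF S G, of "1 / real (Suc n)"]
    by (metis of_nat_0_less_iff zero_less_Suc zero_less_divide_1_iff)
  then obtain q where q: "\<And>n. real_polynomial_function (q n)"
    "\<And>n z. z \<in> ?S \<Longrightarrow> \<bar>G z - q n z\<bar> < 1 / real (Suc n)"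
    by metis
  have "bounded (G ` ?S)"
    by (rule compact_imp_bounded[OF compact_continuous_image[OF G S]])
  then obtain K where K: "\<And>z. z \<in> ?S \<Longrightarrow> \<bar>G z\<bar> \<le> K"
    by (auto simp: bounded_iff)
  have c: "circle_pair p \<in> ?S" for p
    by (simp add: circle_pair_def)
  show ?thesis
  proof (rule approximable_limit)
    show "approximable (\<lambda>p. q n (circle_pair p))" for n
      by (rule approximable_trig[OF trig_real_polynomial[OF q(1)]])
    show "(\<lambda>p. G (circle_pair p)) \<in> borel_measurable torus"
      by (intro measurable_compose[OF circle_pair_measurable] borel_measurable_continuous_onI assms)
    show "square_integrable (\<lambda>p. K + 1)"
      by (intro trig_square_integrable trig_const)
    show "\<bar>q n (circle_pair p)\<bar> \<le> K + 1" for n p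
    proof -
      have "\<bar>G (circle_pair p) - q n (circle_pair p)\<bar> < 1"
        using q(2)[OF c, of p n] by (rule less_le_trans) simp
      then show ?thesis using K[OF c, of p] by linarith
    qed
    show "(\<lambda>n. q n (circle_pair p)) \<longlonglongrightarrow> G (circle_pair p)" for p
    proof (rule LIM_zero_cancel, rule tendsto_rabs_zero_cancel,
        rule tendsto_sandwich[OF _ _ tendsto_const lim_inverse_n'[THEN LIMSEQ_Suc]])
      show "\<forall>\<^sub>F n in sequentially. \<bar>q n (circle_pair p) - G (circle_pair p)\<bar> \<le> 1 / real (Suc n)"
        using q(2)[OF c, of p] by (auto simp: abs_minus_commute less_imp_le)
    qed simp
  qed
qed

lemma approximable_indicator_closed:
  assumes "closed C"
  shows "approximable (\<lambda>p. indicator C (circle_pair p))"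
\<comment> \<open>\<open>infdist\<close> to the empty set is 0 by convention, so the functions
  \<open>G n\<close> below would tend to 1 instead of 0.\<close>
proof (cases "C = {}")
  case True
  then show ?thesis by (simp add: approximable_trig trig_const)
next
  case False
  define G where "G n z = max 0 (1 - real n * infdist z C)" for n z
  have G: "continuous_on UNIV (G n)" for n
    unfolding G_def by (intro continuous_intros)
  show ?thesis
  proof (rule approximable_limit)
    show "approximable (\<lambda>p. G n (circle_pair p))" for n
      by (rule approximable_continuous[OF G])
    show "(\<lambda>p. indicator C (circle_pair p)) \<in> borel_measurable torus"
      using borel_closed[OF assms] by measurable
    show "square_integrable (\<lambda>p. 1)"
      by (intro trig_square_integrable trig_const)
    show "\<bar>G n (circle_pair p)\<bar> \<le> 1" for n p
      by (auto simp: G_def infdist_nonneg)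
    show "(\<lambda>n. G n (circle_pair p)) \<longlonglongrightarrow> indicator C (circle_pair p)" for p
    proof (cases "circle_pair p \<in> C")
      case True
      then show ?thesis by (simp add: G_def)
    next
      case nin: False
      then have pos: "infdist (circle_pair p) C > 0"
        using infdist_pos_not_in_closed[OF assms False] by auto
      obtain N where N: "1 < real N * infdist (circle_pair p) C"
        using reals_Archimedean3[OF pos] by blast
      have "G n (circle_pair p) = 0" if "n \<ge> N" for n
      proof -
        have "real N * infdist (circle_pair p) C \<le> real n * infdist (circle_pair p) C"
          using that pos by (intro mult_right_mono) auto
        then show ?thesis using N by (simp add: G_def)
      qed
      then have "\<forall>\<^sub>F n in sequentially. G n (circle_pair p) = 0"
        by (auto simp: eventually_sequentially)
      then show ?thesis using nin by (simp add: tendsto_eventually)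
    qed
  qed
qed

text \<open>Dynkin's argument: the closed sets are stable under intersection and generate the Borel
  sets, and approximability of the indicator passes to complements and countable disjoint
  unions.\<close>

lemma approximable_indicator_borel:
  assumes "B \<in> sets borel"
  shows "approximable (\<lambda>p. indicator B (circle_pair p))"
proof -
  have st: "Int_stable (Collect closed :: (complex \<times> complex) set set)"
    by (auto simp: Int_stable_def)
  have sub: "Collect closed \<subseteq> Pow (UNIV :: (complex \<times> complex) set)" by simp
  have B: "B \<in> sigma_sets UNIV (Collect closed)"
    using assms by (simp add: borel_eq_closed)
  show ?thesis
    using st sub B
  proof (induction rule: sigma_sets_induct_disjoint)
    case (basic A)
    then show ?case by (simp add: approximable_indicator_closed)
  next
    case empty
    then show ?case by (simp add: approximable_trig trig_const)
  next
    case (compl A)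
    have "(\<lambda>p. indicator (UNIV - A) (circle_pair p) :: real) =
        (\<lambda>p. 1 + - 1 * indicator A (circle_pair p))"
      by (auto simp: indicator_def)
    then show ?case
      using approximable_add[OF approximable_trig[OF trig_const, of 1] approximable_cmult[OF compl(2), of "-1"]]
      by simp
  next
    case (union A)
    have A: "A i \<in> sets borel" for i
      using union(2) by (auto simp: borel_eq_closed)
    show ?case
    proof (rule approximable_limit)
      show "approximable (\<lambda>p. indicator (\<Union>i<n. A i) (circle_pair p))" for n
      proof -
        have "(\<lambda>p. indicator (\<Union>i<n. A i) (circle_pair p) :: real) =
            (\<lambda>p. \<Sum>i<n. indicator (A i) (circle_pair p))"
          using union(1)
          by (auto intro!: ext indicator_UN_disjoint disjoint_family_on_mono[of _ UNIV])
        then show ?thesis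
          using approximable_sum[of "{..<n}" "\<lambda>i p. indicator (A i) (circle_pair p)"] union(3) by simp
      qed
      show "(\<lambda>p. indicator (\<Union>i. A i) (circle_pair p)) \<in> borel_measurable torus"
      proof -
        have [measurable]: "(\<Union>i. A i) \<in> sets borel" using A by auto
        show ?thesis by measurable
      qed
      show "square_integrable (\<lambda>p. 1)"
        by (intro trig_square_integrable trig_const)
      show "\<bar>indicator (\<Union>i<n. A i) (circle_pair p)\<bar> \<le> (1::real)" for n p
        by (simp add: indicator_def)
      show "(\<lambda>n. indicator (\<Union>i<n. A i) (circle_pair p) :: real) \<longlonglongrightarrow>
          indicator (\<Union>i. A i) (circle_pair p)" for p
        by (rule LIMSEQ_indicator_UN)
    qed
  qed
qed

text \<open>\<open>Arg2pi\<close> is continuous off the nonnegative reals and vanishes on them, so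
  cutting it off there changes nothing.\<close>

lemma Arg2pi_measurable: "Arg2pi \<in> borel_measurable borel"
proof -
  have "(\<lambda>z. indicator (- \<real>\<^sub>\<ge>\<^sub>0) z *\<^sub>R Arg2pi z) \<in> borel_measurable borel"
    by (rule borel_measurable_continuous_on_indicator)
      (auto intro!: continuous_at_imp_continuous_on continuous_at_Arg2pi)
  also have "(\<lambda>z. indicator (- \<real>\<^sub>\<ge>\<^sub>0) z *\<^sub>R Arg2pi z) = Arg2pi"
    by (auto simp: indicator_def Arg2pi_eq_0 complex_nonneg_Reals_iff complex_is_Real_iff)
  finally show ?thesis .
qed

lemma Arg2pi_cis: "0 \<le> x \<Longrightarrow> x < 1 \<Longrightarrow> Arg2pi (cis (2 * pi * x)) = 2 * pi * x"
  by (rule Arg2pi_unique[of 1]) (auto simp: cis_conv_exp mult_ac)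

text \<open>
  \<open>circle_pair\<close> is injective on the cell with a Borel inverse, so that every measurable set of
  the torus is the preimage of a Borel set.
\<close>

lemma approximable_indicator:
  assumes "A \<in> sets torus"
  shows "approximable (indicator A)"
proof -
  define inv where "inv = (\<lambda>(z, w). (Arg2pi z / (2 * pi), Arg2pi w / (2 * pi)))"
  have [measurable]: "Arg2pi \<in> borel_measurable borel" by (rule Arg2pi_measurable)
  have "inv \<in> borel \<Otimes>\<^sub>M borel \<rightarrow>\<^sub>M borel \<Otimes>\<^sub>M borel"
    unfolding inv_def by measurable
  then have inv: "inv \<in> borel \<rightarrow>\<^sub>M borel"
    by (simp add: borel_prod)
  have "A \<in> sets borel"
    using assms cell_borel by (auto simp: torus_def sets_restrict_space)
  then have B: "inv -` A \<in> sets borel"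
    using measurable_sets[OF inv] by simp
  have eq: "indicator (inv -` A) (circle_pair p) = (indicator A p :: real)" if "p \<in> space torus" for p
    using that by (auto simp: space_torus inv_def circle_pair_def Arg2pi_cis indicator_def)
  \<comment> \<open>The sequence is constant: the limit lemma serves to replace a function by one
    that agrees with it on the cell only.\<close>
  show ?thesis
  proof (rule approximable_limit)
    show "approximable (\<lambda>p. indicator (inv -` A) (circle_pair p))" for n :: nat
      by (rule approximable_indicator_borel[OF B])
    show "square_integrable (\<lambda>p. 1)"
      by (intro trig_square_integrable trig_const)
  qed (use assms eq in \<open>auto simp: indicator_def\<close>)
qed

text \<open>Induction over nonnegative measurable functions. Square integrability is inherited
  downwards: by the summands of a sum, by a factor after division by \<open>c\<close>, and by the
  members of an increasing sequence, which lie below the limit. The limit also serves as the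
  dominating function.\<close>

lemma approximable_nonneg:
  assumes "u \<in> borel_measurable torus" "\<And>p. 0 \<le> u p" "square_integrable u"
  shows "approximable u"
  using assms
proof (induction rule: borel_measurable_induct_real)
  case (set A)
  then show ?case by (simp add: approximable_indicator)
next
  case (mult u c)
  show ?case
  proof (cases "c = 0")
    case True
    then show ?thesis by (simp add: approximable_trig trig_const)
  next
    case False
    have "square_integrable u"
      using square_integrable_cmult[OF mult(5), of "1 / c"] False by simp
    then show ?thesis using mult by (simp add: approximable_cmult)
  qed
next
  case (add u v)
  have "square_integrable u" "square_integrable v"
    using add by (auto intro!: square_integrable_mono[OF add(8)])
  then show ?case using add by (simp add: approximable_add)
next
  case (seq U)
  have le: "U i p \<le> u p" if "p \<in> space torus" for i p
    using seq.hyps(3) seq.hyps(4)[OF that]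
    by (intro incseq_le[of "\<lambda>i. U i p"]) (blast intro: incseq_def[THEN iffD2] le_funD[OF incseqD])+
  have "square_integrable (U i)" for i
  proof (rule square_integrable_mono[OF seq.prems seq.hyps(1)])
    show "\<bar>U i p\<bar> \<le> \<bar>u p\<bar>" if "p \<in> space torus" for p
      using le[OF that, of i] seq.hyps(2)[of i p] by linarith
  qed
  then have "approximable (U i)" for i by (rule seq.IH)
  then show ?case
    by (rule approximable_limit[where h = u]) (use assms seq le in auto)
qed

lemma cls_in_closure_trig:
  assumes f: "square_integrable f"
  shows "cls f \<in> closure (cls ` Collect trig)"
proof -
  have m: "square_integrable (\<lambda>p. max (f p) 0)" "square_integrable (\<lambda>p. max (- f p) 0)"
    using f by (auto intro!: square_integrable_mono[OF f])
  have "approximable (\<lambda>p. max (f p) 0 + - 1 * max (- f p) 0)"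
    using m by (intro approximable_add approximable_cmult approximable_nonneg) auto
  also have "(\<lambda>p. max (f p) 0 + - 1 * max (- f p) 0) = f"
    by (auto simp: max_def)
  finally show ?thesis by (simp add: approximable_def)
qed

lemma trig_dense:
  assumes "e > 0" obtains f where "trig f" "norm (u - cls f) < e"
  using cls_in_closure_trig[OF fn_square_integrable, of u] assms
  by (auto simp: abs_fn closure_approachable dist_norm norm_minus_commute)

section \<open>Fourier coefficients and essential bounds\<close>

text \<open>The usual coefficient, the integral of u(x, y) exp(-2 pi i (k x + l y)), since
  \<open>mode \<i> k l\<close> is minus the sine. It is assembled from two real inner products
  because \<open>torus_l2\<close> is a real space.\<close>

definition coef :: "torus_l2 \<Rightarrow> int \<Rightarrow> int \<Rightarrow> complex" where
  "coef u k l = Complex (inner u (cls (mode 1 k l))) (inner u (cls (mode \<i> k l)))"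

lemma mode_square_integrable: "square_integrable (mode z k l)"
  by (rule trig_square_integrable[OF trig_mode])

lemma inner_mode: "inner u (cls (mode z k l)) = Re (z * cnj (coef u k l))"
proof -
  have "mode z k l = (\<lambda>p. Re z * mode 1 k l p + Im z * mode \<i> k l p)"
    by (auto simp: mode_eq algebra_simps)
  then have "cls (mode z k l) = cls (\<lambda>p. Re z * mode 1 k l p + Im z * mode \<i> k l p)"
    by (rule arg_cong)
  also have "\<dots> = Re z *\<^sub>R cls (mode 1 k l) + Im z *\<^sub>R cls (mode \<i> k l)"
    by (simp only: cls_add cls_cmult square_integrable_cmult mode_square_integrable)
  finally show ?thesis
    by (simp add: coef_def inner_add_right)
qed

lemma coef_add: "coef (u + v) k l = coef u k l + coef v k l"
  by (simp add: coef_def inner_add_left complex_eq_iff)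

lemma coef_diff: "coef (u - v) k l = coef u k l - coef v k l"
  by (simp add: coef_def inner_diff_left complex_eq_iff)

lemma coef_mode:
  "coef (cls (mode z m n)) k l =
    (if k = m \<and> l = n then z / 2 else 0) + (if k = - m \<and> l = - n then cnj z / 2 else 0)"
proof -
  have *: "inner (cls (mode z m n)) (cls (mode w k l)) =
      (if k = - m \<and> l = - n then Re (w * z / 2) else 0) +
      (if k = m \<and> l = n then Re (w * cnj z / 2) else 0)" for w
  proof -
    have "inner (cls (mode z m n)) (cls (mode w k l)) = (LINT p|torus. mode w k l p * mode z m n p)"
      by (simp add: inner_cls_cls mode_square_integrable mult.commute)
    also have "\<dots> = (LINT p|torus. mode (w * z / 2) (k + m) (l + n) p) +
        (LINT p|torus. mode (w * cnj z / 2) (k - m) (l - n) p)"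
      unfolding mode_mult
      by (intro Bochner_Integration.integral_add square_integrable_imp_integrable mode_square_integrable)
    finally show ?thesis
      unfolding integral_mode by (auto simp: add_eq_0_iff2)
  qed
  show ?thesis
    unfolding coef_def * by (auto simp: complex_eq_iff)
qed

definition freq :: "nat \<Rightarrow> (int \<times> int) set" where
  "freq N = {- int N..int N} \<times> {- int N..int N}"

lemma finite_freq [simp]: "finite (freq N)"
  by (simp add: freq_def)

text \<open>
  The real function \<open>u\<close> is the real part of $\sum_{k,l} \hat u(k,l)\, e^{2\pi i(kx+ly)}$; both
  $(k,l)$ and $(-k,-l)$ occur in the sum, which makes up for the factor 1/2 in \<open>coef_mode\<close>.
\<close>

definition fourier_sum :: "nat \<Rightarrow> torus_l2 \<Rightarrow> real \<times> real \<Rightarrow> real" where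
  "fourier_sum N u p = (\<Sum>(k, l)\<in>freq N. mode (coef u k l) k l p)"

definition proj :: "nat \<Rightarrow> torus_l2 \<Rightarrow> torus_l2" where
  "proj N u = cls (fourier_sum N u)"

lemma fourier_sum_trig: "trig (fourier_sum N u)"
  unfolding fourier_sum_def split_def by (intro trig_sum trig_mode) simp

lemma proj_eq: "proj N u = (\<Sum>(k, l)\<in>freq N. cls (mode (coef u k l) k l))"
  unfolding proj_def fourier_sum_def split_def
  by (rule cls_sum[THEN conjunct2]) (auto simp: mode_square_integrable)

lemma fourier_sum_add: "fourier_sum N (u + v) p = fourier_sum N u p + fourier_sum N v p"
  by (simp add: fourier_sum_def coef_add mode_add split_def sum.distrib)

lemma proj_add: "proj N (u + v) = proj N u + proj N v"
proof -
  have "fourier_sum N (u + v) = (\<lambda>p. fourier_sum N u p + fourier_sum N v p)"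
    by (rule ext) (rule fourier_sum_add)
  then show ?thesis
    by (simp only: proj_def cls_add trig_square_integrable fourier_sum_trig)
qed

lemma inner_proj: "inner v (proj N u) = (\<Sum>(k, l)\<in>freq N. Re (coef u k l * cnj (coef v k l)))"
  by (simp add: proj_eq inner_sum_right split_def inner_mode)

lemma inner_proj_commute: "inner v (proj N u) = inner (proj N v) u"
  unfolding inner_commute[of "proj N v"] inner_proj
  by (intro sum.cong refl) (auto simp: mult.commute)

text \<open>The frequencies (m, n) and (-m, -n) contribute half of the mode each. They coincide at
  the origin, which is why the sum is split into two separate terms before evaluation.\<close>

lemma fourier_sum_mode:
  assumes "(m, n) \<in> freq N"
  shows "fourier_sum N (cls (mode z m n)) = mode z m n"
proof
  fix p
  have mn: "(- m, - n) \<in> freq N"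
    using assms by (auto simp: freq_def)
  have "fourier_sum N (cls (mode z m n)) p =
      (\<Sum>q\<in>freq N. (if q = (m, n) then mode (z / 2) m n p else 0) +
        (if q = (- m, - n) then mode (cnj z / 2) (- m) (- n) p else 0))"
    unfolding fourier_sum_def coef_mode split_def mode_add
    by (intro sum.cong refl arg_cong2[where f = "(+)"]) (auto simp: prod_eq_iff)
  also have "\<dots> = mode (z / 2) m n p + mode (cnj (z / 2)) (- m) (- n) p"
    using assms mn by (simp add: sum.distrib sum.delta)
  also have "\<dots> = mode (z / 2 + z / 2) m n p"
    unfolding mode_cnj mode_add ..
  finally show "fourier_sum N (cls (mode z m n)) p = mode z m n p"
    by simp
qed

lemma proj_zero: "proj N 0 = 0"
  using proj_add[of N 0 0] by simp

lemma proj_sum: "finite A \<Longrightarrow> proj N (\<Sum>i\<in>A. f i) = (\<Sum>i\<in>A. proj N (f i))"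
  by (induction A rule: finite_induct) (simp_all add: proj_zero proj_add)

lemma proj_proj: "proj N (proj N u) = proj N u"
proof -
  have "proj N (proj N u) = (\<Sum>q\<in>freq N. proj N (cls (mode (coef u (fst q) (snd q)) (fst q) (snd q))))"
    unfolding proj_eq[of N u] split_def by (rule proj_sum) simp
  also have "\<dots> = (\<Sum>q\<in>freq N. cls (mode (coef u (fst q) (snd q)) (fst q) (snd q)))"
  proof (rule sum.cong[OF refl])
    fix q assume "q \<in> freq N"
    then have "(fst q, snd q) \<in> freq N" by simp
    then show "proj N (cls (mode (coef u (fst q) (snd q)) (fst q) (snd q))) =
        cls (mode (coef u (fst q) (snd q)) (fst q) (snd q))"
      by (simp only: proj_def fourier_sum_mode)
  qed
  finally show ?thesis
    by (simp add: proj_eq[of N u] split_def)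
qed

text \<open>Symmetry and idempotence make \<open>proj N\<close> an orthogonal projection. The
  formula for its norm, the contraction property and Bessel's inequality all rest on this
  identity.\<close>

lemma norm_proj_inner: "(norm (proj N u))\<^sup>2 = inner u (proj N u)"
  using inner_proj_commute[of u N "proj N u"] by (simp add: power2_norm_eq_inner proj_proj)

lemma norm_proj: "(norm (proj N u))\<^sup>2 = (\<Sum>(k, l)\<in>freq N. (norm (coef u k l))\<^sup>2)"
proof -
  have "Re (c * cnj c) = (norm c)\<^sup>2" for c
    by (simp add: cmod_power2 flip: power2_eq_square)
  then show ?thesis
    unfolding norm_proj_inner inner_proj by (intro sum.cong refl) auto
qed

lemma norm_proj_le: "norm (proj N u) \<le> norm u"
proof (cases "norm (proj N u) = 0")
  case False
  have "norm (proj N u) * norm (proj N u) \<le> norm u * norm (proj N u)"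
    using norm_proj_inner[of N u] norm_cauchy_schwarz[of u "proj N u"]
    by (simp add: power2_eq_square)
  then show ?thesis using False by simp
qed simp

lemma bessel: "(\<Sum>(k, l)\<in>freq N. (norm (coef u k l))\<^sup>2) \<le> (norm u)\<^sup>2"
  unfolding norm_proj[symmetric] by (intro power_mono norm_proj_le norm_ge_zero)

lemma proj_trig: "trig f \<Longrightarrow> \<exists>M. \<forall>N\<ge>M. proj N (cls f) = cls f"
proof (induction rule: trig.induct)
  case (trig_mode z k l)
  have "proj N (cls (mode z k l)) = cls (mode z k l)" if "N \<ge> nat (max \<bar>k\<bar> \<bar>l\<bar>)" for N
  proof -
    have "(k, l) \<in> freq N" using that by (auto simp: freq_def)
    then show ?thesis by (simp only: proj_def fourier_sum_mode)
  qed
  then show ?case by blast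
next
  case (trig_add f g)
  then obtain M M' where "\<forall>N\<ge>M. proj N (cls f) = cls f" "\<forall>N\<ge>M'. proj N (cls g) = cls g"
    by blast
  then have "\<forall>N\<ge>max M M'. proj N (cls (\<lambda>p. f p + g p)) = cls (\<lambda>p. f p + g p)"
    using trig_add.hyps by (simp add: cls_add trig_square_integrable proj_add)
  then show ?case by blast
qed

text \<open>The partial sums are contractions and eventually exact on each trigonometric polynomial,
  and these are dense.\<close>

lemma proj_tendsto: "(\<lambda>N. proj N u) \<longlonglongrightarrow> u"
proof (rule metric_LIMSEQ_I)
  fix e :: real assume "e > 0"
  then obtain f where f: "trig f" "norm (u - cls f) < e / 2"
    using trig_dense[of "e / 2" u] by auto
  obtain M where M: "\<forall>N\<ge>M. proj N (cls f) = cls f"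
    using proj_trig[OF f(1)] by blast
  have "dist (proj N u) u < e" if "N \<ge> M" for N
  proof -
    have "proj N u = proj N (u - cls f) + cls f"
      using proj_add[of N "u - cls f" "cls f"] M that by simp
    then have "proj N u - u = proj N (u - cls f) - (u - cls f)"
      by simp
    then have "norm (proj N u - u) \<le> norm (proj N (u - cls f)) + norm (u - cls f)"
      by (metis norm_triangle_ineq4)
    also have "\<dots> < e"
      using norm_proj_le[of N "u - cls f"] f(2) by simp
    finally show ?thesis by (simp add: dist_norm)
  qed
  then show "\<exists>M. \<forall>N\<ge>M. dist (proj N u) u < e" by blast
qed

lemma coef_eqD: "(\<And>k l. coef u k l = coef v k l) \<Longrightarrow> u = v"
  using proj_tendsto[of u] proj_tendsto[of v]
  by (auto simp: proj_eq intro: LIMSEQ_unique)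

lemma norm_le_of_coef_le:
  assumes "\<And>k l. norm (coef v k l) \<le> norm (coef u k l)"
  shows "norm v \<le> norm u"
proof (rule LIMSEQ_le_const2[OF tendsto_norm[OF proj_tendsto]])
  have "norm (proj N v) \<le> norm u" for N
  proof -
    have "(norm (proj N v))\<^sup>2 \<le> (\<Sum>(k, l)\<in>freq N. (norm (coef u k l))\<^sup>2)"
      unfolding norm_proj split_def by (intro sum_mono power_mono assms norm_ge_zero)
    also have "\<dots> \<le> (norm u)\<^sup>2" by (rule bessel)
    finally show ?thesis by (rule power2_le_imp_le) simp
  qed
  then show "\<exists>M. \<forall>N\<ge>M. norm (proj N v) \<le> norm u" by blast
qed

definition ess_bounded :: "real \<Rightarrow> torus_l2 \<Rightarrow> bool" where
  "ess_bounded K u \<longleftrightarrow> (AE p in torus. \<bar>fn u p\<bar> \<le> K)"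

text \<open>At every point the excess \<open>?g\<close> of |u| over K is at most the distance from u
  to its partial sum, so its L^2 norm is bounded by a quantity tending to zero. No subsequence
  converging almost everywhere has to be extracted.\<close>

lemma ess_bounded_limit:
  assumes "\<And>N p. \<bar>fourier_sum N u p\<bar> \<le> K"
  shows "ess_bounded K u"
proof -
  let ?g = "\<lambda>p. max (\<bar>fn u p\<bar> - K) 0"
  have sq: "square_integrable (\<lambda>p. fn u p - fourier_sum N u p)" for N
    by (intro square_integrable_diff fn_square_integrable trig_square_integrable fourier_sum_trig)
  have le: "\<bar>?g p\<bar> \<le> \<bar>fn u p - fourier_sum N u p\<bar>" for N p
    using assms[of N p] by linarith
  have gm: "?g \<in> borel_measurable torus" by measurable
  have g: "square_integrable ?g"
    by (rule square_integrable_mono[OF sq gm le])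
  have "(LINT p|torus. (?g p)\<^sup>2) \<le> (norm (u - proj N u))\<^sup>2" for N
  proof -
    have "(LINT p|torus. (?g p)\<^sup>2) \<le> (LINT p|torus. (fn u p - fourier_sum N u p)\<^sup>2)"
    proof (rule integral_mono)
      show "(?g p)\<^sup>2 \<le> (fn u p - fourier_sum N u p)\<^sup>2" for p
        by (rule le[unfolded abs_le_square_iff])
    qed (use g sq[of N] in \<open>simp_all only: square_integrable_def\<close>)
    also have "\<dots> = (norm (u - proj N u))\<^sup>2"
      using norm_cls[OF sq[of N]]
      by (simp add: cls_diff fn_square_integrable trig_square_integrable fourier_sum_trig abs_fn proj_def)
    finally show ?thesis .
  qed
  moreover have "(\<lambda>N. (norm (u - proj N u))\<^sup>2) \<longlonglongrightarrow> (norm (u - u))\<^sup>2"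
    by (intro tendsto_intros proj_tendsto)
  ultimately have "(LINT p|torus. (?g p)\<^sup>2) \<le> (norm (u - u))\<^sup>2"
    by (rule_tac LIMSEQ_le_const) blast+
  then have "(LINT p|torus. (?g p)\<^sup>2) = 0"
    by (intro antisym) auto
  then have "AE p in torus. (?g p)\<^sup>2 = 0"
    using g by (subst (asm) integral_nonneg_eq_0_iff_AE) (auto simp: square_integrable_def)
  then show ?thesis
    unfolding ess_bounded_def by eventually_elim (auto simp: max_def split: if_splits)
qed

text \<open>The correction -4/(N+1) makes the induction close: the two new terms add up to at most
  4/((N+1)(N+2)), the difference of consecutive corrections. At N = 0 both sides are 1.\<close>

lemma sum_inverse_squares_le:
  "(\<Sum>k\<in>{- int N..int N}. 1 / (1 + (real_of_int k)\<^sup>2)) \<le> 5 - 4 / (real N + 1)"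
proof (induction N)
  case (Suc N)
  have "{- int (Suc N)..int (Suc N)} = insert (int N + 1) (insert (- int N - 1) {- int N..int N})"
    by auto
  then have "(\<Sum>k\<in>{- int (Suc N)..int (Suc N)}. 1 / (1 + (real_of_int k)\<^sup>2)) =
      1 / (1 + (real N + 1)\<^sup>2) + 1 / (1 + (- real N - 1)\<^sup>2) +
      (\<Sum>k\<in>{- int N..int N}. 1 / (1 + (real_of_int k)\<^sup>2))"
    by simp
  also have "(- real N - 1)\<^sup>2 = (real N + 1)\<^sup>2"
    by (simp add: power2_eq_square algebra_simps)
  also have "1 / (1 + (real N + 1)\<^sup>2) + 1 / (1 + (real N + 1)\<^sup>2) +
      (\<Sum>k\<in>{- int N..int N}. 1 / (1 + (real_of_int k)\<^sup>2)) \<le>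
      2 / (1 + (real N + 1)\<^sup>2) + (5 - 4 / (real N + 1))"
    using Suc.IH by simp
  also have "2 / (1 + (real N + 1)\<^sup>2) \<le> 4 / ((real N + 1) * (real N + 2))"
  proof -
    have "(real N + 1) * (real N + 2) \<le> 2 * (1 + (real N + 1)\<^sup>2)"
      by (simp add: power2_eq_square algebra_simps)
    then have "4 / (2 * (1 + (real N + 1)\<^sup>2)) \<le> 4 / ((real N + 1) * (real N + 2))"
      by (intro divide_left_mono mult_pos_pos add_nonneg_pos add_pos_nonneg) auto
    moreover have "4 / (2 * a) = 2 / a" for a :: real
      by simp
    ultimately show ?thesis by (simp only:)
  qed
  also have "4 / ((real N + 1) * (real N + 2)) = 4 / (real N + 1) - 4 / (real N + 2)"
    by (simp add: field_simps)
  finally show ?case by (simp add: add.commute)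
qed simp

text \<open>Cauchy-Schwarz against the weight. The reciprocals of a product weight sum to the square
  of a one-dimensional sum, at most 25, whence the factor 5; and such a weight costs only one
  derivative in each variable and the mixed one.\<close>

lemma ess_bounded_weighted:
  assumes K: "0 \<le> K"
    and le: "\<And>N. (\<Sum>(k, l)\<in>freq N. (1 + (real_of_int k)\<^sup>2) * (1 + (real_of_int l)\<^sup>2) * (norm (coef u k l))\<^sup>2) \<le> K\<^sup>2"
  shows "ess_bounded (5 * K) u"
proof (rule ess_bounded_limit)
  fix N p
  define w where "w = (\<lambda>(k, l). (1 + (real_of_int k)\<^sup>2) * (1 + (real_of_int l)\<^sup>2))"
  have w: "w q > 0" for q
    by (cases q) (auto simp: w_def intro!: mult_pos_pos add_pos_nonneg)
  define c where "c q = norm (coef u (fst q) (snd q))" for q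
  have "\<bar>fourier_sum N u p\<bar> \<le> (\<Sum>q\<in>freq N. c q)"
    unfolding fourier_sum_def split_def c_def
    by (rule order_trans[OF sum_abs]) (intro sum_mono abs_mode_le)
  also have "\<dots> = (\<Sum>q\<in>freq N. (1 / sqrt (w q)) * (sqrt (w q) * c q))"
    using w by (intro sum.cong) (auto simp: less_imp_neq[symmetric])
  finally have 1: "\<bar>fourier_sum N u p\<bar> \<le> (\<Sum>q\<in>freq N. (1 / sqrt (w q)) * (sqrt (w q) * c q))" .
  have "(\<Sum>q\<in>freq N. (1 / sqrt (w q)) * (sqrt (w q) * c q))\<^sup>2 \<le>
      (\<Sum>q\<in>freq N. (1 / sqrt (w q))\<^sup>2) * (\<Sum>q\<in>freq N. (sqrt (w q) * c q)\<^sup>2)"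
    by (rule Cauchy_Schwarz_ineq_sum)
  also have "(\<Sum>q\<in>freq N. (1 / sqrt (w q))\<^sup>2) = (\<Sum>q\<in>freq N. 1 / w q)"
    using w by (simp add: power_divide less_imp_le)
  also have "\<dots> = (\<Sum>k\<in>{- int N..int N}. 1 / (1 + (real_of_int k)\<^sup>2)) *
      (\<Sum>k\<in>{- int N..int N}. 1 / (1 + (real_of_int k)\<^sup>2))"
    unfolding freq_def w_def sum_product sum.cartesian_product by (simp add: split_def)
  also have "(\<Sum>q\<in>freq N. (sqrt (w q) * c q)\<^sup>2) = (\<Sum>q\<in>freq N. w q * (c q)\<^sup>2)"
    using w by (simp add: power_mult_distrib less_imp_le)
  also have "(\<Sum>k\<in>{- int N..int N}. 1 / (1 + (real_of_int k)\<^sup>2)) *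
      (\<Sum>k\<in>{- int N..int N}. 1 / (1 + (real_of_int k)\<^sup>2)) * (\<Sum>q\<in>freq N. w q * (c q)\<^sup>2) \<le> 5 * 5 * K\<^sup>2"
  proof (intro mult_mono mult_nonneg_nonneg sum_nonneg)
    have "5 - 4 / (real N + 1) \<le> 5" by simp
    then show "(\<Sum>k\<in>{- int N..int N}. 1 / (1 + (real_of_int k)\<^sup>2)) \<le> 5"
      "(\<Sum>k\<in>{- int N..int N}. 1 / (1 + (real_of_int k)\<^sup>2)) \<le> 5"
      using sum_inverse_squares_le[of N] by linarith+
    show "(\<Sum>q\<in>freq N. w q * (c q)\<^sup>2) \<le> K\<^sup>2"
      using le[of N] by (simp add: w_def c_def split_def)
  qed (use w in \<open>auto intro: less_imp_le\<close>)
  finally have "(\<Sum>q\<in>freq N. (1 / sqrt (w q)) * (sqrt (w q) * c q))\<^sup>2 \<le> (5 * K)\<^sup>2"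
    by (simp add: power_mult_distrib)
  then have "(\<Sum>q\<in>freq N. (1 / sqrt (w q)) * (sqrt (w q) * c q)) \<le> 5 * K"
    by (rule power2_le_imp_le) (use K in simp)
  with 1 show "\<bar>fourier_sum N u p\<bar> \<le> 5 * K" by linarith
qed

section \<open>Weak derivatives and products\<close>

lemma square_integrable_continuous:
  assumes "continuous_on UNIV f"
  shows "square_integrable f"
proof -
  have "bounded (f ` cbox (0, 0) (1, 1))"
    by (intro compact_imp_bounded compact_continuous_image continuous_on_subset[OF assms])
      auto
  then obtain K where K: "\<And>p. p \<in> cbox (0, 0) (1, 1) \<Longrightarrow> \<bar>f p\<bar> \<le> K"
    by (auto simp: bounded_iff)
  show ?thesis
  proof (rule square_integrable_mono)
    show "square_integrable (\<lambda>p. K)"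
      by (rule trig_square_integrable[OF trig_const])
    show "f \<in> borel_measurable torus"
      by (intro measurable_torus borel_measurable_continuous_onI assms)
    show "\<bar>f p\<bar> \<le> \<bar>K\<bar>" if "p \<in> space torus" for p
      using K[of p] that by (auto simp: space_torus cbox_Pair_eq)
  qed
qed

lemma C_k_derivs:
  assumes "\<forall>k. C_k k f"
  shows "\<forall>k. C_k k ((D1 ^^ a) ((D2 ^^ b) f))"
proof -
  have 1: "\<forall>k. C_k k (D1 g)" "\<forall>k. C_k k (D2 g)" if "\<forall>k. C_k k g" for g
    using that[rule_format, of "Suc _"] by simp_all
  have "\<forall>k. C_k k ((D2 ^^ b) f)"
    by (induction b) (simp_all add: assms 1)
  then show ?thesis
    by (induction a) (simp_all add: 1)
qed

lemma test_function_square_integrable: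
  assumes "test_function f"
  shows "square_integrable ((D1 ^^ a) ((D2 ^^ b) f))"
proof -
  have "C_k 0 ((D1 ^^ a) ((D2 ^^ b) f))"
    using assms C_k_derivs unfolding test_function_def by blast
  then show ?thesis
    by (intro square_integrable_continuous) simp
qed

lemma has_weak_partial_inner:
  "has_weak_partial \<alpha> u v \<longleftrightarrow> (\<forall>f. test_function f \<longrightarrow>
     inner u (cls ((D1 ^^ fst \<alpha>) ((D2 ^^ snd \<alpha>) f))) = (- 1) ^ (fst \<alpha> + snd \<alpha>) * inner v (cls f))"
  unfolding has_weak_partial_def
  using test_function_square_integrable test_function_square_integrable[of _ 0 0]
  by (simp add: inner_cls)

lemma has_weak_partial_diff:
  "has_weak_partial \<alpha> u v \<Longrightarrow> has_weak_partial \<alpha> u' v' \<Longrightarrow> has_weak_partial \<alpha> (u - u') (v - v')"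
  by (simp add: has_weak_partial_inner inner_diff_left right_diff_distrib)

lemma has_weak_partial_zero: "has_weak_partial \<alpha> 0 0"
  by (simp add: has_weak_partial_inner)

definition dsymbol :: "nat \<times> nat \<Rightarrow> int \<Rightarrow> int \<Rightarrow> complex" where
  "dsymbol \<alpha> k l = (2 * pi * \<i> * k) ^ fst \<alpha> * (2 * pi * \<i> * l) ^ snd \<alpha>"

lemma iterated_mode: "(D1 ^^ a) ((D2 ^^ b) (mode z k l)) = mode (dsymbol (a, b) k l * z) k l"
proof -
  have "(D2 ^^ b) (mode z k l) = mode ((2 * pi * \<i> * l) ^ b * z) k l"
    by (induction b) (simp_all add: D2_mode mult_ac)
  moreover have "(D1 ^^ a) (mode w k l) = mode ((2 * pi * \<i> * k) ^ a * w) k l" for w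
    by (induction a) (simp_all add: D1_mode mult_ac)
  ultimately show ?thesis
    by (simp add: dsymbol_def mult_ac)
qed

text \<open>Testing with single modes turns the definition into an identity of coefficients. The
  sign (-1)^|\<alpha>| is absorbed by conjugation, because \<open>dsymbol\<close> is a product of
  |\<alpha>| imaginary factors.\<close>

lemma coef_weak_partial:
  assumes "has_weak_partial \<alpha> u v"
  shows "coef v k l = dsymbol \<alpha> k l * coef u k l"
proof -
  let ?s = "(- 1) ^ (fst \<alpha> + snd \<alpha>) :: complex"
  have "Re (z * (dsymbol \<alpha> k l * cnj (coef u k l))) = Re (z * (?s * cnj (coef v k l)))" for z
  proof -
    have "Re (dsymbol \<alpha> k l * z * cnj (coef u k l)) = (- 1) ^ (fst \<alpha> + snd \<alpha>) * Re (z * cnj (coef v k l))"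
    proof -
      have "inner u (cls ((D1 ^^ fst \<alpha>) ((D2 ^^ snd \<alpha>) (mode z k l)))) =
          (- 1) ^ (fst \<alpha> + snd \<alpha>) * inner v (cls (mode z k l))"
        using assms test_function_trig[OF trig_mode] unfolding has_weak_partial_inner by blast
      then show ?thesis
        by (simp only: iterated_mode inner_mode prod.collapse)
    qed
    then show ?thesis
      by (cases "even (fst \<alpha> + snd \<alpha>)") (simp_all add: mult_ac)
  qed
  from this[of 1] this[of \<i>] have "dsymbol \<alpha> k l * cnj (coef u k l) = ?s * cnj (coef v k l)"
    by (auto simp: complex_eq_iff)
  then have "cnj (dsymbol \<alpha> k l * cnj (coef u k l)) = cnj (?s * cnj (coef v k l))"
    by (rule arg_cong)
  then have 1: "cnj (dsymbol \<alpha> k l) * coef u k l = ?s * coef v k l"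
    by simp
  have "cnj (dsymbol \<alpha> k l) = ?s * dsymbol \<alpha> k l"
    by (simp add: dsymbol_def power_mult_distrib[of "-1", symmetric] power_add mult_ac)
      (simp add: power_minus[of "\<i> * _"] mult_ac)
  with 1 have "?s * (?s * (dsymbol \<alpha> k l * coef u k l)) = ?s * (?s * coef v k l)"
    by (simp add: mult.assoc)
  moreover have "?s * (?s * x) = x" for x
    by (simp flip: mult.assoc power_add)
  ultimately show ?thesis by simp
qed

text \<open>Fourier coefficients determine the class, so weak derivatives are unique and the
  definite description denotes.\<close>

lemma weak_partial_eq:
  assumes "has_weak_partial \<alpha> u v"
  shows "weak_partial \<alpha> u = v"
  unfolding weak_partial_def
proof (rule the_equality)
  show "has_weak_partial \<alpha> u v" by (rule assms)
next
  fix v' assume "has_weak_partial \<alpha> u v'"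
  then show "v' = v"
    using assms by (intro coef_eqD) (simp add: coef_weak_partial)
qed

lemma has_weak_partial_sobolev:
  assumes "u \<in> sobolev m" "\<alpha> \<in> multi_indices m"
  shows "has_weak_partial \<alpha> u (weak_partial \<alpha> u)"
  using assms weak_partial_eq unfolding sobolev_def by blast

lemma sobolev_diff: "u \<in> sobolev m \<Longrightarrow> v \<in> sobolev m \<Longrightarrow> u - v \<in> sobolev m"
  unfolding sobolev_def using has_weak_partial_diff by blast

lemma weak_partial_diff:
  assumes "u \<in> sobolev m" "v \<in> sobolev m" "\<alpha> \<in> multi_indices m"
  shows "weak_partial \<alpha> (u - v) = weak_partial \<alpha> u - weak_partial \<alpha> v"
  by (intro weak_partial_eq has_weak_partial_diff has_weak_partial_sobolev[of _ m] assms)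

lemma weak_partial_zero: "weak_partial \<alpha> 0 = 0"
  by (rule weak_partial_eq[OF has_weak_partial_zero])

lemma sobolev_norm_zero: "sobolev_norm k 0 = 0"
  by (simp add: sobolev_norm_def weak_partial_zero)

lemma coef_weak_partial_sobolev:
  "u \<in> sobolev m \<Longrightarrow> \<alpha> \<in> multi_indices m \<Longrightarrow> coef (weak_partial \<alpha> u) k l = dsymbol \<alpha> k l * coef u k l"
  by (rule coef_weak_partial[OF has_weak_partial_sobolev])

text \<open>The form behind every flux pairing. Three factors in L^2 need not have an integrable
  product, so the estimates place an essentially bounded factor in the first slot. The symmetries
  hold for all arguments, because the integrand is the same function.\<close>

definition tri :: "torus_l2 \<Rightarrow> torus_l2 \<Rightarrow> torus_l2 \<Rightarrow> real" where
  "tri v a b = (LINT p|torus. fn v p * fn a p * fn b p)"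

lemma tri_commute: "tri v a b = tri a v b" "tri v a b = tri v b a"
  by (simp_all add: tri_def mult_ac)

lemma square_integrable_ess_bounded:
  assumes "ess_bounded K v" "square_integrable f"
  shows "square_integrable (\<lambda>p. fn v p * f p)" "(LINT p|torus. (fn v p * f p)\<^sup>2) \<le> (LINT p|torus. (K * f p)\<^sup>2)"
proof -
  have [measurable]: "f \<in> borel_measurable torus"
    using assms by (simp add: square_integrable_def)
  have K: "integrable torus (\<lambda>p. (K * f p)\<^sup>2)"
    using square_integrable_cmult[OF assms(2), of K] by (simp add: square_integrable_def)
  have le: "AE p in torus. (fn v p * f p)\<^sup>2 \<le> (K * f p)\<^sup>2"
    using assms(1) unfolding ess_bounded_def
  proof eventually_elim
    case (elim p)
    then have "(fn v p)\<^sup>2 \<le> K\<^sup>2"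
      by (metis abs_ge_zero power2_abs power_mono)
    then show ?case
      by (simp add: power_mult_distrib mult_right_mono)
  qed
  have int: "integrable torus (\<lambda>p. (fn v p * f p)\<^sup>2)"
    by (rule Bochner_Integration.integrable_bound[OF K]) (use le in auto)
  then show "square_integrable (\<lambda>p. fn v p * f p)"
    by (simp add: square_integrable_def)
  show "(LINT p|torus. (fn v p * f p)\<^sup>2) \<le> (LINT p|torus. (K * f p)\<^sup>2)"
    by (rule integral_mono_AE[OF int K le])
qed

lemma tri_inner:
  assumes "ess_bounded K v"
  shows "tri v a b = inner (cls (\<lambda>p. fn v p * fn a p)) b"
  using inner_cls[OF square_integrable_ess_bounded(1)[OF assms fn_square_integrable], of b a]
  by (simp add: tri_def inner_commute mult_ac)

lemma norm_mult_ess_bounded: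
  assumes "ess_bounded K v" "0 \<le> K"
  shows "norm (cls (\<lambda>p. fn v p * fn a p)) \<le> K * norm a"
proof (rule power2_le_imp_le)
  have "(norm (cls (\<lambda>p. fn v p * fn a p)))\<^sup>2 \<le> (LINT p|torus. (K * fn a p)\<^sup>2)"
    using square_integrable_ess_bounded[OF assms(1) fn_square_integrable] by (simp add: norm_cls)
  also have "\<dots> = (norm (cls (\<lambda>p. K * fn a p)))\<^sup>2"
    by (simp add: norm_cls square_integrable_cmult fn_square_integrable)
  also have "\<dots> = (K * norm a)\<^sup>2"
    using assms(2) by (simp add: cls_cmult fn_square_integrable abs_fn)
  finally show "(norm (cls (\<lambda>p. fn v p * fn a p)))\<^sup>2 \<le> (K * norm a)\<^sup>2" .
qed (use assms in simp)

lemma abs_tri_le: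
  assumes "ess_bounded K v" "0 \<le> K"
  shows "\<bar>tri v a b\<bar> \<le> K * norm a * norm b"
proof -
  have "\<bar>tri v a b\<bar> \<le> norm (cls (\<lambda>p. fn v p * fn a p)) * norm b"
    unfolding tri_inner[OF assms(1)] by (rule Cauchy_Schwarz_ineq2)
  also have "\<dots> \<le> K * norm a * norm b"
    by (intro mult_right_mono norm_mult_ess_bounded assms norm_ge_zero)
  finally show ?thesis .
qed

lemma ess_bounded_mono: "ess_bounded K v \<Longrightarrow> K \<le> L \<Longrightarrow> ess_bounded L v"
  unfolding ess_bounded_def by (auto elim: eventually_mono)

lemma tri_add_right: "ess_bounded K v \<Longrightarrow> tri v a (b + c) = tri v a b + tri v a c"
  by (simp add: tri_inner inner_add_right)

lemma tri_scaleR_right: "ess_bounded K v \<Longrightarrow> tri v a (r *\<^sub>R b) = r * tri v a b"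
  by (simp add: tri_inner)

lemma bounded_bilinear_tri:
  assumes "ess_bounded K v"
  shows "bounded_bilinear (tri v)"
proof
  \<comment> \<open>\<open>ess_bounded\<close> does not state a sign for \<open>K\<close>, whereas
    \<open>abs_tri_le\<close> asks for a nonnegative constant.\<close>
  have K: "ess_bounded \<bar>K\<bar> v"
    using assms by (rule ess_bounded_mono) simp
  fix a a' b b' :: torus_l2 and r :: real
  show "tri v a (b + b') = tri v a b + tri v a b'" "tri v a (r *\<^sub>R b) = r *\<^sub>R tri v a b"
    using assms by (simp_all add: tri_add_right tri_scaleR_right)
  show "tri v (a + a') b = tri v a b + tri v a' b" "tri v (r *\<^sub>R a) b = r *\<^sub>R tri v a b"
    using assms by (simp_all add: tri_commute(2)[of v _ b] tri_add_right tri_scaleR_right)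
  show "\<exists>K. \<forall>a b. norm (tri v a b) \<le> norm a * norm b * K"
    using abs_tri_le[OF K] by (auto simp: mult_ac intro!: exI[of _ "\<bar>K\<bar>"])
qed

lemma tri_cls:
  assumes "ess_bounded K v" "square_integrable f"
  shows "tri v a (cls f) = (LINT p|torus. fn v p * fn a p * f p)"
  using inner_cls_cls[OF square_integrable_ess_bounded(1)[OF assms(1) fn_square_integrable[of a]] assms(2)]
  by (simp add: tri_inner[OF assms(1)])

lemma tri_trig:
  assumes "ess_bounded K v" "trig f" "trig g"
  shows "tri v (cls f) (cls g) = inner v (cls (\<lambda>p. f p * g p))"
proof -
  have "tri v (cls f) (cls g) = (LINT p|torus. fn v p * fn (cls f) p * g p)"
    using assms by (simp add: tri_cls trig_square_integrable)
  also have "\<dots> = (LINT p|torus. fn v p * (f p * g p))"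
  proof (rule integral_cong_AE)
    have [measurable]: "f \<in> borel_measurable torus" "g \<in> borel_measurable torus"
      using assms trig_square_integrable by (auto simp: square_integrable_def)
    show "(\<lambda>p. fn v p * fn (cls f) p * g p) \<in> borel_measurable torus"
      "(\<lambda>p. fn v p * (f p * g p)) \<in> borel_measurable torus" by measurable
    show "AE p in torus. fn v p * fn (cls f) p * g p = fn v p * (f p * g p)"
      using fn_abs[OF trig_square_integrable[OF assms(2)]] by eventually_elim simp
  qed
  also have "\<dots> = inner v (cls (\<lambda>p. f p * g p))"
    using assms by (simp add: inner_cls trig_square_integrable trig_mult)
  finally show ?thesis .
qed

text \<open>Integration by parts is the same in x and in y, so both derivatives are treated as
  instances. \<open>cnj_s\<close> says that the symbol is imaginary, which makes the derivation
  antisymmetric. The index type in \<open>D_sum\<close> is fixed because a locale assumption cannot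
  be polymorphic in it.\<close>

locale fourier_derivation =
  fixes D :: "(real \<times> real \<Rightarrow> real) \<Rightarrow> real \<times> real \<Rightarrow> real" and s :: "int \<Rightarrow> int \<Rightarrow> complex"
  assumes D_mode: "D (mode z k l) = mode (s k l * z) k l"
    and cnj_s: "cnj (s k l) = - s k l"
    and D_add: "trig f \<Longrightarrow> trig g \<Longrightarrow> D (\<lambda>p. f p + g p) = (\<lambda>p. D f p + D g p)"
    and D_sum: "finite (A :: (int \<times> int) set) \<Longrightarrow> (\<And>i. i \<in> A \<Longrightarrow> trig (F i)) \<Longrightarrow>
      D (\<lambda>p. \<Sum>i\<in>A. F i p) = (\<lambda>p. \<Sum>i\<in>A. D (F i) p)"
    and D_mult: "trig f \<Longrightarrow> trig g \<Longrightarrow> D (\<lambda>p. f p * g p) = (\<lambda>p. f p * D g p + g p * D f p)"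
    and D_trig: "trig f \<Longrightarrow> trig (D f)"
begin

text \<open>Expressed on coefficients, differentiation commutes with partial sums at once and
  applies alike to a function and to its weak derivatives.\<close>

definition deriv_of :: "torus_l2 \<Rightarrow> torus_l2 \<Rightarrow> bool" where
  "deriv_of u u' \<longleftrightarrow> (\<forall>k l. coef u' k l = s k l * coef u k l)"

lemma D_fourier_sum:
  assumes "deriv_of u u'"
  shows "D (fourier_sum N u) = fourier_sum N u'"
proof -
  have "D (fourier_sum N u) = (\<lambda>p. \<Sum>q\<in>freq N. D (mode (coef u (fst q) (snd q)) (fst q) (snd q)) p)"
    unfolding fourier_sum_def[abs_def] split_def
    by (rule D_sum) (simp_all add: trig_mode)
  then show ?thesis
    using assms by (simp add: D_mode deriv_of_def fourier_sum_def[abs_def] split_def)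
qed

lemma inner_D_trig:
  assumes "deriv_of u u'" "trig f"
  shows "inner u (cls (D f)) = - inner u' (cls f)"
  using assms(2)
proof (induction rule: trig.induct)
  case (trig_mode z k l)
  then show ?case
    using assms(1) by (simp add: D_mode inner_mode deriv_of_def cnj_s algebra_simps)
next
  case (trig_add f g)
  then show ?case
    by (simp add: D_add cls_add trig_square_integrable D_trig inner_add_right)
qed

lemma inner_deriv_of:
  assumes "deriv_of u u'" "deriv_of v v'"
  shows "inner u v' = - inner u' v"
proof (rule LIMSEQ_unique)
  have "inner u (proj N v') = - inner u' (proj N v)" for N
    using inner_D_trig[OF assms(1) fourier_sum_trig[of N v]]
    by (simp add: D_fourier_sum[OF assms(2)] proj_def)
  then have "(\<lambda>N. inner u (proj N v')) = (\<lambda>N. - inner u' (proj N v))" by simp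
  moreover have "(\<lambda>N. - inner u' (proj N v)) \<longlonglongrightarrow> - inner u' v"
    by (intro tendsto_intros proj_tendsto)
  ultimately show "(\<lambda>N. inner u (proj N v')) \<longlonglongrightarrow> - inner u' v"
    by simp
  show "(\<lambda>N. inner u (proj N v')) \<longlonglongrightarrow> inner u v'"
    by (intro tendsto_intros proj_tendsto)
qed

text \<open>Leibniz's rule for the product of a and b, paired with v. Only a and b are replaced by
  partial sums, whose product is again a trigonometric polynomial, so that
  \<open>inner_D_trig\<close> applies to it; v stays fixed. The bounds on v and its derivative make
  both sides continuous in the other arguments.\<close>

lemma tri_deriv_of:
  assumes v: "ess_bounded K v" "ess_bounded L v'" "deriv_of v v'"
    and ab: "deriv_of a a'" "deriv_of b b'"
  shows "tri v a b' + tri v b a' = - tri v' a b"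
proof (rule LIMSEQ_unique)
  interpret V: bounded_bilinear "tri v" by (rule bounded_bilinear_tri[OF v(1)])
  interpret V': bounded_bilinear "tri v'" by (rule bounded_bilinear_tri[OF v(2)])
  have "tri v (proj N a) (proj N b') + tri v (proj N b) (proj N a') = - tri v' (proj N a) (proj N b)" for N
  proof -
    let ?f = "fourier_sum N a" and ?g = "fourier_sum N b"
    note t = fourier_sum_trig[of N a] fourier_sum_trig[of N b]
    have "tri v (proj N a) (proj N b') + tri v (proj N b) (proj N a') =
        inner v (cls (\<lambda>p. ?f p * D ?g p)) + inner v (cls (\<lambda>p. ?g p * D ?f p))"
      unfolding proj_def D_fourier_sum[OF ab(1)] D_fourier_sum[OF ab(2)]
      by (simp only: tri_trig[OF v(1)] fourier_sum_trig)
    also have "\<dots> = inner v (cls (D (\<lambda>p. ?f p * ?g p)))"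
      by (simp only: D_mult t cls_add trig_square_integrable trig_mult D_trig inner_add_right)
    also have "\<dots> = - inner v' (cls (\<lambda>p. ?f p * ?g p))"
      by (intro inner_D_trig v trig_mult t)
    also have "\<dots> = - tri v' (proj N a) (proj N b)"
      unfolding proj_def by (simp only: tri_trig[OF v(2)] t)
    finally show ?thesis .
  qed
  then have "(\<lambda>N. tri v (proj N a) (proj N b') + tri v (proj N b) (proj N a')) =
      (\<lambda>N. - tri v' (proj N a) (proj N b))" by simp
  moreover have "(\<lambda>N. - tri v' (proj N a) (proj N b)) \<longlonglongrightarrow> - tri v' a b"
    by (intro tendsto_minus V'.tendsto proj_tendsto)
  ultimately show "(\<lambda>N. tri v (proj N a) (proj N b') + tri v (proj N b) (proj N a')) \<longlonglongrightarrow> - tri v' a b"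
    by simp
  show "(\<lambda>N. tri v (proj N a) (proj N b') + tri v (proj N b) (proj N a')) \<longlonglongrightarrow> tri v a b' + tri v b a'"
    by (intro tendsto_add V.tendsto proj_tendsto)
qed

end

interpretation dx: fourier_derivation D1 "\<lambda>k l. 2 * pi * \<i> * k"
  by unfold_locales (simp_all add: D1_mode D_trig_add D_trig_sum D_trig_mult trig_deriv)

interpretation dy: fourier_derivation D2 "\<lambda>k l. 2 * pi * \<i> * l"
  by unfold_locales (simp_all add: D2_mode D_trig_add D_trig_sum D_trig_mult trig_deriv)

text \<open>Enlarges the test functions from smooth ones to classes with a gradient in L^2. The
  bound on \<open>a\<close> puts the flux into L^2, so the left side is continuous in the gradient
  of the test function.\<close>

lemma has_div_flux_limit:
  assumes flux: "has_div_flux a v g" and a: "ess_bounded K a"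
    and c: "dx.deriv_of c cx" "dy.deriv_of c cy"
  shows "tri a (fst v) cx + tri a (snd v) cy = - inner g c"
proof (rule LIMSEQ_unique)
  interpret A: bounded_bilinear "tri a" by (rule bounded_bilinear_tri[OF a])
  have "tri a (fst v) (proj N cx) + tri a (snd v) (proj N cy) = - inner g (proj N c)" for N
  proof -
    let ?f = "fourier_sum N c"
    have sq: "square_integrable (fourier_sum N u)" for u
      by (rule trig_square_integrable[OF fourier_sum_trig])
    have int: "integrable torus (\<lambda>p. fn a p * fn w p * fourier_sum N u p)" for w u
      by (intro square_integrable_mult square_integrable_ess_bounded(1)[OF a] fn_square_integrable sq)
    have "tri a (fst v) (proj N cx) + tri a (snd v) (proj N cy) =
       (LINT p|torus. fn a p * fn (fst v) p * D1 ?f p) + (LINT p|torus. fn a p * fn (snd v) p * D2 ?f p)"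
      by (simp add: proj_def tri_cls[OF a] sq dx.D_fourier_sum[OF c(1)] dy.D_fourier_sum[OF c(2)])
    also have "\<dots> = (LINT p|torus. fn a p * fn (fst v) p * D1 ?f p + fn a p * fn (snd v) p * D2 ?f p)"
      by (rule Bochner_Integration.integral_add[symmetric])
        (simp_all add: dx.D_fourier_sum[OF c(1)] dy.D_fourier_sum[OF c(2)] int)
    also have "\<dots> = - (LINT p|torus. fn g p * ?f p)"
      using flux test_function_trig[OF fourier_sum_trig]
      by (auto simp: has_div_flux_def has_weak_div_def)
    also have "\<dots> = - inner g (proj N c)"
      by (simp add: proj_def inner_cls sq)
    finally show ?thesis .
  qed
  then have "(\<lambda>N. tri a (fst v) (proj N cx) + tri a (snd v) (proj N cy)) = (\<lambda>N. - inner g (proj N c))"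
    by simp
  moreover have "(\<lambda>N. - inner g (proj N c)) \<longlonglongrightarrow> - inner g c"
    by (intro tendsto_intros proj_tendsto)
  ultimately show "(\<lambda>N. tri a (fst v) (proj N cx) + tri a (snd v) (proj N cy)) \<longlonglongrightarrow> - inner g c"
    by simp
  show "(\<lambda>N. tri a (fst v) (proj N cx) + tri a (snd v) (proj N cy)) \<longlonglongrightarrow> tri a (fst v) cx + tri a (snd v) cy"
    by (intro tendsto_add A.tendsto tendsto_const proj_tendsto)
qed

section \<open>Sobolev and Helmholtz estimates\<close>

lemma weak_partial_0: "u \<in> sobolev m \<Longrightarrow> weak_partial (0, 0) u = u"
  by (rule coef_eqD) (simp add: coef_weak_partial_sobolev multi_indices_def dsymbol_def)

lemma sobolev_mono: "u \<in> sobolev m \<Longrightarrow> n \<le> m \<Longrightarrow> u \<in> sobolev n"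
  unfolding sobolev_def multi_indices_def by fastforce

lemma deriv_of_weak_partial:
  assumes "u \<in> sobolev m" "Suc (a + b) \<le> m"
  shows "dx.deriv_of (weak_partial (a, b) u) (weak_partial (Suc a, b) u)"
    "dy.deriv_of (weak_partial (a, b) u) (weak_partial (a, Suc b) u)"
  using assms unfolding dx.deriv_of_def dy.deriv_of_def
  by (simp_all add: coef_weak_partial_sobolev[OF assms(1)] multi_indices_def dsymbol_def mult_ac)

lemma norm_weak_partial_le:
  assumes "\<alpha> \<in> multi_indices m"
  shows "norm (weak_partial \<alpha> u) \<le> sobolev_norm m u"
  unfolding sobolev_norm_def
  by (rule real_le_rsqrt, rule member_le_sum[OF assms]) (auto simp: finite_multi_indices)

lemma norm_le_sobolev_norm: "u \<in> sobolev m \<Longrightarrow> norm u \<le> sobolev_norm m u"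
  using norm_weak_partial_le[of "(0, 0)" m u] by (simp add: weak_partial_0 multi_indices_def)

lemma sobolev_norm_nonneg: "0 \<le> sobolev_norm m u"
  by (simp add: sobolev_norm_def sum_nonneg)

text \<open>With x = (2 pi k)^2 and y = (2 pi l)^2 the weight is at most (1 + x)(1 + y), whose four
  monomials are the squared moduli of the symbols of the identity, the two first derivatives and the
  mixed one. Two orders are thus spent for an essential bound.\<close>

lemma weighted_sum_le:
  assumes u: "u \<in> sobolev m" and m: "a + b + 2 \<le> m"
  shows "(\<Sum>(k, l)\<in>freq N. (1 + (real_of_int k)\<^sup>2) * (1 + (real_of_int l)\<^sup>2) *
    (norm (coef (weak_partial (a, b) u) k l))\<^sup>2) \<le> (sobolev_norm m u)\<^sup>2"
proof -
  define B where "B = {(a, b), (Suc a, b), (a, Suc b), (Suc a, Suc b)}"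
  have B: "B \<subseteq> multi_indices m"
    using m by (auto simp: B_def multi_indices_def)
  have 1: "(1 + (real_of_int k)\<^sup>2) * (1 + (real_of_int l)\<^sup>2) * (norm (coef (weak_partial (a, b) u) k l))\<^sup>2 \<le>
      (\<Sum>\<alpha>\<in>B. (norm (coef (weak_partial \<alpha> u) k l))\<^sup>2)" for k l
  proof -
    define c where "c = (norm (coef (weak_partial (a, b) u) k l))\<^sup>2"
    have pi1: "1 \<le> (2 * pi)\<^sup>2"
      using pi_ge_two by (intro one_le_power) linarith
    define x where "x = (2 * pi)\<^sup>2 * (real_of_int k)\<^sup>2"
    define y where "y = (2 * pi)\<^sup>2 * (real_of_int l)\<^sup>2"
    have x: "(real_of_int k)\<^sup>2 \<le> x" "(real_of_int l)\<^sup>2 \<le> y"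
      using mult_right_mono[OF pi1, of "(real_of_int k)\<^sup>2"] mult_right_mono[OF pi1, of "(real_of_int l)\<^sup>2"]
      by (simp_all add: x_def y_def)
    have c: "(norm (coef (weak_partial (Suc a, b) u) k l))\<^sup>2 = x * c"
      "(norm (coef (weak_partial (a, Suc b) u) k l))\<^sup>2 = y * c"
      "(norm (coef (weak_partial (Suc a, Suc b) u) k l))\<^sup>2 = x * y * c"
      using B unfolding B_def c_def x_def y_def
      by (simp_all add: coef_weak_partial_sobolev[OF u] dsymbol_def norm_mult norm_power power_mult_distrib mult_ac)
    have "(1 + (real_of_int k)\<^sup>2) * (1 + (real_of_int l)\<^sup>2) * c \<le> (1 + x) * (1 + y) * c"
      using x order_trans[OF zero_le_power2 x(1)] order_trans[OF zero_le_power2 x(2)]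
      by (intro mult_mono) (auto simp: c_def)
    also have "\<dots> = (\<Sum>\<alpha>\<in>B. (norm (coef (weak_partial \<alpha> u) k l))\<^sup>2)"
      by (simp add: B_def c) (simp add: c_def algebra_simps)
    finally show ?thesis by (simp add: c_def)
  qed
  have "(\<Sum>(k, l)\<in>freq N. (1 + (real_of_int k)\<^sup>2) * (1 + (real_of_int l)\<^sup>2) *
      (norm (coef (weak_partial (a, b) u) k l))\<^sup>2) \<le>
      (\<Sum>(k, l)\<in>freq N. \<Sum>\<alpha>\<in>B. (norm (coef (weak_partial \<alpha> u) k l))\<^sup>2)"
    using 1 by (intro sum_mono) auto
  also have "\<dots> = (\<Sum>\<alpha>\<in>B. \<Sum>(k, l)\<in>freq N. (norm (coef (weak_partial \<alpha> u) k l))\<^sup>2)"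
    unfolding split_def by (rule sum.swap)
  also have "\<dots> \<le> (\<Sum>\<alpha>\<in>B. (norm (weak_partial \<alpha> u))\<^sup>2)"
    by (intro sum_mono bessel)
  also have "\<dots> \<le> (\<Sum>\<alpha>\<in>multi_indices m. (norm (weak_partial \<alpha> u))\<^sup>2)"
    by (intro sum_mono2 finite_multi_indices B) auto
  also have "\<dots> = (sobolev_norm m u)\<^sup>2"
    by (simp add: sobolev_norm_def sum_nonneg)
  finally show ?thesis .
qed

text \<open>Stated through domination of coefficients so that \<open>v\<close> may be something
  other than a derivative of \<open>u\<close>. For second derivatives of a stream function this
  gives essential bounds without showing first that it has four derivatives.\<close>

lemma ess_bounded_dominated:
  assumes u: "u \<in> sobolev m" "a + b + 2 \<le> m"
    and le: "\<And>k l. norm (coef v k l) \<le> norm (coef (weak_partial (a, b) u) k l)"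
  shows "ess_bounded (5 * sobolev_norm m u) v"
proof (rule ess_bounded_weighted[OF sobolev_norm_nonneg])
  fix N
  have "(\<Sum>(k, l)\<in>freq N. (1 + (real_of_int k)\<^sup>2) * (1 + (real_of_int l)\<^sup>2) * (norm (coef v k l))\<^sup>2) \<le>
      (\<Sum>(k, l)\<in>freq N. (1 + (real_of_int k)\<^sup>2) * (1 + (real_of_int l)\<^sup>2) *
        (norm (coef (weak_partial (a, b) u) k l))\<^sup>2)"
    by (intro sum_mono) (auto intro!: mult_left_mono power_mono le)
  also have "\<dots> \<le> (sobolev_norm m u)\<^sup>2"
    by (rule weighted_sum_le[OF u])
  finally show "(\<Sum>(k, l)\<in>freq N. (1 + (real_of_int k)\<^sup>2) * (1 + (real_of_int l)\<^sup>2) *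
      (norm (coef v k l))\<^sup>2) \<le> (sobolev_norm m u)\<^sup>2" .
qed

lemma ess_bounded_diff:
  assumes "ess_bounded K u" "ess_bounded L v"
  shows "ess_bounded (K + L) (u - v)"
  using assms fn_diff[of u v] unfolding ess_bounded_def by eventually_elim linarith

section \<open>Elliptic estimates for Delta - 1\<close>

definition solves_helmholtz :: "torus_l2 \<Rightarrow> torus_l2 \<Rightarrow> bool" where
  "solves_helmholtz g \<psi> \<longleftrightarrow> \<psi> \<in> sobolev 2 \<and> laplacian \<psi> - \<psi> = g"

lemma laplacian_diff:
  assumes "u \<in> sobolev 2" "v \<in> sobolev 2"
  shows "laplacian (u - v) = laplacian u - laplacian v"
  unfolding laplacian_def
  using weak_partial_diff[OF assms, of "(2, 0)"] weak_partial_diff[OF assms, of "(0, 2)"]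
  by (simp add: multi_indices_def)

lemma solves_helmholtz_diff:
  "solves_helmholtz g \<psi> \<Longrightarrow> solves_helmholtz g' \<psi>' \<Longrightarrow> solves_helmholtz (g - g') (\<psi> - \<psi>')"
  unfolding solves_helmholtz_def by (auto simp: sobolev_diff laplacian_diff)

lemma monomial_le:
  fixes x y :: real
  assumes "0 \<le> x" "0 \<le> y" "a + b \<le> 2"
  shows "x ^ a * y ^ b \<le> 1 + x\<^sup>2 + y\<^sup>2"
proof -
  have "2 * x \<le> 1 + x\<^sup>2" "2 * y \<le> 1 + y\<^sup>2" "2 * (x * y) \<le> x\<^sup>2 + y\<^sup>2"
    using sum_squares_bound[of 1 x] sum_squares_bound[of 1 y] sum_squares_bound[of x y]
    by (simp_all add: mult.assoc)
  moreover have "0 \<le> x * y" using assms by simp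
  ultimately have "x \<le> 1 + x\<^sup>2 + y\<^sup>2" "y \<le> 1 + x\<^sup>2 + y\<^sup>2" "x * y \<le> 1 + x\<^sup>2 + y\<^sup>2"
    using assms zero_le_power2[of x] zero_le_power2[of y] by linarith+
  moreover have "(a, b) \<in> {(0, 0), (1, 0), (0, 1), (2, 0), (1, 1), (0, 2)}"
    using assms(3) by auto
  ultimately show ?thesis by auto
qed

text \<open>In Fourier variables 1 - Delta multiplies by 1 + x^2 + y^2, with x = 2 pi |k| and y = 2
  pi |l|, and this dominates every monomial of degree at most 2. Elliptic regularity thus holds with
  constant 1.\<close>

lemma coef_stream_le:
  assumes "solves_helmholtz g \<psi>" "\<alpha> \<in> multi_indices 2"
  shows "norm (coef (weak_partial \<alpha> \<psi>) k l) \<le> norm (coef g k l)"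
proof -
  define x y where "x = 2 * pi * \<bar>real_of_int k\<bar>" and "y = 2 * pi * \<bar>real_of_int l\<bar>"
  have \<psi>: "\<psi> \<in> sobolev 2" and g: "g = laplacian \<psi> - \<psi>"
    using assms(1) by (auto simp: solves_helmholtz_def)
  have "coef g k l = - of_real (1 + x\<^sup>2 + y\<^sup>2) * coef \<psi> k l"
    unfolding g laplacian_def x_def y_def
    by (simp add: coef_diff coef_add coef_weak_partial_sobolev[OF \<psi>] multi_indices_def dsymbol_def
        power_mult_distrib algebra_simps)
  then have "norm (coef g k l) = (1 + x\<^sup>2 + y\<^sup>2) * norm (coef \<psi> k l)"
    by (simp add: norm_mult del: of_real_add)
  moreover have "norm (coef (weak_partial \<alpha> \<psi>) k l) = x ^ fst \<alpha> * y ^ snd \<alpha> * norm (coef \<psi> k l)"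
    by (simp add: coef_weak_partial_sobolev[OF \<psi> assms(2)] dsymbol_def norm_mult norm_power x_def y_def)
  moreover have "x ^ fst \<alpha> * y ^ snd \<alpha> \<le> 1 + x\<^sup>2 + y\<^sup>2"
    using assms(2) by (intro monomial_le) (auto simp: x_def y_def multi_indices_def)
  ultimately show ?thesis
    by (simp add: mult_right_mono)
qed

lemma norm_stream_le:
  "solves_helmholtz g \<psi> \<Longrightarrow> \<alpha> \<in> multi_indices 2 \<Longrightarrow> norm (weak_partial \<alpha> \<psi>) \<le> norm g"
  by (intro norm_le_of_coef_le coef_stream_le)

lemma ess_bounded_stream:
  assumes "solves_helmholtz g \<psi>" "\<alpha> \<in> multi_indices 2" "g \<in> sobolev 2"
  shows "ess_bounded (5 * sobolev_norm 2 g) (weak_partial \<alpha> \<psi>)"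
  using coef_stream_le[OF assms(1,2)]
  by (intro ess_bounded_dominated[OF assms(3), of 0 0]) (simp_all add: weak_partial_0[OF assms(3)])

lemma sobolev2_deriv_of:
  assumes "\<psi> \<in> sobolev 2"
  shows "dx.deriv_of \<psi> (weak_partial (1, 0) \<psi>)" "dy.deriv_of \<psi> (weak_partial (0, 1) \<psi>)"
    "dx.deriv_of (weak_partial (1, 0) \<psi>) (weak_partial (2, 0) \<psi>)"
    "dy.deriv_of (weak_partial (1, 0) \<psi>) (weak_partial (1, 1) \<psi>)"
    "dx.deriv_of (weak_partial (0, 1) \<psi>) (weak_partial (1, 1) \<psi>)"
    "dy.deriv_of (weak_partial (0, 1) \<psi>) (weak_partial (0, 2) \<psi>)"
  using deriv_of_weak_partial[OF assms, of 0 0] deriv_of_weak_partial[OF assms, of 1 0]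
    deriv_of_weak_partial[OF assms, of 0 1]
  by (simp_all add: weak_partial_0[OF assms] numeral_2_eq_2)

text \<open>One integration by parts gives minus the W^{1,2} inner product of the two solutions. Its
  definiteness turns -<\<omega>, \<phi>> into an energy, and its symmetry lets \<omega> and \<phi>
  exchange their times.\<close>

lemma inner_helmholtz:
  assumes "solves_helmholtz g \<psi>" "solves_helmholtz g' \<psi>'"
  shows "inner g \<psi>' = - (inner \<psi> \<psi>' + inner (weak_partial (1, 0) \<psi>) (weak_partial (1, 0) \<psi>') +
    inner (weak_partial (0, 1) \<psi>) (weak_partial (0, 1) \<psi>'))"
proof -
  have \<psi>: "\<psi> \<in> sobolev 2" "\<psi>' \<in> sobolev 2" and g: "g = laplacian \<psi> - \<psi>"
    using assms by (auto simp: solves_helmholtz_def)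
  note d = sobolev2_deriv_of[OF \<psi>(1)] and d' = sobolev2_deriv_of[OF \<psi>(2)]
  have "inner (weak_partial (2, 0) \<psi>) \<psi>' = - inner (weak_partial (1, 0) \<psi>) (weak_partial (1, 0) \<psi>')"
    using dx.inner_deriv_of[OF d(3) d'(1)] by simp
  moreover have "inner (weak_partial (0, 2) \<psi>) \<psi>' = - inner (weak_partial (0, 1) \<psi>) (weak_partial (0, 1) \<psi>')"
    using dy.inner_deriv_of[OF d(6) d'(2)] by simp
  ultimately show ?thesis
    by (simp add: g laplacian_def inner_diff_left inner_add_left)
qed

text \<open>The transport estimate of 2D Euler: $2\int \Delta\varphi\, u\cdot\nabla\varphi$ is a quadratic
  form in $\nabla\varphi$ whose coefficients are derivatives of $u = \nabla^\perp\psi$.\<close>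

lemma stream_transport_estimate:
  assumes \<psi>: "\<psi> \<in> sobolev 2" "\<And>\<alpha>. \<alpha> \<in> multi_indices 2 \<Longrightarrow> ess_bounded K (weak_partial \<alpha> \<psi>)" "0 \<le> K"
    and \<phi>: "\<phi> \<in> sobolev 2"
  shows "\<bar>tri (weak_partial (0, 1) \<psi>) (laplacian \<phi>) (weak_partial (1, 0) \<phi>) -
    tri (weak_partial (1, 0) \<psi>) (laplacian \<phi>) (weak_partial (0, 1) \<phi>)\<bar> \<le>
    K * (norm (weak_partial (1, 0) \<phi>) + norm (weak_partial (0, 1) \<phi>))\<^sup>2"
proof -
  define P Q Pxx Pxy Pyy where "P = weak_partial (1, 0) \<psi>" and "Q = weak_partial (0, 1) \<psi>"
    and "Pxx = weak_partial (2, 0) \<psi>" and "Pxy = weak_partial (1, 1) \<psi>" and "Pyy = weak_partial (0, 2) \<psi>"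
  define p q pxx pxy pyy where "p = weak_partial (1, 0) \<phi>" and "q = weak_partial (0, 1) \<phi>"
    and "pxx = weak_partial (2, 0) \<phi>" and "pxy = weak_partial (1, 1) \<phi>" and "pyy = weak_partial (0, 2) \<phi>"
  note defs = P_def Q_def Pxx_def Pxy_def Pyy_def p_def q_def pxx_def pxy_def pyy_def
  note d = sobolev2_deriv_of[OF \<psi>(1), folded defs] and d' = sobolev2_deriv_of[OF \<phi>, folded defs]
  have K: "ess_bounded K P" "ess_bounded K Q" "ess_bounded K Pxx" "ess_bounded K Pxy" "ess_bounded K Pyy"
    unfolding defs by (auto intro!: \<psi> simp: multi_indices_def)
  \<comment> \<open>Every term with a second derivative of \<phi> is removed by moving a derivative;
    \<open>3\<close> and \<open>5\<close> dispose of the mixed terms that \<open>2\<close> and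
    \<open>4\<close> leave. In total, the integral of Pxy (q^2 - p^2) + (Pxx - Pyy) p q
    remains.\<close>
  have 1: "tri Q p pxx + tri Q p pxx = - tri Pxy p p"
    by (rule dx.tri_deriv_of[OF K(2,4) d(5) d'(3) d'(3)])
  have 2: "tri Q p pyy + tri Q q pxy = - tri Pyy p q"
    by (rule dy.tri_deriv_of[OF K(2,5) d(6) d'(4) d'(6)])
  have 3: "tri Q q pxy + tri Q q pxy = - tri Pxy q q"
    by (rule dx.tri_deriv_of[OF K(2,4) d(5) d'(5) d'(5)])
  have 4: "tri P p pxy + tri P q pxx = - tri Pxx p q"
    by (rule dx.tri_deriv_of[OF K(1,3) d(3) d'(3) d'(5)])
  have 5: "tri P p pxy + tri P p pxy = - tri Pxy p p"
    by (rule dy.tri_deriv_of[OF K(1,4) d(4) d'(4) d'(4)])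
  have 6: "tri P q pyy + tri P q pyy = - tri Pxy q q"
    by (rule dy.tri_deriv_of[OF K(1,4) d(4) d'(6) d'(6)])
  have lap: "tri Q (laplacian \<phi>) p = tri Q p pxx + tri Q p pyy" "tri P (laplacian \<phi>) q = tri P q pxx + tri P q pyy"
    unfolding laplacian_def defs[symmetric] tri_commute(2)[of _ "pxx + pyy"]
    by (rule tri_add_right, rule K)+
  have "\<bar>tri Pxy p p\<bar> \<le> K * (norm p)\<^sup>2" "\<bar>tri Pxy q q\<bar> \<le> K * (norm q)\<^sup>2"
    "\<bar>tri Pyy p q\<bar> \<le> K * (norm p * norm q)" "\<bar>tri Pxx p q\<bar> \<le> K * (norm p * norm q)"
    using abs_tri_le[OF K(4) \<psi>(3)] abs_tri_le[OF K(5) \<psi>(3)] abs_tri_le[OF K(3) \<psi>(3)]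
    by (simp_all add: power2_eq_square mult.assoc)
  moreover have "K * (norm p + norm q)\<^sup>2 = K * (norm p)\<^sup>2 + 2 * (K * (norm p * norm q)) + K * (norm q)\<^sup>2"
    by (simp add: power2_sum algebra_simps)
  ultimately show ?thesis
    unfolding defs(1,2,6,7)[symmetric] lap using 1 2 3 4 5 6 by linarith
qed

text \<open>One solution at one time, together with the bounds that the estimates use, so that the
  energy estimate can be carried out at a fixed time. A single \<open>K\<close> will serve all times
  and both solutions.\<close>

definition tqg_slice where
  "tqg_slice K uh f b w \<psi> Gb Gw Gh \<longleftrightarrow> 0 \<le> K \<and> b \<in> sobolev 3 \<and> w \<in> sobolev 2 \<and>
    solves_helmholtz (w - f) \<psi> \<and>
    has_div_flux b (grad_perp \<psi>) Gb \<and> has_div_flux (w - b) (grad_perp \<psi>) Gw \<and> has_div_flux b uh Gh \<and>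
    (\<forall>\<alpha>\<in>multi_indices 1. ess_bounded K (weak_partial \<alpha> b)) \<and> ess_bounded K (w - b) \<and>
    (\<forall>\<alpha>\<in>multi_indices 2. ess_bounded K (weak_partial \<alpha> \<psi>)) \<and> norm (w - f) \<le> K"

lemma tqg_slice_mono: "tqg_slice K uh f b w \<psi> Gb Gw Gh \<Longrightarrow> K \<le> L \<Longrightarrow> tqg_slice L uh f b w \<psi> Gb Gw Gh"
  unfolding tqg_slice_def using ess_bounded_mono by fastforce

lemma tqg_slice_ess_bounded:
  assumes "tqg_slice K uh f b w \<psi> Gb Gw Gh"
  shows "ess_bounded K b"
proof -
  have "b \<in> sobolev 3" "ess_bounded K (weak_partial (0, 0) b)"
    using assms by (simp_all add: tqg_slice_def multi_indices_def)
  then show ?thesis by (simp add: weak_partial_0)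
qed

lemma inner_div_flux_grad_perp:
  assumes "has_div_flux a (grad_perp \<psi>) g" "ess_bounded K a" "dx.deriv_of c cx" "dy.deriv_of c cy"
  shows "inner g c = tri a (weak_partial (0, 1) \<psi>) cx - tri a (weak_partial (1, 0) \<psi>) cy"
proof -
  interpret A: bounded_bilinear "tri a" by (rule bounded_bilinear_tri[OF assms(2)])
  show ?thesis
    using has_div_flux_limit[OF assms] by (simp add: grad_perp_def A.minus_left)
qed

text \<open>As functionals on functions with a gradient in L^2 the divergences are bounded in terms
  of \<open>K\<close> alone, hence uniformly in time, whatever their L^2 norms are. This allows a
  test function to be exchanged for a nearby one. One factor \<open>K\<close> bounds the transported
  quantity, the other the velocity.\<close>

lemma tqg_slice_flux_bound:
  assumes S: "tqg_slice K uh f b w \<psi> Gb Gw Gh"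
    and uh: "norm (fst uh) \<le> K" "norm (snd uh) \<le> K"
    and c: "dx.deriv_of c cx" "dy.deriv_of c cy"
  shows "\<bar>inner Gb c\<bar> \<le> K\<^sup>2 * (norm cx + norm cy)"
    "\<bar>inner (Gw + Gh) c\<bar> \<le> 2 * K\<^sup>2 * (norm cx + norm cy)"
proof -
  have K: "0 \<le> K" "ess_bounded K b" "ess_bounded K (w - b)"
    and \<psi>: "solves_helmholtz (w - f) \<psi>" "norm (w - f) \<le> K"
    and G: "has_div_flux b (grad_perp \<psi>) Gb" "has_div_flux (w - b) (grad_perp \<psi>) Gw" "has_div_flux b uh Gh"
    using S tqg_slice_ess_bounded[OF S] by (auto simp: tqg_slice_def)
  have n: "norm (weak_partial (1, 0) \<psi>) \<le> K" "norm (weak_partial (0, 1) \<psi>) \<le> K"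
    using norm_stream_le[OF \<psi>(1), of "(1, 0)"] norm_stream_le[OF \<psi>(1), of "(0, 1)"] \<psi>(2)
    by (auto simp: multi_indices_def)
  have t: "\<bar>tri a v e\<bar> \<le> K\<^sup>2 * norm e" if "ess_bounded K a" "norm v \<le> K" for a v e
  proof -
    have "\<bar>tri a v e\<bar> \<le> K * norm v * norm e" by (rule abs_tri_le[OF that(1) K(1)])
    also have "\<dots> \<le> K * K * norm e"
      using that K(1) by (intro mult_right_mono mult_left_mono) auto
    finally show ?thesis by (simp add: power2_eq_square)
  qed
  show "\<bar>inner Gb c\<bar> \<le> K\<^sup>2 * (norm cx + norm cy)"
    unfolding inner_div_flux_grad_perp[OF G(1) K(2) c] distrib_left
    using t[OF K(2) n(2), of cx] t[OF K(2) n(1), of cy] by linarith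
  have "\<bar>inner Gw c\<bar> \<le> K\<^sup>2 * norm cx + K\<^sup>2 * norm cy"
    unfolding inner_div_flux_grad_perp[OF G(2) K(3) c]
    using t[OF K(3) n(2), of cx] t[OF K(3) n(1), of cy] by linarith
  moreover have "\<bar>inner Gh c\<bar> \<le> K\<^sup>2 * norm cx + K\<^sup>2 * norm cy"
    using has_div_flux_limit[OF G(3) K(2) c] t[OF K(2) uh(1), of cx] t[OF K(2) uh(2), of cy] by linarith
  ultimately show "\<bar>inner (Gw + Gh) c\<bar> \<le> 2 * K\<^sup>2 * (norm cx + norm cy)"
    by (simp add: inner_add_left algebra_simps)
qed

section \<open>The energy estimate\<close>

text \<open>Adds and subtracts the product of a' and v, and moves the bounded factors
  \<open>v\<close> and \<open>a'\<close> to the first slot.\<close>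

lemma tri_product_diff:
  assumes "ess_bounded K v" "ess_bounded L a'"
  shows "tri a v c - tri a' v' c = tri v (a - a') c + tri a' (v - v') c"
proof -
  have "tri v (a - a') c = tri v a c - tri v a' c" "tri a' (v - v') c = tri a' v c - tri a' v' c"
    using assms by (simp_all add: bounded_bilinear.diff_left[OF bounded_bilinear_tri])
  then show ?thesis
    using tri_commute(1)[of v a c] tri_commute(1)[of v a' c] by linarith
qed

text \<open>Formally the left side is half the time derivative of the energy, since \<beta> and
  \<omega> have the derivatives -(Gb1 - Gb2) and -((Gw1 + Gh1) - (Gw2 + Gh2)). The right side
  controls neither the gradient of \<beta> nor second derivatives of \<phi>, so these have to be
  integrated away.\<close>

lemma tqg_energy_estimate:
  assumes S1: "tqg_slice K uh f b1 w1 \<psi>1 Gb1 Gw1 Gh1" and S2: "tqg_slice K uh f b2 w2 \<psi>2 Gb2 Gw2 Gh2"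
    and uh: "ess_bounded K (fst uh)" "ess_bounded K (snd uh)"
  shows "- inner (Gb1 - Gb2) (b1 - b2) + inner ((Gw1 + Gh1) - (Gw2 + Gh2)) (\<psi>1 - \<psi>2) \<le>
    10 * K * ((norm (b1 - b2))\<^sup>2 + (norm (\<psi>1 - \<psi>2))\<^sup>2 +
      (norm (weak_partial (1, 0) (\<psi>1 - \<psi>2)))\<^sup>2 + (norm (weak_partial (0, 1) (\<psi>1 - \<psi>2)))\<^sup>2)"
proof -
  define \<beta> \<phi> a1 a2 where "\<beta> = b1 - b2" and "\<phi> = \<psi>1 - \<psi>2" and "a1 = w1 - b1" and "a2 = w2 - b2"
  have K: "0 \<le> K" using S1 by (simp add: tqg_slice_def)
  have sob: "b1 \<in> sobolev 3" "b2 \<in> sobolev 3" "\<psi>1 \<in> sobolev 2" "\<psi>2 \<in> sobolev 2"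
    using S1 S2 by (auto simp: tqg_slice_def solves_helmholtz_def)
  have \<beta>: "\<beta> \<in> sobolev 2" and b2: "b2 \<in> sobolev 2"
    unfolding \<beta>_def using sob sobolev_mono[of _ 3 2] by (auto intro: sobolev_diff)
  have \<phi>: "\<phi> \<in> sobolev 2"
    unfolding \<phi>_def using sob by (auto intro: sobolev_diff)
  have "solves_helmholtz ((w1 - f) - (w2 - f)) \<phi>"
    unfolding \<phi>_def using S1 S2 by (intro solves_helmholtz_diff) (auto simp: tqg_slice_def)
  then have lap: "a1 - a2 = laplacian \<phi> - (\<phi> + \<beta>)"
    by (simp add: solves_helmholtz_def a1_def a2_def \<beta>_def algebra_simps)
  define b2x b2y where "b2x = weak_partial (1, 0) b2" and "b2y = weak_partial (0, 1) b2"
  define \<beta>x \<beta>y where "\<beta>x = weak_partial (1, 0) \<beta>" and "\<beta>y = weak_partial (0, 1) \<beta>"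
  define P Q R where "P = weak_partial (1, 0) \<psi>1" and "Q = weak_partial (0, 1) \<psi>1"
    and "R = weak_partial (1, 1) \<psi>1"
  define P2 Q2 where "P2 = weak_partial (1, 0) \<psi>2" and "Q2 = weak_partial (0, 1) \<psi>2"
  define p q r where "p = weak_partial (1, 0) \<phi>" and "q = weak_partial (0, 1) \<phi>"
    and "r = weak_partial (1, 1) \<phi>"
  have pq: "p = P - P2" "q = Q - Q2"
    unfolding p_def q_def \<phi>_def P_def Q_def P2_def Q2_def
    using sob weak_partial_diff[of _ 2] by (auto simp: multi_indices_def)
  have e: "ess_bounded K b1" "ess_bounded K b2" "ess_bounded K b2x" "ess_bounded K b2y"
    "ess_bounded K a1" "ess_bounded K a2" "ess_bounded K P" "ess_bounded K Q" "ess_bounded K R"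
    using S1 S2 tqg_slice_ess_bounded[OF S1] tqg_slice_ess_bounded[OF S2]
    by (auto simp: tqg_slice_def multi_indices_def b2x_def b2y_def a1_def a2_def P_def Q_def R_def)
  note d\<beta> = sobolev2_deriv_of(1,2)[OF \<beta>, folded \<beta>x_def \<beta>y_def]
  note db = sobolev2_deriv_of(1,2)[OF b2, folded b2x_def b2y_def]
  note d\<phi> = sobolev2_deriv_of[OF \<phi>, folded p_def q_def r_def]
  note d\<psi> = sobolev2_deriv_of[OF sob(3), folded P_def Q_def R_def]
  have fl: "has_div_flux b1 (grad_perp \<psi>1) Gb1" "has_div_flux a1 (grad_perp \<psi>1) Gw1" "has_div_flux b1 uh Gh1"
    "has_div_flux b2 (grad_perp \<psi>2) Gb2" "has_div_flux a2 (grad_perp \<psi>2) Gw2" "has_div_flux b2 uh Gh2"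
    using S1 S2 by (auto simp: tqg_slice_def a1_def a2_def)
  interpret P: bounded_bilinear "tri P" by (rule bounded_bilinear_tri[OF e(7)])
  interpret Q: bounded_bilinear "tri Q" by (rule bounded_bilinear_tri[OF e(8)])
  interpret U: bounded_bilinear "tri (fst uh)" by (rule bounded_bilinear_tri[OF uh(1)])
  interpret V: bounded_bilinear "tri (snd uh)" by (rule bounded_bilinear_tri[OF uh(2)])

  \<comment> \<open>By \<open>t1\<close> and \<open>t2\<close> the two terms with \<beta> times its
    own gradient both reduce to \<open>tri R \<beta> \<beta>\<close> and cancel, the velocity being
    divergence-free. By \<open>t3\<close> and \<open>t4\<close> the derivative in the remainder
    moves from \<beta> to \<open>b2\<close>, whose gradient is bounded; the mixed derivative
    \<open>r\<close> cancels for the same reason.\<close>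
  have "- inner (Gb1 - Gb2) \<beta> = tri b2x q \<beta> - tri b2y p \<beta>"
  proof -
    have i1: "inner Gb1 \<beta> = tri b1 Q \<beta>x - tri b1 P \<beta>y"
      unfolding P_def Q_def by (rule inner_div_flux_grad_perp[OF fl(1) e(1) d\<beta>])
    have i2: "inner Gb2 \<beta> = tri b2 Q2 \<beta>x - tri b2 P2 \<beta>y"
      unfolding P2_def Q2_def by (rule inner_div_flux_grad_perp[OF fl(4) e(2) d\<beta>])
    have s1: "tri b1 Q \<beta>x - tri b2 Q2 \<beta>x = tri Q \<beta> \<beta>x + tri b2 q \<beta>x"
      unfolding \<beta>_def pq by (rule tri_product_diff[OF e(8,2)])
    have s2: "tri b1 P \<beta>y - tri b2 P2 \<beta>y = tri P \<beta> \<beta>y + tri b2 p \<beta>y"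
      unfolding \<beta>_def pq by (rule tri_product_diff[OF e(7,2)])
    have t1: "tri Q \<beta> \<beta>x + tri Q \<beta> \<beta>x = - tri R \<beta> \<beta>"
      by (rule dx.tri_deriv_of[OF e(8,9) d\<psi>(5) d\<beta>(1) d\<beta>(1)])
    have t2: "tri P \<beta> \<beta>y + tri P \<beta> \<beta>y = - tri R \<beta> \<beta>"
      by (rule dy.tri_deriv_of[OF e(7,9) d\<psi>(4) d\<beta>(2) d\<beta>(2)])
    have t3: "tri b2 q \<beta>x + tri b2 \<beta> r = - tri b2x q \<beta>"
      by (rule dx.tri_deriv_of[OF e(2,3) db(1) d\<phi>(5) d\<beta>(1)])
    have t4: "tri b2 p \<beta>y + tri b2 \<beta> r = - tri b2y p \<beta>"
      by (rule dy.tri_deriv_of[OF e(2,4) db(2) d\<phi>(4) d\<beta>(2)])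
    show ?thesis
      unfolding inner_diff_left i1 i2 using s1 s2 t1 t2 t3 t4 by linarith
  qed
  moreover have "\<bar>tri b2x q \<beta>\<bar> \<le> K * (norm q * norm \<beta>)" "\<bar>tri b2y p \<beta>\<bar> \<le> K * (norm p * norm \<beta>)"
    using abs_tri_le[OF e(3) K] abs_tri_le[OF e(4) K] by (simp_all add: mult.assoc)
  ultimately have B: "- inner (Gb1 - Gb2) \<beta> \<le> K * (norm q * norm \<beta>) + K * (norm p * norm \<beta>)"
    by linarith

  \<comment> \<open>The term with \<open>a2\<close> vanishes by \<open>s3\<close>, because the
    rotated gradient of \<phi> is orthogonal to the gradient of \<phi>. In the other term
    \<open>lap\<close> resolves a1 - a2: the Laplacian falls to the transport estimate, and \<phi>
    and \<beta> are controlled by the energy directly.\<close>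
  have "inner (Gw1 - Gw2) \<phi> = (tri Q (laplacian \<phi>) p - tri P (laplacian \<phi>) q) -
      (tri Q \<phi> p + tri Q \<beta> p) + (tri P \<phi> q + tri P \<beta> q)"
  proof -
    have i1: "inner Gw1 \<phi> = tri a1 Q p - tri a1 P q"
      unfolding P_def Q_def by (rule inner_div_flux_grad_perp[OF fl(2) e(5) d\<phi>(1,2)])
    have i2: "inner Gw2 \<phi> = tri a2 Q2 p - tri a2 P2 q"
      unfolding P2_def Q2_def by (rule inner_div_flux_grad_perp[OF fl(5) e(6) d\<phi>(1,2)])
    have s1: "tri a1 Q p - tri a2 Q2 p = tri Q (a1 - a2) p + tri a2 q p"
      unfolding pq(2) by (rule tri_product_diff[OF e(8,6)])
    have s2: "tri a1 P q - tri a2 P2 q = tri P (a1 - a2) q + tri a2 p q"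
      unfolding pq(1) by (rule tri_product_diff[OF e(7,6)])
    have s3: "tri a2 q p = tri a2 p q" by (rule tri_commute(2))
    have s4: "tri Q (a1 - a2) p = tri Q (laplacian \<phi>) p - (tri Q \<phi> p + tri Q \<beta> p)"
      "tri P (a1 - a2) q = tri P (laplacian \<phi>) q - (tri P \<phi> q + tri P \<beta> q)"
      unfolding lap by (simp_all add: Q.diff_left Q.add_left P.diff_left P.add_left)
    show ?thesis
      unfolding inner_diff_left i1 i2 using s1 s2 s3 s4 by linarith
  qed
  moreover have "\<bar>tri Q (laplacian \<phi>) p - tri P (laplacian \<phi>) q\<bar> \<le> K * (norm p + norm q)\<^sup>2"
    unfolding P_def Q_def p_def q_def using S1
    by (intro stream_transport_estimate sob K \<phi>) (auto simp: tqg_slice_def)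
  moreover have "\<bar>tri Q \<phi> p\<bar> \<le> K * (norm \<phi> * norm p)" "\<bar>tri Q \<beta> p\<bar> \<le> K * (norm p * norm \<beta>)"
    "\<bar>tri P \<phi> q\<bar> \<le> K * (norm \<phi> * norm q)" "\<bar>tri P \<beta> q\<bar> \<le> K * (norm q * norm \<beta>)"
    using abs_tri_le[OF e(7) K] abs_tri_le[OF e(8) K] by (simp_all add: mult_ac)
  ultimately have W: "inner (Gw1 - Gw2) \<phi> \<le> K * (norm p + norm q)\<^sup>2 + K * (norm \<phi> * norm p) +
      K * (norm p * norm \<beta>) + K * (norm \<phi> * norm q) + K * (norm q * norm \<beta>)"
    by linarith

  have "inner (Gh1 - Gh2) \<phi> = - (tri (fst uh) \<beta> p + tri (snd uh) \<beta> q)"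
  proof -
    have "tri (fst uh) \<beta> p = tri b1 (fst uh) p - tri b2 (fst uh) p"
      by (simp only: \<beta>_def U.diff_left tri_commute(1)[of b1 "fst uh"] tri_commute(1)[of b2 "fst uh"])
    moreover have "tri (snd uh) \<beta> q = tri b1 (snd uh) q - tri b2 (snd uh) q"
      by (simp only: \<beta>_def V.diff_left tri_commute(1)[of b1 "snd uh"] tri_commute(1)[of b2 "snd uh"])
    ultimately show ?thesis
      using has_div_flux_limit[OF fl(3) e(1) d\<phi>(1,2)] has_div_flux_limit[OF fl(6) e(2) d\<phi>(1,2)]
      unfolding inner_diff_left by linarith
  qed
  moreover have "\<bar>tri (fst uh) \<beta> p\<bar> \<le> K * (norm p * norm \<beta>)" "\<bar>tri (snd uh) \<beta> q\<bar> \<le> K * (norm q * norm \<beta>)"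
    using abs_tri_le[OF uh(1) K] abs_tri_le[OF uh(2) K] by (simp_all add: mult_ac)
  ultimately have H: "inner (Gh1 - Gh2) \<phi> \<le> K * (norm p * norm \<beta>) + K * (norm q * norm \<beta>)"
    by linarith

  have "- inner (Gb1 - Gb2) \<beta> + inner ((Gw1 + Gh1) - (Gw2 + Gh2)) \<phi> =
      - inner (Gb1 - Gb2) \<beta> + inner (Gw1 - Gw2) \<phi> + inner (Gh1 - Gh2) \<phi>"
    by (simp add: inner_diff_left inner_add_left)
  also have "\<dots> \<le> K * ((norm p + norm q)\<^sup>2 + norm \<phi> * norm p + norm \<phi> * norm q +
      3 * (norm p * norm \<beta>) + 3 * (norm q * norm \<beta>))"
    using B W H by (simp add: algebra_simps)
  also have "\<dots> \<le> K * (10 * ((norm \<beta>)\<^sup>2 + (norm \<phi>)\<^sup>2 + (norm p)\<^sup>2 + (norm q)\<^sup>2))"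
  proof (intro mult_left_mono K)
    have s: "2 * (x * y) \<le> x\<^sup>2 + y\<^sup>2" for x y :: real
      using sum_squares_bound[of x y] by (simp add: mult.assoc)
    \<comment> \<open>Young's inequality produces coefficients of at most 4, so 10 is a generous
      round value.\<close>
    have lin: "S + u + v + 3 * x + 3 * y \<le> 10 * (B + F + P + Q)"
      if "S = P + Q + 2 * z" "2 * z \<le> P + Q" "2 * u \<le> F + P" "2 * v \<le> F + Q" "2 * x \<le> P + B"
        "2 * y \<le> Q + B" "0 \<le> B" "0 \<le> F" "0 \<le> P" "0 \<le> Q" for S B F P Q u v x y z :: real
      using that by (simp only: distrib_left)
    show "(norm p + norm q)\<^sup>2 + norm \<phi> * norm p + norm \<phi> * norm q +
        3 * (norm p * norm \<beta>) + 3 * (norm q * norm \<beta>) \<le>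
        10 * ((norm \<beta>)\<^sup>2 + (norm \<phi>)\<^sup>2 + (norm p)\<^sup>2 + (norm q)\<^sup>2)"
      by (rule lin[where z = "norm p * norm q"]) (simp_all only: power2_sum mult.assoc s zero_le_power2)
  qed
  finally show ?thesis
    by (simp add: \<beta>_def \<phi>_def p_def q_def mult_ac)
qed

text \<open>No derivative of \<open>Z\<close> enters, only increments over short steps with
  \<open>Z\<close> on the right frozen at the left end. Iteration over steps of length h gives Z(i
  h) \<le> e i h (1 + C h)^i, and e is arbitrary.\<close>

lemma discrete_gronwall:
  fixes Z :: "real \<Rightarrow> real"
  assumes T: "0 \<le> T" and C: "0 \<le> C" and Z0: "Z 0 \<le> 0"
    and step: "\<And>e. e > 0 \<Longrightarrow> \<exists>d>0. \<forall>s t. 0 \<le> s \<longrightarrow> s \<le> t \<longrightarrow> t \<le> T \<longrightarrow> t - s < d \<longrightarrow>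
      Z t - Z s \<le> (t - s) * (C * Z s + e)"
    and t: "t \<in> {0..T}"
  shows "Z t \<le> 0"
proof (rule field_le_epsilon)
  fix \<epsilon> :: real assume "\<epsilon> > 0"
  \<comment> \<open>The bound reached below is e t exp(C t); the summand 1 keeps the divisor
    positive at t = 0.\<close>
  define e where "e = \<epsilon> / (1 + t * exp (C * t))"
  have pos: "1 + t * exp (C * t) > 0"
    using t by (intro add_pos_nonneg) auto
  then have e: "e > 0" using \<open>\<epsilon> > 0\<close> by (simp add: e_def)
  then obtain d where d: "d > 0" and D: "\<And>s t. 0 \<le> s \<Longrightarrow> s \<le> t \<Longrightarrow> t \<le> T \<Longrightarrow> t - s < d \<Longrightarrow>
      Z t - Z s \<le> (t - s) * (C * Z s + e)"
    using step by meson
  obtain n where n: "t < real n * d"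
    using reals_Archimedean3[OF d] by blast
  have n0: "n > 0" using n t d by (cases n) auto
  define h where "h = t / real n"
  have h: "0 \<le> h" "h < d" and nh: "real n * h = t"
    using n n0 t by (auto simp: h_def field_simps)
  have Ch: "1 \<le> 1 + C * h" using C h by simp
  have "Z (real i * h) \<le> e * (real i * h) * (1 + C * h) ^ i" if "i \<le> n" for i
    using that
  proof (induction i)
    case 0
    then show ?case using Z0 by simp
  next
    case (Suc i)
    have le: "real (Suc i) * h \<le> T"
      using mult_right_mono[of "real (Suc i)" "real n" h] Suc.prems h nh t by simp
    have "Z (real (Suc i) * h) - Z (real i * h) \<le> (real (Suc i) * h - real i * h) * (C * Z (real i * h) + e)"
      using h le by (intro D) (auto simp: algebra_simps)
    then have "Z (real (Suc i) * h) \<le> (1 + C * h) * Z (real i * h) + e * h * 1"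
      by (simp add: algebra_simps)
    also have "\<dots> \<le> (1 + C * h) * (e * (real i * h) * (1 + C * h) ^ i) + e * h * (1 + C * h) ^ Suc i"
      using Suc Ch e h one_le_power[OF Ch, of "Suc i"]
      by (intro add_mono mult_left_mono) auto
    also have "\<dots> = e * (real (Suc i) * h) * (1 + C * h) ^ Suc i"
      by (simp add: algebra_simps)
    finally show ?case .
  qed
  from this[of n] have "Z t \<le> e * t * (1 + C * h) ^ n"
    by (simp add: nh)
  also have "(1 + C * h) ^ n \<le> exp (C * h) ^ n"
    using Ch by (intro power_mono) (auto simp: exp_ge_add_one_self)
  also have "exp (C * h) ^ n = exp (C * t)"
    by (simp add: exp_of_nat_mult[symmetric] nh[symmetric] mult_ac)
  finally have "Z t \<le> e * (t * exp (C * t))"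
    using e t by (simp add: mult_left_mono mult.assoc)
  also have "\<dots> \<le> e * (1 + t * exp (C * t))"
    using e by (simp add: mult_left_mono)
  also have "\<dots> = \<epsilon>" using pos by (simp add: e_def)
  finally show "Z t \<le> 0 + \<epsilon>" by simp
qed

lemma integral_increment_le:
  fixes g F :: "real \<Rightarrow> real"
  assumes g: "\<And>r. r \<in> {0..T} \<Longrightarrow> (g has_integral F r) {0..r}"
    and st: "0 \<le> s" "s \<le> t" "t \<le> T" and le: "\<And>\<tau>. \<tau> \<in> {s..t} \<Longrightarrow> g \<tau> \<le> B"
  shows "F t - F s \<le> (t - s) * B"
proof -
  have t: "g integrable_on {0..t}" using g[of t] st by (auto simp: integrable_on_def)
  then have st': "g integrable_on {s..t}"
    by (rule integrable_on_subinterval) (use st in auto)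
  have "integral {0..s} g + integral {s..t} g = integral {0..t} g"
    using st t by (intro Henstock_Kurzweil_Integration.integral_combine) auto
  then have "F t - F s = integral {s..t} g"
    using g[of s] g[of t] st by (simp add: integral_unique)
  also have "\<dots> \<le> integral {s..t} (\<lambda>_. B)"
    by (intro integral_le st' le) auto
  also have "\<dots> = (t - s) * B" using st by simp
  finally show ?thesis .
qed

section \<open>Uniqueness\<close>

lemma continuous_on_weak_partial:
  assumes u: "continuous_in_sobolev0 m T u" and \<alpha>: "\<alpha> \<in> multi_indices m"
  shows "continuous_on {0..T} (\<lambda>t. weak_partial \<alpha> (u t))"
  unfolding continuous_on_def
proof
  fix t assume t: "t \<in> {0..T}"
  have sob: "u s \<in> sobolev m" if "s \<in> {0..T}" for s
    using u that by (auto simp: continuous_in_sobolev0_def sobolev0_def)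
  have "\<forall>\<^sub>F s in at t within {0..T}.
      norm (weak_partial \<alpha> (u s) - weak_partial \<alpha> (u t)) \<le> sobolev_norm m (u s - u t)"
    unfolding eventually_at_filter
  proof (intro always_eventually allI impI)
    fix s assume "s \<in> {0..T}"
    then have "weak_partial \<alpha> (u s) - weak_partial \<alpha> (u t) = weak_partial \<alpha> (u s - u t)"
      using weak_partial_diff[OF sob sob[OF t] \<alpha>] by simp
    then show "norm (weak_partial \<alpha> (u s) - weak_partial \<alpha> (u t)) \<le> sobolev_norm m (u s - u t)"
      using norm_weak_partial_le[OF \<alpha>] by simp
  qed
  moreover have "((\<lambda>s. sobolev_norm m (u s - u t)) \<longlongrightarrow> 0) (at t within {0..T})"
    using u t by (auto simp: continuous_in_sobolev0_def)
  ultimately have "((\<lambda>s. weak_partial \<alpha> (u s) - weak_partial \<alpha> (u t)) \<longlongrightarrow> 0) (at t within {0..T})"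
    by (rule Lim_null_comparison)
  then show "((\<lambda>s. weak_partial \<alpha> (u s)) \<longlongrightarrow> weak_partial \<alpha> (u t)) (at t within {0..T})"
    by (rule LIM_zero_cancel)
qed

lemma sobolev_norm_bounded:
  fixes T :: real
  assumes "\<And>\<alpha>. \<alpha> \<in> multi_indices m \<Longrightarrow> continuous_on {0..T} (\<lambda>t. weak_partial \<alpha> (u t))"
  obtains C where "0 \<le> C" "\<And>t. t \<in> {0..T} \<Longrightarrow> sobolev_norm m (u t) \<le> C"
proof -
  have "continuous_on {0..T} (\<lambda>t. sobolev_norm m (u t))"
    unfolding sobolev_norm_def by (intro continuous_intros assms)
  then have "bounded ((\<lambda>t. sobolev_norm m (u t)) ` {0..T})"
    by (intro compact_imp_bounded compact_continuous_image compact_Icc)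
  then obtain C where C: "\<And>t. t \<in> {0..T} \<Longrightarrow> \<bar>sobolev_norm m (u t)\<bar> \<le> C"
    unfolding bounded_iff by fastforce
  have "sobolev_norm m (u t) \<le> max 0 C" if "t \<in> {0..T}" for t
    using C[OF that] by linarith
  then show ?thesis using that[of "max 0 C"] by simp
qed

lemma ess_bounded_sobolev:
  assumes "u \<in> sobolev m" "a + b + 2 \<le> m"
  shows "ess_bounded (5 * sobolev_norm m u) (weak_partial (a, b) u)"
  by (rule ess_bounded_dominated[OF assms]) simp

text \<open>Compactness of the time interval turns continuity in the Sobolev norms into bounds
  uniform in time; the factor 5 in \<open>K\<close> is the constant of the essential bounds.\<close>

lemma local_strong_solution_slices:
  assumes sol: "local_strong_solution uh f b0 w0 b w T" and f: "f \<in> sobolev0 2"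
  obtains \<psi> Gb Gw Gh K where
    "\<And>\<tau>. \<tau> \<in> {0..T} \<Longrightarrow> tqg_slice K uh f (b \<tau>) (w \<tau>) (\<psi> \<tau>) (Gb \<tau>) (Gw \<tau>) (Gh \<tau>)"
    "\<And>t. t \<in> {0..T} \<Longrightarrow> (Gb has_integral b0 - b t) {0..t}"
    "\<And>t. t \<in> {0..T} \<Longrightarrow> ((\<lambda>\<tau>. Gw \<tau> + Gh \<tau>) has_integral w0 - w t) {0..t}"
proof -
  obtain \<psi> Gb Gw Gh where
    bc: "continuous_in_sobolev0 3 T b" and wc: "continuous_in_sobolev0 2 T w" and
    S: "\<And>\<tau>. \<tau> \<in> {0..T} \<Longrightarrow> is_stream_function (w \<tau> - f) (\<psi> \<tau>) \<and>
      has_div_flux (b \<tau>) (grad_perp (\<psi> \<tau>)) (Gb \<tau>) \<and>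
      has_div_flux (w \<tau> - b \<tau>) (grad_perp (\<psi> \<tau>)) (Gw \<tau>) \<and> has_div_flux (b \<tau>) uh (Gh \<tau>)" and
    I: "\<And>t. t \<in> {0..T} \<Longrightarrow> Gb integrable_on {0..t} \<and> b t = b0 - integral {0..t} Gb \<and>
      (\<lambda>\<tau>. Gw \<tau> + Gh \<tau>) integrable_on {0..t} \<and> w t = w0 - integral {0..t} (\<lambda>\<tau>. Gw \<tau> + Gh \<tau>)"
    using sol unfolding local_strong_solution_def by blast
  have fs: "f \<in> sobolev 2" using f by (simp add: sobolev0_def)
  have bs: "b t \<in> sobolev 3" and ws: "w t \<in> sobolev 2" if "t \<in> {0..T}" for t
    using bc wc that by (auto simp: continuous_in_sobolev0_def sobolev0_def)
  obtain A where A: "0 \<le> A" "\<And>t. t \<in> {0..T} \<Longrightarrow> sobolev_norm 3 (b t) \<le> A"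
    using sobolev_norm_bounded[OF continuous_on_weak_partial[OF bc]] by blast
  obtain B where B: "0 \<le> B" "\<And>t. t \<in> {0..T} \<Longrightarrow> sobolev_norm 2 (w t) \<le> B"
    using sobolev_norm_bounded[OF continuous_on_weak_partial[OF wc]] by blast
  \<comment> \<open>The stream function is controlled by w - f, so this difference gets a bound of
    its own, again from the continuity of its weak derivatives.\<close>
  have "continuous_on {0..T} (\<lambda>t. weak_partial \<alpha> (w t - f))" if "\<alpha> \<in> multi_indices 2" for \<alpha>
  proof -
    have "continuous_on {0..T} (\<lambda>t. weak_partial \<alpha> (w t) - weak_partial \<alpha> f)"
      by (intro continuous_intros continuous_on_weak_partial[OF wc that])
    then show ?thesis
      by (rule continuous_on_eq) (simp add: weak_partial_diff[OF ws fs that])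
  qed
  then obtain C where C: "0 \<le> C" "\<And>t. t \<in> {0..T} \<Longrightarrow> sobolev_norm 2 (w t - f) \<le> C"
    using sobolev_norm_bounded[of 2 T "\<lambda>t. w t - f"] by blast
  define K where "K = 5 * (A + B + C)"
  show ?thesis
  proof (rule that)
    fix \<tau> assume \<tau>: "\<tau> \<in> {0..T}"
    have sh: "solves_helmholtz (w \<tau> - f) (\<psi> \<tau>)"
      using S[OF \<tau>] by (auto simp: is_stream_function_def solves_helmholtz_def sobolev0_def)
    have wf: "w \<tau> - f \<in> sobolev 2" by (rule sobolev_diff[OF ws[OF \<tau>] fs])
    have b: "ess_bounded (5 * A) (weak_partial \<alpha> (b \<tau>))" if "\<alpha> \<in> multi_indices 1" for \<alpha>
      using ess_bounded_sobolev[OF bs[OF \<tau>], of "fst \<alpha>" "snd \<alpha>"] A(2)[OF \<tau>] that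
      by (auto simp: multi_indices_def elim: ess_bounded_mono)
    have w: "ess_bounded (5 * B) (w \<tau>)"
      using ess_bounded_sobolev[OF ws[OF \<tau>], of 0 0] B(2)[OF \<tau>]
      by (auto simp: weak_partial_0[OF ws[OF \<tau>]] elim: ess_bounded_mono)
    have b': "ess_bounded (5 * A) (b \<tau>)"
      using b[of "(0, 0)"] by (simp add: weak_partial_0[OF bs[OF \<tau>]] multi_indices_def)
    have \<psi>: "ess_bounded (5 * C) (weak_partial \<alpha> (\<psi> \<tau>))" if "\<alpha> \<in> multi_indices 2" for \<alpha>
      by (rule ess_bounded_mono[OF ess_bounded_stream[OF sh that wf]]) (use C(2)[OF \<tau>] in simp)
    have "norm (w \<tau> - f) \<le> C"
      using norm_le_sobolev_norm[OF wf] C(2)[OF \<tau>] by linarith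
    then show "tqg_slice K uh f (b \<tau>) (w \<tau>) (\<psi> \<tau>) (Gb \<tau>) (Gw \<tau>) (Gh \<tau>)"
      using S[OF \<tau>] sh bs[OF \<tau>] ws[OF \<tau>] A(1) B(1) C(1)
        ess_bounded_mono[OF b, of _ K] ess_bounded_mono[OF \<psi>, of _ K]
        ess_bounded_mono[OF ess_bounded_diff[OF w b'], of K]
      unfolding tqg_slice_def by (auto simp: K_def)
  next
    fix t assume t: "t \<in> {0..T}"
    show "(Gb has_integral b0 - b t) {0..t}"
      "((\<lambda>\<tau>. Gw \<tau> + Gh \<tau>) has_integral w0 - w t) {0..t}"
      using I[OF t] by (auto simp: has_integral_integral)
  qed
qed

lemma has_integral_inner_left:
  fixes G :: "real \<Rightarrow> torus_l2"
  assumes "(G has_integral I) S"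
  shows "((\<lambda>\<tau>. inner (G \<tau>) v) has_integral inner I v) S"
  using has_integral_linear[OF assms bounded_linear_inner_left[of v]] by (simp add: o_def)

theorem corollary2p13:
  fixes h f b0 w0 :: torus_l2
    and uh :: "torus_l2 \<times> torus_l2"
    and b1 w1 b2 w2 :: "real \<Rightarrow> torus_l2"
    and T1 T2 :: real
  assumes "h \<in> sobolev0 1"
    and "uh = (1 / 2) *\<^sub>R grad_perp h"
    and "uh \<in> sobolev_div 3"
    and "f \<in> sobolev0 2"
    and "(b0, w0) \<in> sobolev0 3 \<times> sobolev0 2"
    and "local_strong_solution uh f b0 w0 b1 w1 T1"
    and "local_strong_solution uh f b0 w0 b2 w2 T2"
  shows "\<forall>t\<in>{0..min T1 T2}.
    (sobolev_norm 2 (b1 t - b2 t))\<^sup>2 + (sobolev_norm 1 (w1 t - w2 t))\<^sup>2 = 0"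
proof
  define T where "T = min T1 T2"
  obtain \<psi>1 Gb1 Gw1 Gh1 K1 where
    S1: "\<And>\<tau>. \<tau> \<in> {0..T1} \<Longrightarrow> tqg_slice K1 uh f (b1 \<tau>) (w1 \<tau>) (\<psi>1 \<tau>) (Gb1 \<tau>) (Gw1 \<tau>) (Gh1 \<tau>)"
    and I1: "\<And>t. t \<in> {0..T1} \<Longrightarrow> (Gb1 has_integral b0 - b1 t) {0..t}"
      "\<And>t. t \<in> {0..T1} \<Longrightarrow> ((\<lambda>\<tau>. Gw1 \<tau> + Gh1 \<tau>) has_integral w0 - w1 t) {0..t}"
    by (rule local_strong_solution_slices[OF assms(6,4)]) blast
  obtain \<psi>2 Gb2 Gw2 Gh2 K2 where
    S2: "\<And>\<tau>. \<tau> \<in> {0..T2} \<Longrightarrow> tqg_slice K2 uh f (b2 \<tau>) (w2 \<tau>) (\<psi>2 \<tau>) (Gb2 \<tau>) (Gw2 \<tau>) (Gh2 \<tau>)"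
    and I2: "\<And>t. t \<in> {0..T2} \<Longrightarrow> (Gb2 has_integral b0 - b2 t) {0..t}"
      "\<And>t. t \<in> {0..T2} \<Longrightarrow> ((\<lambda>\<tau>. Gw2 \<tau> + Gh2 \<tau>) has_integral w0 - w2 t) {0..t}"
    by (rule local_strong_solution_slices[OF assms(7,4)]) blast
  have c: "continuous_in_sobolev0 3 T1 b1" "continuous_in_sobolev0 3 T2 b2"
    "continuous_in_sobolev0 2 T1 w1" "continuous_in_sobolev0 2 T2 w2" "0 < T"
    using assms(6,7) by (auto simp: local_strong_solution_def T_def)
  have uh: "fst uh \<in> sobolev 3" "snd uh \<in> sobolev 3"
    using assms(3) by (auto simp: sobolev_div_def sobolev0_def)
  \<comment> \<open>One constant for both solutions and for \<open>uh\<close>; its last entry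
    dominates the essential bounds and the L^2 norms of the components of \<open>uh\<close>.\<close>
  define K where "K = max (max K1 K2) (5 * (sobolev_norm 3 (fst uh) + sobolev_norm 3 (snd uh)))"
  have sl: "tqg_slice K uh f (b1 \<tau>) (w1 \<tau>) (\<psi>1 \<tau>) (Gb1 \<tau>) (Gw1 \<tau>) (Gh1 \<tau>)"
    "tqg_slice K uh f (b2 \<tau>) (w2 \<tau>) (\<psi>2 \<tau>) (Gb2 \<tau>) (Gw2 \<tau>) (Gh2 \<tau>)" if "\<tau> \<in> {0..T}" for \<tau>
    using that by (auto simp: T_def K_def intro!: tqg_slice_mono[OF S1] tqg_slice_mono[OF S2])
  have K: "0 \<le> K" using sl(1)[of 0] c(5) by (simp add: tqg_slice_def)
  note nn = sobolev_norm_nonneg[of 3 "fst uh"] sobolev_norm_nonneg[of 3 "snd uh"]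
  have uhK: "ess_bounded K (fst uh)" "ess_bounded K (snd uh)" "norm (fst uh) \<le> K" "norm (snd uh) \<le> K"
    using ess_bounded_mono[OF ess_bounded_sobolev[OF uh(1), of 0 0], of K]
      ess_bounded_mono[OF ess_bounded_sobolev[OF uh(2), of 0 0], of K]
      norm_le_sobolev_norm[OF uh(1)] norm_le_sobolev_norm[OF uh(2)] nn
    by (auto simp: K_def weak_partial_0[OF uh(1)] weak_partial_0[OF uh(2)])

  \<comment> \<open>The differences of the two solutions and their continuity in time\<close>
  define \<beta> \<omega> \<phi> where "\<beta> t = b1 t - b2 t" and "\<omega> t = w1 t - w2 t" and "\<phi> t = \<psi>1 t - \<psi>2 t" for t
  have \<beta>sob: "\<beta> t \<in> sobolev 3" if "t \<in> {0..T}" for t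
    using sl[OF that] by (auto simp: \<beta>_def tqg_slice_def intro: sobolev_diff)
  have helm: "solves_helmholtz (\<omega> t) (\<phi> t)" if "t \<in> {0..T}" for t
    using solves_helmholtz_diff[of "w1 t - f" "\<psi>1 t" "w2 t - f" "\<psi>2 t"] sl[OF that]
    by (auto simp: \<omega>_def \<phi>_def tqg_slice_def)
  then have \<phi>sob: "\<phi> t \<in> sobolev 2" if "t \<in> {0..T}" for t
    using that by (auto simp: solves_helmholtz_def)

  have sub: "{0..T} \<subseteq> {0..T1}" "{0..T} \<subseteq> {0..T2}" by (auto simp: T_def)
  have \<beta>c: "continuous_on {0..T} (\<lambda>t. weak_partial \<alpha> (\<beta> t))" if "\<alpha> \<in> multi_indices 3" for \<alpha>
  proof (rule continuous_on_eq)
    show "continuous_on {0..T} (\<lambda>t. weak_partial \<alpha> (b1 t) - weak_partial \<alpha> (b2 t))"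
      by (intro continuous_on_diff continuous_on_subset[OF _ sub(1)] continuous_on_subset[OF _ sub(2)]
          continuous_on_weak_partial[OF c(1) that] continuous_on_weak_partial[OF c(2) that])
    show "weak_partial \<alpha> (b1 t) - weak_partial \<alpha> (b2 t) = weak_partial \<alpha> (\<beta> t)" if "t \<in> {0..T}" for t
      using sl[OF that] weak_partial_diff[OF _ _ \<open>\<alpha> \<in> multi_indices 3\<close>] by (simp add: \<beta>_def tqg_slice_def)
  qed
  have \<omega>c: "continuous_on {0..T} \<omega>"
  proof (rule continuous_on_eq)
    have "(0, 0) \<in> multi_indices 2" by (simp add: multi_indices_def)
    then show "continuous_on {0..T} (\<lambda>t. weak_partial (0, 0) (w1 t) - weak_partial (0, 0) (w2 t))"
      by (intro continuous_on_diff continuous_on_subset[OF _ sub(1)] continuous_on_subset[OF _ sub(2)]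
          continuous_on_weak_partial[OF c(3)] continuous_on_weak_partial[OF c(4)])
    show "weak_partial (0, 0) (w1 t) - weak_partial (0, 0) (w2 t) = \<omega> t" if "t \<in> {0..T}" for t
      using sl[OF that] by (simp add: \<omega>_def tqg_slice_def weak_partial_0[of _ 2])
  qed
  \<comment> \<open>Each derivative of order at most 2 of the elliptic solution is bounded in L^2 by
    the right-hand side, so continuity passes from \<omega> to \<phi>.\<close>
  have \<phi>c: "continuous_on {0..T} (\<lambda>t. weak_partial \<alpha> (\<phi> t))" if \<alpha>: "\<alpha> \<in> multi_indices 2" for \<alpha>
    unfolding continuous_on_iff
  proof (intro ballI allI impI)
    fix t and e :: real assume t: "t \<in> {0..T}" and "0 < e"
    then obtain d where d: "d > 0" "\<And>s. s \<in> {0..T} \<Longrightarrow> dist s t < d \<Longrightarrow> dist (\<omega> s) (\<omega> t) < e"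
      using \<omega>c unfolding continuous_on_iff by meson
    have "dist (weak_partial \<alpha> (\<phi> s)) (weak_partial \<alpha> (\<phi> t)) < e" if s: "s \<in> {0..T}" "dist s t < d" for s
    proof -
      have "weak_partial \<alpha> (\<phi> s) - weak_partial \<alpha> (\<phi> t) = weak_partial \<alpha> (\<phi> s - \<phi> t)"
        using weak_partial_diff[OF \<phi>sob[OF s(1)] \<phi>sob[OF t] \<alpha>] by simp
      moreover have "norm (weak_partial \<alpha> (\<phi> s - \<phi> t)) \<le> norm (\<omega> s - \<omega> t)"
        by (rule norm_stream_le[OF solves_helmholtz_diff[OF helm[OF s(1)] helm[OF t]] \<alpha>])
      ultimately show ?thesis
        using d(2)[OF s] by (simp add: dist_norm)
    qed
    then show "\<exists>d>0. \<forall>s\<in>{0..T}. dist s t < d \<longrightarrow> dist (weak_partial \<alpha> (\<phi> s)) (weak_partial \<alpha> (\<phi> t)) < e"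
      using d(1) by blast
  qed

  define \<beta>x \<beta>y \<phi>x \<phi>y where "\<beta>x t = weak_partial (1, 0) (\<beta> t)" and "\<beta>y t = weak_partial (0, 1) (\<beta> t)"
    and "\<phi>x t = weak_partial (1, 0) (\<phi> t)" and "\<phi>y t = weak_partial (0, 1) (\<phi> t)" for t
  have deriv: "dx.deriv_of (\<beta> s - \<beta> t) (\<beta>x s - \<beta>x t)" "dy.deriv_of (\<beta> s - \<beta> t) (\<beta>y s - \<beta>y t)"
    "dx.deriv_of (\<phi> s - \<phi> t) (\<phi>x s - \<phi>x t)" "dy.deriv_of (\<phi> s - \<phi> t) (\<phi>y s - \<phi>y t)"
    if "s \<in> {0..T}" "t \<in> {0..T}" for s t
  proof -
    have sob: "\<beta> s \<in> sobolev 2" "\<beta> t \<in> sobolev 2" "\<phi> s \<in> sobolev 2" "\<phi> t \<in> sobolev 2"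
      using \<beta>sob \<phi>sob that sobolev_mono[of _ 3 2] by auto
    show "dx.deriv_of (\<beta> s - \<beta> t) (\<beta>x s - \<beta>x t)" "dy.deriv_of (\<beta> s - \<beta> t) (\<beta>y s - \<beta>y t)"
      "dx.deriv_of (\<phi> s - \<phi> t) (\<phi>x s - \<phi>x t)" "dy.deriv_of (\<phi> s - \<phi> t) (\<phi>y s - \<phi>y t)"
      using sobolev2_deriv_of(1,2)[OF sobolev_diff[OF sob(1,2)]] sobolev2_deriv_of(1,2)[OF sobolev_diff[OF sob(3,4)]]
        weak_partial_diff[OF sob(1,2)] weak_partial_diff[OF sob(3,4)]
      by (simp_all add: \<beta>x_def \<beta>y_def \<phi>x_def \<phi>y_def multi_indices_def)
  qed

  \<comment> \<open>Written through \<beta> and \<omega>, for which the equations provide time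
    integrals; the elliptic identity turns it into a sum of squares.\<close>
  define Z where "Z t = inner (\<beta> t) (\<beta> t) - inner (\<omega> t) (\<phi> t)" for t
  have Z: "Z t = (norm (\<beta> t))\<^sup>2 + (norm (\<phi> t))\<^sup>2 + (norm (\<phi>x t))\<^sup>2 + (norm (\<phi>y t))\<^sup>2" if "t \<in> {0..T}" for t
    using inner_helmholtz[OF helm helm, OF that that]
    by (simp add: Z_def \<phi>x_def \<phi>y_def power2_norm_eq_inner)
  have Zc: "continuous_on {0..T} Z"
  proof -
    have "continuous_on {0..T} \<beta>"
      by (rule continuous_on_eq[OF \<beta>c[of "(0, 0)"]]) (simp_all add: multi_indices_def weak_partial_0[OF \<beta>sob])
    moreover have "continuous_on {0..T} \<phi>"
      by (rule continuous_on_eq[OF \<phi>c[of "(0, 0)"]]) (simp_all add: multi_indices_def weak_partial_0[OF \<phi>sob])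
    ultimately show ?thesis
      unfolding Z_def by (intro continuous_intros \<omega>c)
  qed

  \<comment> \<open>Formally half the derivative of \<open>Z\<close> when \<open>v\<close> and
    \<open>y\<close> are \<beta> and \<phi> at time \<tau>. It is linear in the pair, so it can also
    be evaluated at the values of other times.\<close>
  define L where "L \<tau> v y = - inner (Gb1 \<tau> - Gb2 \<tau>) v + inner ((Gw1 \<tau> + Gh1 \<tau>) - (Gw2 \<tau> + Gh2 \<tau>)) y" for \<tau> v y
  have L_energy: "L \<tau> (\<beta> \<tau>) (\<phi> \<tau>) \<le> 10 * K * Z \<tau>" if "\<tau> \<in> {0..T}" for \<tau>
    using tqg_energy_estimate[OF sl[OF that] uhK(1,2)] Z[OF that]
    by (simp add: L_def \<beta>_def \<phi>_def \<phi>x_def \<phi>y_def)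
  \<comment> \<open>12 = 2 + 2 + 4 + 4: two pairings with \<beta>, two with \<phi>, each against two
    gradient components of size at most e.\<close>
  have L_bound: "L \<tau> (\<beta> s - \<beta> \<tau>) (\<phi> s - \<phi> \<tau>) \<le> 12 * K\<^sup>2 * e"
    if "\<tau> \<in> {0..T}" "s \<in> {0..T}" "norm (\<beta>x s - \<beta>x \<tau>) \<le> e" "norm (\<beta>y s - \<beta>y \<tau>) \<le> e"
      "norm (\<phi>x s - \<phi>x \<tau>) \<le> e" "norm (\<phi>y s - \<phi>y \<tau>) \<le> e" for \<tau> s e
  proof -
    note d = deriv[OF that(2,1)]
    have n: "K\<^sup>2 * (norm (\<beta>x s - \<beta>x \<tau>) + norm (\<beta>y s - \<beta>y \<tau>)) \<le> K\<^sup>2 * (2 * e)"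
      "2 * K\<^sup>2 * (norm (\<phi>x s - \<phi>x \<tau>) + norm (\<phi>y s - \<phi>y \<tau>)) \<le> 2 * K\<^sup>2 * (2 * e)"
      using that(3-6) by (intro mult_left_mono; simp)+
    have "\<bar>inner (Gb1 \<tau>) (\<beta> s - \<beta> \<tau>)\<bar> \<le> K\<^sup>2 * (2 * e)" "\<bar>inner (Gb2 \<tau>) (\<beta> s - \<beta> \<tau>)\<bar> \<le> K\<^sup>2 * (2 * e)"
      "\<bar>inner (Gw1 \<tau> + Gh1 \<tau>) (\<phi> s - \<phi> \<tau>)\<bar> \<le> 2 * K\<^sup>2 * (2 * e)"
      "\<bar>inner (Gw2 \<tau> + Gh2 \<tau>) (\<phi> s - \<phi> \<tau>)\<bar> \<le> 2 * K\<^sup>2 * (2 * e)"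
      using tqg_slice_flux_bound[OF sl(1)[OF that(1)] uhK(3,4) d(1,2)]
        tqg_slice_flux_bound[OF sl(2)[OF that(1)] uhK(3,4) d(1,2)]
        tqg_slice_flux_bound[OF sl(1)[OF that(1)] uhK(3,4) d(3,4)]
        tqg_slice_flux_bound[OF sl(2)[OF that(1)] uhK(3,4) d(3,4)] n
      by linarith+
    then show ?thesis
      unfolding L_def inner_diff_left[of _ _ "\<beta> s - \<beta> \<tau>"] inner_diff_left[of _ _ "\<phi> s - \<phi> \<tau>"]
      by linarith
  qed

  \<comment> \<open>The test functions are the sums of the values at s and t. They do not depend on
    \<tau>, so the integrated equations can be paired with them.\<close>
  have increment: "Z t - Z s \<le> (t - s) * B"
    if st: "0 \<le> s" "s \<le> t" "t \<le> T" and B: "\<And>\<tau>. \<tau> \<in> {s..t} \<Longrightarrow> L \<tau> (\<beta> t + \<beta> s) (\<phi> t + \<phi> s) \<le> B" for s t B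
  proof -
    define F where "F r = inner (\<beta> r) (\<beta> t + \<beta> s) - inner (\<omega> r) (\<phi> t + \<phi> s)" for r
    have "((\<lambda>\<tau>. L \<tau> (\<beta> t + \<beta> s) (\<phi> t + \<phi> s)) has_integral F r) {0..r}" if "r \<in> {0..T}" for r
    proof -
      have r: "r \<in> {0..T1}" "r \<in> {0..T2}" using that sub by auto
      have F: "F r = - (inner (b0 - b1 r) (\<beta> t + \<beta> s) - inner (b0 - b2 r) (\<beta> t + \<beta> s)) +
          (inner (w0 - w1 r) (\<phi> t + \<phi> s) - inner (w0 - w2 r) (\<phi> t + \<phi> s))"
        unfolding F_def \<beta>_def[of r] \<omega>_def[of r] inner_diff_left by simp
      show ?thesis
        unfolding F L_def inner_diff_left[of "Gb1 _"] inner_diff_left[of "Gw1 _ + Gh1 _"]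
        by (intro has_integral_add has_integral_neg has_integral_diff has_integral_inner_left I1 I2 r)
    qed
    then have "F t - F s \<le> (t - s) * B"
      by (rule integral_increment_le) (use st B in auto)
    \<comment> \<open>Symmetry of the elliptic form cancels the cross terms between the two
      times.\<close>
    moreover have "inner (\<omega> t) (\<phi> s) = inner (\<omega> s) (\<phi> t)"
      using inner_helmholtz[OF helm[of t] helm[of s]] inner_helmholtz[OF helm[of s] helm[of t]] st
      by (simp add: inner_commute)
    ultimately show ?thesis
      by (simp add: F_def Z_def inner_add_right inner_commute)
  qed

  have Z_le: "Z t \<le> 0" if "t \<in> {0..T}" for t
  proof (rule discrete_gronwall[of T "20 * K" Z, OF _ _ _ _ that])
    \<comment> \<open>At time 0 the integrals run over a single point, so both solutions start from
      the common initial values.\<close>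
    have zero: "x = 0" if "(G has_integral x) {0..0}" for G :: "real \<Rightarrow> torus_l2" and x
      using that has_integral_unique[OF _ has_integral_refl(2)] by simp
    have "b1 0 = b0" "b2 0 = b0" "w1 0 = w0" "w2 0 = w0"
      using zero[OF I1(1)[of 0]] zero[OF I2(1)[of 0]] zero[OF I1(2)[of 0]] zero[OF I2(2)[of 0]] c(5)
      by (simp_all add: T_def)
    then show "Z 0 \<le> 0" by (simp add: Z_def \<beta>_def \<omega>_def)
    fix e :: real assume e: "e > 0"
    \<comment> \<open>Two errors must fit into e: 20 K e1 from replacing \<open>Z\<close> at \<tau>
      by \<open>Z\<close> at s, and 12 K^2 e1 for each endpoint. The summand 1 keeps the divisor
      positive.\<close>
    define e1 where "e1 = e / (20 * K + 24 * K\<^sup>2 + 1)"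
    have pos: "20 * K + 24 * K\<^sup>2 + 1 > 0" using K by (intro add_nonneg_pos) auto
    have e1: "e1 > 0" using e pos by (simp add: e1_def)
    have e1_le: "20 * K * e1 + 24 * K\<^sup>2 * e1 \<le> e"
    proof -
      have "e1 * (20 * K + 24 * K\<^sup>2 + 1) = e"
        using pos unfolding e1_def by simp
      then show ?thesis
        using e1 by (simp add: algebra_simps)
    qed
    \<comment> \<open>Taken as one tuple, so that a single \<open>d\<close> serves the energy and
      all four gradient components.\<close>
    have "continuous_on {0..T} (\<lambda>t. (Z t, \<beta>x t, \<beta>y t, \<phi>x t, \<phi>y t))"
      unfolding \<beta>x_def \<beta>y_def \<phi>x_def \<phi>y_def
      by (intro continuous_intros Zc \<beta>c \<phi>c) (auto simp: multi_indices_def)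
    then have "uniformly_continuous_on {0..T} (\<lambda>t. (Z t, \<beta>x t, \<beta>y t, \<phi>x t, \<phi>y t))"
      by (rule compact_uniformly_continuous) simp
    then obtain d where d: "d > 0" and D: "\<And>s t. s \<in> {0..T} \<Longrightarrow> t \<in> {0..T} \<Longrightarrow> dist s t < d \<Longrightarrow>
        dist (Z s, \<beta>x s, \<beta>y s, \<phi>x s, \<phi>y s) (Z t, \<beta>x t, \<beta>y t, \<phi>x t, \<phi>y t) < e1"
      using e1 unfolding uniformly_continuous_on_def by meson
    have near: "\<bar>Z s - Z t\<bar> \<le> e1 \<and> norm (\<beta>x s - \<beta>x t) \<le> e1 \<and> norm (\<beta>y s - \<beta>y t) \<le> e1 \<and>
        norm (\<phi>x s - \<phi>x t) \<le> e1 \<and> norm (\<phi>y s - \<phi>y t) \<le> e1"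
      if "s \<in> {0..T}" "t \<in> {0..T}" "\<bar>s - t\<bar> < d" for s t
    proof -
      have pair: "dist a a' \<le> dist (a, b) (a', b')" "dist b b' \<le> dist (a, b) (a', b')"
        for a a' :: "'a :: metric_space" and b b' :: "'b :: metric_space"
        using dist_fst_le[of "(a, b)" "(a', b')"] dist_snd_le[of "(a, b)" "(a', b')"] by simp_all
      have "dist (Z s, \<beta>x s, \<beta>y s, \<phi>x s, \<phi>y s) (Z t, \<beta>x t, \<beta>y t, \<phi>x t, \<phi>y t) < e1"
        using that by (intro D) (auto simp: dist_real_def)
      then have "dist (Z s) (Z t) < e1" "dist (\<beta>x s) (\<beta>x t) < e1" "dist (\<beta>y s) (\<beta>y t) < e1"
        "dist (\<phi>x s) (\<phi>x t) < e1" "dist (\<phi>y s) (\<phi>y t) < e1"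
        by (meson pair order_le_less_trans)+
      then show ?thesis by (simp add: dist_norm less_imp_le)
    qed
    show "\<exists>d>0. \<forall>s t. 0 \<le> s \<longrightarrow> s \<le> t \<longrightarrow> t \<le> T \<longrightarrow> t - s < d \<longrightarrow> Z t - Z s \<le> (t - s) * (20 * K * Z s + e)"
    proof (intro exI[of _ d] conjI d allI impI)
      fix s t assume st: "0 \<le> s" "s \<le> t" "t \<le> T" "t - s < d"
      show "Z t - Z s \<le> (t - s) * (20 * K * Z s + e)"
      proof (rule increment[OF st(1-3)])
        fix \<tau> assume \<tau>: "\<tau> \<in> {s..t}"
        then have m: "s \<in> {0..T}" "t \<in> {0..T}" "\<tau> \<in> {0..T}" "\<bar>t - \<tau>\<bar> < d" "\<bar>s - \<tau>\<bar> < d"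
          using st by auto
        \<comment> \<open>Both endpoint values are compared with the value at \<tau>, which makes
          the energy term appear twice and turns 10 K into 20 K.\<close>
        have "L \<tau> (\<beta> t + \<beta> s) (\<phi> t + \<phi> s) =
            2 * L \<tau> (\<beta> \<tau>) (\<phi> \<tau>) + L \<tau> (\<beta> t - \<beta> \<tau>) (\<phi> t - \<phi> \<tau>) + L \<tau> (\<beta> s - \<beta> \<tau>) (\<phi> s - \<phi> \<tau>)"
          by (simp add: L_def inner_add_right inner_diff_right)
        also have "\<dots> \<le> 2 * (10 * K * Z \<tau>) + 12 * K\<^sup>2 * e1 + 12 * K\<^sup>2 * e1"
          using near[OF m(2,3,4)] near[OF m(1,3,5)]
          by (intro add_mono mult_left_mono L_energy L_bound m) auto
        also have "10 * K * Z \<tau> \<le> 10 * K * (Z s + e1)"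
          using near[OF m(1,3,5)] K by (intro mult_left_mono) auto
        finally show "L \<tau> (\<beta> t + \<beta> s) (\<phi> t + \<phi> s) \<le> 20 * K * Z s + e"
          using e1_le by (simp add: algebra_simps)
      qed
    qed
  qed (use K c(5) in auto)

  fix t assume "t \<in> {0..min T1 T2}"
  then have t: "t \<in> {0..T}" by (simp add: T_def)
  \<comment> \<open>A sum of squares that is at most zero vanishes termwise. With \<phi> also
    \<omega> = (Delta - 1)\<phi> is the zero class, and the zero class has zero norm in every
    Sobolev space; so the weaker energy settles the stronger norms.\<close>
  have "(norm (\<beta> t))\<^sup>2 \<le> 0" "(norm (\<phi> t))\<^sup>2 \<le> 0"
    using Z_le[OF t] unfolding Z[OF t]
    using zero_le_power2[of "norm (\<beta> t)"] zero_le_power2[of "norm (\<phi> t)"]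
      zero_le_power2[of "norm (\<phi>x t)"] zero_le_power2[of "norm (\<phi>y t)"] by linarith+
  then have "\<beta> t = 0" "\<phi> t = 0" by simp_all
  moreover have "\<omega> t = 0"
    using helm[OF t] \<open>\<phi> t = 0\<close> by (auto simp: solves_helmholtz_def laplacian_def weak_partial_zero)
  ultimately show "(sobolev_norm 2 (b1 t - b2 t))\<^sup>2 + (sobolev_norm 1 (w1 t - w2 t))\<^sup>2 = 0"
    by (simp add: \<beta>_def \<omega>_def sobolev_norm_zero)
qed

end
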